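(* Let $\gamma>2$, $n\in\mathbb{N}$ with $n\ge\gamma$, and let $(u,\mu)$ be a weak conservative solution of the Hunter--Saxton equation with $\int_{\mathbb{R}}(1+|x|^\gamma)d\mu(0,x)<\infty$; let $T>0$. Then the function $\chi(t,\cdot)$ satisfies, for almost all $t\in[0,T]$, the differential equation $$\chi_t(t,\eta)+h(t,\eta)\chi_\eta(t,\eta)=\mathcal{U}(t,\eta)$$ in $L^\gamma([0,B+C])$, where $h(t,\eta)=\mathcal{U}\mathcal{P}(t,\eta)-\int_0^{B+C}\mathcal{U}(t,\tilde\eta)K(\chi(t,\eta)-\chi(t,\tilde\eta))(1-\mathcal{P}\chi_\eta(t,\tilde\eta))d\tilde\eta$. Furthermore, the map $t\mapsto\chi(t,\cdot)$ is continuous from $[0,T]$ into $L^\gamma([0,B+C])$.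
   Context: The Hunter--Saxton equation is $u_t+uu_x=\tfrac14\big(\int_{-\infty}^x d\mu(t,z)-\int_x^{\infty}d\mu(t,z)\big)$, $\mu_t+(u\mu)_x=0$. Fix $\psi^\pm\in C^\infty(\mathbb{R})$ with $\psi^++\psi^-\equiv1$, $0\le\psi^\pm\le1$, $\operatorname{supp}\psi^-\subset(-\infty,1)$, $\operatorname{supp}\psi^+\subset(-1,\infty)$. $E_1=\{\bar f+a\psi^+:\bar f\in H^1,a\in\mathbb{R}\}$, $E_2=\{\bar f+a\psi^++b\psi^-:\bar f\in H^1,a,b\in\mathbb{R}\}$; $E_1^0,E_2^0$ analogously with $\bar f\in L^2$, normed by $(\|\bar f\|_{L^2}^2+a^2)^{1/2}$ resp. $(\|\bar f\|_{L^2}^2+a^2+b^2)^{1/2}$. $\mathcal{D}$: pairs $(u,\mu)$, $u\in E_2$, $\mu$ positive finite Radon measure, $\mu((-\infty,\cdot))\in E_1^0$, $d\mu_{\rm ac}=u_x^2dx$. A weak conservative solution with initial data in $\mathcal{D}$ is a pair $(u,\mu)$ with: (i) $u(t,\cdot)\in E_2$; (ii) $\mu(t,(-\infty,\cdot))\in E_1^0$, $d\mu_{\rm ac}(t)=u_x^2(t,\cdot)dx$; (iii) for all $\phi\in C_c^\infty([0,\infty)\times\mathbb{R})$: $\int_0^\infty\!\int[u\phi_t+\tfrac12u^2\phi_x+\tfrac14(\int_{-\infty}^xd\mu(t)-\int_x^\infty d\mu(t))\phi]dxdt=-\int u\phi|_{t=0}dx$ and $\int_0^\infty\!\int(\phi_t+u\phi_x)d\mu(t)dt=-\int\phi|_{t=0}d\mu(0)$;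 (iv) for every $T>0$, $u$ Hölder continuous on $[0,T]\times\mathbb{R}$ and $t\mapsto u(t,\cdot)$ Lipschitz $[0,T]\to E_2^0$; (v) for a.e. $t$, $\mu(t)$ absolutely continuous with density $u_x^2(t,\cdot)$; (vi) $t\mapsto\mu(t)$ weakly continuous. $C=\mu(t,\mathbb{R})$ (independent of $t$). $K(x)=(1+x^2)^{-n}$, $p(t,x)=\int K(x-y)d\mu(t,y)$, $B=\int_{\mathbb{R}}p(t,x)dx$ (independent of $t$), $G(t,x)=\int_{-\infty}^xp(t,y)dy+\mu(t,(-\infty,x))$, $\chi(t,\eta)=\sup\{x\mid G(t,x)<\eta\}$ for $\eta\in[0,B+C]$, $\mathcal{U}(t,\eta)=u(t,\chi(t,\eta))$, $\mathcal{P}(t,\eta)=p(t,\chi(t,\eta))$; $\chi_\eta$ is the a.e. derivative of the nondecreasing function $\chi(t,\cdot)$. *)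

theory Defs
  imports "HOL-Analysis.Analysis"
begin

definition L2 :: "(real \<Rightarrow> real) \<Rightarrow> bool" where
  "L2 f \<longleftrightarrow> f \<in> borel_measurable borel \<and> integrable lborel (\<lambda>x. (f x)\<^sup>2)"

text \<open>H^1(R), represented by the absolutely continuous representative: f in L2 and
  f(y) - f(x) is the integral over [x,y] of a weak derivative g in L2.\<close>
definition H1 :: "(real \<Rightarrow> real) \<Rightarrow> bool" where
  "H1 f \<longleftrightarrow> L2 f \<and> (\<exists>g. L2 g \<and> (\<forall>x y. x \<le> y \<longrightarrow>
      set_integrable lborel {x..y} g \<and> f y - f x = (LINT s:{x..y}|lborel. g s)))"

definition smooth1 :: "(real \<Rightarrow> real) \<Rightarrow> bool" where
  "smooth1 f \<longleftrightarrow> (\<exists>S. f \<in> S \<and> (\<forall>g\<in>S. \<exists>g'\<in>S. \<forall>x. (g has_real_derivative g' x) (at x)))"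

text \<open>Smooth functions of (t,x): all iterated partial derivatives exist and are continuous.\<close>
definition smooth2 :: "(real \<Rightarrow> real \<Rightarrow> real) \<Rightarrow> bool" where
  "smooth2 f \<longleftrightarrow> (\<exists>S. f \<in> S \<and> (\<forall>g\<in>S. continuous_on UNIV (\<lambda>(t,x). g t x) \<and>
      (\<exists>g1\<in>S. \<exists>g2\<in>S. \<forall>t x. ((\<lambda>s. g s x) has_real_derivative g1 t x) (at t) \<and>
                             ((\<lambda>y. g t y) has_real_derivative g2 t x) (at x))))"

text \<open>Test functions in C_c^infinity([0,infinity) x R): restrictions of compactly supported
  smooth functions on R^2.\<close>
definition test_fun :: "(real \<Rightarrow> real \<Rightarrow> real) \<Rightarrow> bool" where
  "test_fun \<phi> \<longleftrightarrow> smooth2 \<phi> \<and> bounded {(t,x). \<phi> t x \<noteq> 0}"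

definition cutoff_pair :: "(real \<Rightarrow> real) \<Rightarrow> (real \<Rightarrow> real) \<Rightarrow> bool" where
  "cutoff_pair \<psi>p \<psi>m \<longleftrightarrow> smooth1 \<psi>p \<and> smooth1 \<psi>m \<and> (\<forall>x. \<psi>p x + \<psi>m x = 1) \<and>
     (\<forall>x. 0 \<le> \<psi>p x \<and> \<psi>p x \<le> 1 \<and> 0 \<le> \<psi>m x \<and> \<psi>m x \<le> 1) \<and>
     closure {x. \<psi>m x \<noteq> 0} \<subseteq> {..<1} \<and> closure {x. \<psi>p x \<noteq> 0} \<subseteq> {-1<..}"

definition inE2 :: "(real \<Rightarrow> real) \<Rightarrow> (real \<Rightarrow> real) \<Rightarrow> (real \<Rightarrow> real) \<Rightarrow> bool" where
  "inE2 \<psi>p \<psi>m f \<longleftrightarrow> (\<exists>fb a b. H1 fb \<and> (\<forall>x. f x = fb x + a * \<psi>p x + b * \<psi>m x))"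

definition inE1_0 :: "(real \<Rightarrow> real) \<Rightarrow> (real \<Rightarrow> real) \<Rightarrow> bool" where
  "inE1_0 \<psi>p f \<longleftrightarrow> (\<exists>fb a. L2 fb \<and> (\<forall>x. f x = fb x + a * \<psi>p x))"

text \<open>f lies in E_2^0 and its E_2^0 norm is at most r (the decomposition is unique).\<close>
definition E2_0_norm_le :: "(real \<Rightarrow> real) \<Rightarrow> (real \<Rightarrow> real) \<Rightarrow> (real \<Rightarrow> real) \<Rightarrow> real \<Rightarrow> bool" where
  "E2_0_norm_le \<psi>p \<psi>m f r \<longleftrightarrow> (\<exists>fb a b. L2 fb \<and> (\<forall>x. f x = fb x + a * \<psi>p x + b * \<psi>m x) \<and>
      sqrt ((\<integral>x. (fb x)\<^sup>2 \<partial>lborel) + a\<^sup>2 + b\<^sup>2) \<le> r)"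

definition HS_weak_conservative ::
  "(real \<Rightarrow> real) \<Rightarrow> (real \<Rightarrow> real) \<Rightarrow> (real \<Rightarrow> real \<Rightarrow> real) \<Rightarrow> (real \<Rightarrow> real measure) \<Rightarrow> bool" where
  "HS_weak_conservative \<psi>p \<psi>m u \<mu> \<longleftrightarrow>
     \<comment> \<open>mu(t) positive finite (Radon) measures on R\<close>
     (\<forall>t\<ge>0. sets (\<mu> t) = sets borel \<and> emeasure (\<mu> t) UNIV < \<infinity>) \<and>
     \<comment> \<open>(i)\<close>
     (\<forall>t\<ge>0. inE2 \<psi>p \<psi>m (u t)) \<and>
     \<comment> \<open>(ii): distribution function in E_1^0 and absolutely continuous part u_x^2 dx\<close>
     (\<forall>t\<ge>0. inE1_0 \<psi>p (\<lambda>x. measure (\<mu> t) {..<x}) \<and>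
        (\<exists>N \<in> sets borel. emeasure lborel N = 0 \<and>
           (\<forall>A \<in> sets borel. emeasure (\<mu> t) A =
               emeasure (\<mu> t) (A \<inter> N) + (\<integral>\<^sup>+ x\<in>A. ennreal ((deriv (u t) x)\<^sup>2) \<partial>lborel)))) \<and>
     \<comment> \<open>(iii): weak formulation\<close>
     (\<forall>\<phi>. test_fun \<phi> \<longrightarrow>
        (LINT t:{0..}|lborel. (\<integral>x. u t x * deriv (\<lambda>s. \<phi> s x) t
              + (1/2) * (u t x)\<^sup>2 * deriv (\<lambda>y. \<phi> t y) x
              + (1/4) * (measure (\<mu> t) {..<x} - measure (\<mu> t) {x<..}) * \<phi> t x \<partial>lborel))
          = - (\<integral>x. u 0 x * \<phi> 0 x \<partial>lborel)
      \<and> (LINT t:{0..}|lborel. (\<integral>x. deriv (\<lambda>s. \<phi> s x) t + u t x * deriv (\<lambda>y. \<phi> t y) x \<partial>\<mu> t))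
          = - (\<integral>x. \<phi> 0 x \<partial>\<mu> 0)) \<and>
     \<comment> \<open>(iv): Hoelder continuity and Lipschitz continuity into E_2^0\<close>
     (\<forall>T>0. (\<exists>\<alpha> M. 0 < \<alpha> \<and> \<alpha> \<le> 1 \<and> (\<forall>t\<in>{0..T}. \<forall>s\<in>{0..T}. \<forall>x y.
                 \<bar>u t x - u s y\<bar> \<le> M * (sqrt ((t - s)\<^sup>2 + (x - y)\<^sup>2)) powr \<alpha>)) \<and>
            (\<exists>L. \<forall>t\<in>{0..T}. \<forall>s\<in>{0..T}. E2_0_norm_le \<psi>p \<psi>m (\<lambda>x. u t x - u s x) (L * \<bar>t - s\<bar>))) \<and>
     \<comment> \<open>(v)\<close>
     (AE t in lborel. t \<ge> 0 \<longrightarrow> \<mu> t = density lborel (\<lambda>x. ennreal ((deriv (u t) x)\<^sup>2))) \<and>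
     \<comment> \<open>(vi): weak continuity of t \<mapsto> mu(t)\<close>
     (\<forall>f::real \<Rightarrow> real. continuous_on UNIV f \<and> bounded (range f) \<longrightarrow>
        continuous_on {0..} (\<lambda>t. \<integral>x. f x \<partial>\<mu> t))"

definition Kn :: "nat \<Rightarrow> real \<Rightarrow> real" where
  "Kn n x = 1 / (1 + x\<^sup>2) ^ n"

definition pHS :: "nat \<Rightarrow> (real \<Rightarrow> real measure) \<Rightarrow> real \<Rightarrow> real \<Rightarrow> real" where
  "pHS n \<mu> t x = (\<integral>y. Kn n (x - y) \<partial>\<mu> t)"

definition BHS :: "nat \<Rightarrow> (real \<Rightarrow> real measure) \<Rightarrow> real" where
  "BHS n \<mu> = (\<integral>x. pHS n \<mu> 0 x \<partial>lborel)"

definition CHS :: "(real \<Rightarrow> real measure) \<Rightarrow> real" where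
  "CHS \<mu> = measure (\<mu> 0) UNIV"

definition GHS :: "nat \<Rightarrow> (real \<Rightarrow> real measure) \<Rightarrow> real \<Rightarrow> real \<Rightarrow> real" where
  "GHS n \<mu> t x = (LINT y:{..x}|lborel. pHS n \<mu> t y) + measure (\<mu> t) {..<x}"

definition chiHS :: "nat \<Rightarrow> (real \<Rightarrow> real measure) \<Rightarrow> real \<Rightarrow> real \<Rightarrow> real" where
  "chiHS n \<mu> t \<eta> = Sup {x. GHS n \<mu> t x < \<eta>}"

definition UHS :: "nat \<Rightarrow> (real \<Rightarrow> real \<Rightarrow> real) \<Rightarrow> (real \<Rightarrow> real measure) \<Rightarrow> real \<Rightarrow> real \<Rightarrow> real" where
  "UHS n u \<mu> t \<eta> = u t (chiHS n \<mu> t \<eta>)"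

definition PHS :: "nat \<Rightarrow> (real \<Rightarrow> real measure) \<Rightarrow> real \<Rightarrow> real \<Rightarrow> real" where
  "PHS n \<mu> t \<eta> = pHS n \<mu> t (chiHS n \<mu> t \<eta>)"

text \<open>chi_eta: the a.e. derivative of the nondecreasing function chi(t,.)\<close>
definition chi_eta :: "nat \<Rightarrow> (real \<Rightarrow> real measure) \<Rightarrow> real \<Rightarrow> real \<Rightarrow> real" where
  "chi_eta n \<mu> t \<eta> = deriv (chiHS n \<mu> t) \<eta>"

definition hHS :: "nat \<Rightarrow> (real \<Rightarrow> real \<Rightarrow> real) \<Rightarrow> (real \<Rightarrow> real measure) \<Rightarrow> real \<Rightarrow> real \<Rightarrow> real" where
  "hHS n u \<mu> t \<eta> = UHS n u \<mu> t \<eta> * PHS n \<mu> t \<eta>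
     - (LINT \<eta>':{0..BHS n \<mu> + CHS \<mu>}|lborel.
          UHS n u \<mu> t \<eta>' * Kn n (chiHS n \<mu> t \<eta> - chiHS n \<mu> t \<eta>')
            * (1 - PHS n \<mu> t \<eta>' * chi_eta n \<mu> t \<eta>'))"

definition Lp_on :: "real \<Rightarrow> real set \<Rightarrow> (real \<Rightarrow> real) \<Rightarrow> bool" where
  "Lp_on \<gamma> S f \<longleftrightarrow> set_borel_measurable lborel S f \<and>
      (\<integral>\<^sup>+ x\<in>S. ennreal (\<bar>f x\<bar> powr \<gamma>) \<partial>lborel) < \<infinity>"

definition Lp_dist_pow :: "real \<Rightarrow> real set \<Rightarrow> (real \<Rightarrow> real) \<Rightarrow> (real \<Rightarrow> real) \<Rightarrow> ennreal" where
  "Lp_dist_pow \<gamma> S f g = (\<integral>\<^sup>+ x\<in>S. ennreal (\<bar>f x - g x\<bar> powr \<gamma>) \<partial>lborel)"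

end

theory Submission
  imports Defs
begin

text \<open>The second weak equation is only tested against functions of the form
  \<open>a(t) \<theta>(x - c t)\<close>, with \<open>a\<close> and \<open>\<theta>\<close> made from the smooth step \<open>\<psi>\<^sup>+\<close>. Letting \<open>a\<close> tend to an
  indicator function gives the balance law
  \<open>\<integral> \<theta>(x - c t) d\<mu>(t) - \<integral> \<theta> d\<mu>(0) = \<integral>\<^sub>0\<^sup>t \<integral> (u - c) \<theta>'(x - c s) d\<mu>(s) ds\<close>,
  which superposition and mollification extend to every \<open>\<theta>\<close> whose derivative is continuous, bounded
  and integrable. In a frame moving faster (slower) than \<open>u\<close> the right-hand side has a sign for
  increasing \<open>\<theta>\<close>, so \<open>\<mu>(t,(-\<infinity>,x))\<close> is controlled along straight lines, while \<open>\<theta>' = K\<close> controls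
  \<open>\<integral>\<^sub>-\<^sub>\<infinity>\<^sup>x p\<close>. Globally this yields \<open>\<bar>\<chi>(t,\<eta>) - \<chi>(s,\<eta>)\<bar> \<le> M \<bar>t - s\<bar>\<close> with \<open>M\<close> a bound of \<open>\<bar>u\<bar>\<close>. Near a
  point \<open>(t, \<chi>(t,\<eta>))\<close> it says that \<open>G\<close> grows at rate \<open>h \<plusminus> \<epsilon>\<close> along lines of slope \<open>\<U> \<plusminus> \<epsilon>\<close>, where
  \<open>h = \<integral> (u(x) - u(y)) K(x - y) d\<mu>(t,y)\<close>, so that \<open>\<chi>\<^sub>t = \<U> - h \<chi>\<^sub>\<eta>\<close> at every \<open>\<eta>\<close> at which \<open>\<chi>(t,\<cdot>)\<close> is
  differentiable.

  If \<open>\<mu>(t)\<close> is atomless, then \<open>\<chi>(t,\<cdot>)\<close> pushes Lebesgue measure on \<open>(0,B+C)\<close> forward to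
  \<open>p dx + d\<mu>\<close>. With \<open>r\<close> the density of \<open>p dx\<close> with respect to the latter, \<open>\<chi>(t,\<cdot>)\<close> is a primitive of
  \<open>(r/p) \<circ> \<chi>\<close>, hence differentiable a.e. with \<open>\<P> \<chi>\<^sub>\<eta> = r \<circ> \<chi>\<close>; this also identifies the two
  expressions for \<open>h\<close>. As the difference quotients of \<open>\<chi>\<close> in time are bounded by \<open>M\<close>, dominated
  convergence turns pointwise convergence into convergence in \<open>L\<^sup>\<gamma>\<close>.\<close>

text \<open>The obstacle is the low regularity of \<open>u\<close>: it is only Hoelder continuous,
  so characteristics need not be unique and there is no flow along which to transport
  \<open>\<mu>\<close>. Straight lines slightly faster or slower than \<open>u\<close> replace them.
  Estimates on one side only are enough because \<open>\<chi>(t,\<cdot>)\<close> is a generalised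
  inverse of the monotone function \<open>G(t,\<cdot>)\<close>: an inequality for \<open>G\<close>
  at a single point is an inequality for \<open>\<chi>\<close>. The price is an \<epsilon> in the
  slope and in the growth rate, and differentiability of \<open>\<chi>(t,\<cdot>)\<close> at the one
  value \<eta> turns it into an error of order \<epsilon> in the quotient.

  Adding \<open>p dx\<close> to \<open>\<mu>\<close> makes the inversion work: \<open>p > 0\<close>
  forces \<open>G\<close> to increase strictly, so \<open>\<chi>\<close> does not jump across
  regions without mass, and the decay of \<open>K\<close> keeps the tails light enough for
  \<open>\<chi>(0,\<cdot>)\<close> to lie in \<open>L\<^sup>\<gamma>\<close>.

  Atoms of \<open>\<mu>(t)\<close> obstruct only the differential equation. The speed bound, and
  with it the continuity in time, holds at every time.\<close>

lemma set_integrable_bounded_real: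
  fixes g :: "real \<Rightarrow> real"
  assumes "g \<in> borel_measurable borel" "S \<in> sets borel" "emeasure lborel S < \<infinity>" "\<And>x. x \<in> S \<Longrightarrow> \<bar>g x\<bar> \<le> L"
  shows "set_integrable lborel S g"
  unfolding set_integrable_def
  by (rule integrableI_bounded_set_indicator[where B=L]) (use assms in auto)

section \<open>Differentiating an indefinite integral\<close>

text \<open>The intervals need only contain \<open>x\<close>, not be centred at it. Difference
  quotients require this freedom: the interval between \<open>x\<close> and \<open>x + h\<close> has
  \<open>x\<close> as an endpoint. Nonnegative integrals at arbitrarily small scales around points
  with \<open>g x \<le> - c\<close> are incompatible with positive measure of
  \<open>A\<close>.\<close>

lemma null_set_covering_intervals:
  fixes g :: "real \<Rightarrow> real"
  assumes gm[measurable]: "g \<in> borel_measurable borel" and Am[measurable]: "A \<in> sets borel"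
    and L: "\<And>x. \<bar>g x\<bar> \<le> L" and c: "c > 0"
    and bdd: "bounded A" and neg: "\<And>x. x \<in> A \<Longrightarrow> g x \<le> - c"
    and cov: "\<And>x d. x \<in> A \<Longrightarrow> d > 0 \<Longrightarrow>
      \<exists>y r. 0 < r \<and> r < d \<and> x \<in> cball y r \<and> 0 \<le> (LINT s:cball y r|lborel. g s)"
  shows "A \<in> null_sets lborel"
proof (rule ccontr)
  assume "A \<notin> null_sets lborel"
  define a where "a = measure lborel A"
  have Afin: "emeasure lborel A < \<infinity>"
    using emeasure_bounded_finite[OF bdd] by simp
  have a: "a > 0" "emeasure lborel A = ennreal a"
    using \<open>A \<notin> null_sets lborel\<close> Afin unfolding a_def
    by (auto simp: null_sets_def emeasure_eq_ennreal_measure less_top zero_less_measure_iff)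
  have "L \<ge> 0" using L[of 0] by linarith
  \<comment> \<open>Makes the contribution of the excess \<open>U - A\<close> at most
    \<open>L * e \<le> c * a / 2\<close>, half of what \<open>A\<close> contributes with a negative
    sign. \<open>L + 1\<close> keeps the denominator positive when \<open>L = 0\<close>.\<close>
  define e where "e = c * a / (2 * (L + 1))"
  have "e > 0" unfolding e_def using c a \<open>L \<ge> 0\<close> by simp
  obtain U where U: "open U" "A \<subseteq> U" "emeasure lborel (U - A) < e"
    using outer_regular_lborel[OF Am \<open>e > 0\<close>] by blast
  txt \<open>A disjoint Vitali subfamily of \<open>K\<close> covers \<open>A\<close> up to a null set inside \<open>U\<close>, and there
    \<open>0 \<le> \<integral> g \<le> - c a + L e < 0\<close>.\<close>
  define K where "K = {(y, r). 0 < r \<and> cball y r \<subseteq> U \<and> 0 \<le> (LINT s:cball y r|lborel. g s)}"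
  have fine: "\<exists>i. i \<in> K \<and> x \<in> cball (fst i) (snd i) \<and> snd i < d" if "x \<in> A" and dpos: "0 < d" for x d
  proof -
    obtain d' where d': "d' > 0" "ball x d' \<subseteq> U"
      using U(1,2) \<open>x \<in> A\<close> openE by blast
    obtain y r where yr: "0 < r" "r < min d (d' / 2)" "x \<in> cball y r" "0 \<le> (LINT s:cball y r|lborel. g s)"
      using cov[OF \<open>x \<in> A\<close>, of "min d (d'/2)"] dpos d' by auto
    have "cball y r \<subseteq> ball x d'" using yr by (auto simp: dist_real_def)
    then have "(y, r) \<in> K" using yr d' unfolding K_def by blast
    then show ?thesis using yr by (intro exI[of _ "(y, r)"]) auto
  qed
  obtain C where C: "countable C" "C \<subseteq> K"
    "pairwise (\<lambda>i j. disjnt (cball (fst i) (snd i)) (cball (fst j) (snd j))) C"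
    "negligible (A - (\<Union>i \<in> C. cball (fst i) (snd i)))"
  proof (rule Vitali_covering_theorem_cballs[of K snd A fst])
    show "0 < snd i" if "i \<in> K" for i using that unfolding K_def by auto
  qed (rule fine)
  define W where "W = (\<Union>i \<in> C. cball (fst i) (snd i))"
  define B where "B n = (if n \<in> to_nat_on C ` C then cball (fst (from_nat_into C n)) (snd (from_nat_into C n)) else {})"
    for n :: nat
  have B_cases: "B n = {} \<or> (\<exists>i\<in>C. n = to_nat_on C i \<and> B n = cball (fst i) (snd i))" for n
    unfolding B_def using C(1) by auto
  have W_B: "W = (\<Union>n. B n)"
  proof
    show "W \<subseteq> (\<Union>n. B n)"
    proof
      fix x assume "x \<in> W"
      then obtain i where i: "i \<in> C" "x \<in> cball (fst i) (snd i)" unfolding W_def by auto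
      then have "x \<in> B (to_nat_on C i)" unfolding B_def using C(1) by auto
      then show "x \<in> (\<Union>n. B n)" by blast
    qed
    show "(\<Union>n. B n) \<subseteq> W"
    proof
      fix x assume "x \<in> (\<Union>n. B n)"
      then obtain n where n: "x \<in> B n" by blast
      with B_cases[of n] show "x \<in> W" unfolding W_def by blast
    qed
  qed
  have WU: "W \<subseteq> U" using C(2) unfolding W_def K_def by (fastforce simp del: mem_cball)
  have Bm[measurable]: "B n \<in> sets borel" for n unfolding B_def by auto
  have Wm[measurable]: "W \<in> sets borel" unfolding W_B by measurable
  have Um[measurable]: "U \<in> sets borel" using U(1) by simp
  have disjB: "B i \<inter> B j = {}" if "i \<noteq> j" for i j
    using B_cases[of i]
  proof
    assume "\<exists>k\<in>C. i = to_nat_on C k \<and> B i = cball (fst k) (snd k)"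
    then obtain k where k: "k \<in> C" "i = to_nat_on C k" "B i = cball (fst k) (snd k)" by blast
    show ?thesis using B_cases[of j]
    proof
      assume "\<exists>k\<in>C. j = to_nat_on C k \<and> B j = cball (fst k) (snd k)"
      then obtain l where l: "l \<in> C" "j = to_nat_on C l" "B j = cball (fst l) (snd l)" by blast
      have "k \<noteq> l" using k l that by auto
      then show ?thesis using C(3) k(1,3) l(1,3) unfolding pairwise_def disjnt_def by simp
    qed simp
  qed simp
  have "emeasure lborel U = emeasure lborel A + emeasure lborel (U - A)"
    using U(2) by (subst plus_emeasure) (auto simp: Un_absorb1)
  then have Ufin: "emeasure lborel U < \<infinity>"
    using order_less_trans[OF U(3), of \<infinity>] Afin by (auto simp: ennreal_add_eq_top less_top)
  have fin: "emeasure lborel S < \<infinity>" if "S \<subseteq> U" "S \<in> sets borel" for S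
    using emeasure_mono[of S U lborel] that Ufin by (auto simp: less_top top_unique)
  have int: "set_integrable lborel S g" if "S \<subseteq> U" "S \<in> sets borel" for S
    by (rule set_integrable_bounded_real[where L=L]) (use that fin L in auto)
  have BU: "B n \<subseteq> U" for n using W_B WU by auto
  have posB: "0 \<le> (LINT s:B n|lborel. g s)" for n
    using B_cases[of n] C(2) unfolding K_def by (auto simp: set_lebesgue_integral_def)
  have "0 \<le> (LINT s:(\<Union>i<n. B i)|lborel. g s)" for n
  proof -
    have "(LINT s:(\<Union>i<n. B i)|lborel. g s) = (\<Sum>i<n. LINT s:B i|lborel. g s)"
      by (rule set_integral_finite_Union)
         (use disjB BU int in \<open>auto simp: disjoint_family_on_def\<close>)
    then show ?thesis using posB by (simp add: sum_nonneg)
  qed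
  moreover have "(\<lambda>n. LINT s:(\<Union>i<n. B i)|lborel. g s) \<longlonglongrightarrow> (LINT s:(\<Union>n. \<Union>i<n. B i)|lborel. g s)"
  proof (rule set_integral_cont_up)
    show "incseq (\<lambda>n. \<Union>i<n. B i)" unfolding incseq_def by (meson UN_mono lessThan_subset_iff subset_refl)
    have "(\<Union>n. \<Union>i<n. B i) \<subseteq> U" using BU by auto
    then show "set_integrable lborel (\<Union>n. \<Union>i<n. B i) g" by (rule int) auto
  qed auto
  moreover have "(\<Union>n. \<Union>i<n. B i) = W" unfolding W_B by auto
  ultimately have pos: "0 \<le> (LINT s:W|lborel. g s)"
    using LIMSEQ_le_const[of "\<lambda>n. LINT s:(\<Union>i<n. B i)|lborel. g s" _ 0] by auto
  have "A - W \<in> null_sets lborel"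
    using C(4) by (simp add: W_def[symmetric] negligible_iff_null_sets null_sets_completion_iff)
  then have AW: "measure lborel (W \<inter> A) = a"
    using measure_Diff_null_set[of A lborel "A - W"] unfolding a_def
    by (metis Am Diff_Diff_Int Int_commute sets_lborel)
  have WAU: "W \<inter> A \<subseteq> U" "W - A \<subseteq> U" using WU by auto
  have WAm: "W \<inter> A \<in> sets borel" "W - A \<in> sets borel" by auto
  have const: "set_integrable lborel S (\<lambda>_. k)" "(LINT s:S|lborel. k) = k * measure lborel S"
    if "S \<subseteq> U" "S \<in> sets borel" for k :: real and S
    using fin[OF that] that(2)
    by (auto intro!: set_integrable_bounded_real[where L="\<bar>k\<bar>"] simp: set_integral_const)
  have "(LINT s:(W \<inter> A) \<union> (W - A)|lborel. g s) = (LINT s:(W \<inter> A)|lborel. g s) + (LINT s:(W - A)|lborel. g s)"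
    by (rule set_integral_Un) (auto intro!: int[OF WAU(1) WAm(1)] int[OF WAU(2) WAm(2)])
  moreover have "(W \<inter> A) \<union> (W - A) = W" by auto
  moreover have "(LINT s:(W \<inter> A)|lborel. g s) \<le> (LINT s:(W \<inter> A)|lborel. - c)"
    using neg by (intro set_integral_mono int const WAU WAm) auto
  moreover have "(LINT s:(W \<inter> A)|lborel. - c) = - c * a"
    using AW const(2)[OF WAU(1) WAm(1)] by simp
  moreover have "(LINT s:(W - A)|lborel. g s) \<le> (LINT s:(W - A)|lborel. L)"
    using L by (intro set_integral_mono int const WAU WAm) (simp add: abs_le_iff)
  moreover have "(LINT s:(W - A)|lborel. L) = L * measure lborel (W - A)"
    by (rule const(2)[OF WAU(2) WAm(2)])
  moreover have "measure lborel (W - A) \<le> e"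
  proof -
    have "emeasure lborel (W - A) \<le> emeasure lborel (U - A)"
      by (rule emeasure_mono) (use WU in auto)
    then have "emeasure lborel (W - A) \<le> ennreal e" using U(3) by simp
    then show ?thesis using \<open>e > 0\<close> by (simp add: measure_def enn2real_leI)
  qed
  ultimately have "0 \<le> - c * a + L * e"
    using pos mult_left_mono[OF _ \<open>L \<ge> 0\<close>, of "measure lborel (W - A)" e] by simp
  moreover have "L * e \<le> (L + 1) * e" using \<open>e > 0\<close> by simp
  moreover have "(L + 1) * e = c * a / 2" unfolding e_def using \<open>L \<ge> 0\<close> by (simp add: field_simps)
  moreover have "c * a > 0" using c a by simp
  ultimately show False by linarith
qed

text \<open>If quotients exceed \<open>q\<close> at arbitrarily small \<open>h\<close> although
  \<open>g x < q\<close>, then \<open>g - q\<close> has nonnegative integral over arbitrarily short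
  intervals with endpoint \<open>x\<close>, and \<open>null_set_covering_intervals\<close> makes the
  set of such \<open>x\<close> null. Rational \<open>q\<close> leave only countably many exceptional
  sets.\<close>

lemma AE_upper_derivative_le:
  fixes f g :: "real \<Rightarrow> real"
  assumes gm[measurable]: "g \<in> borel_measurable borel" and L: "\<And>x. \<bar>g x\<bar> \<le> L"
    and fg: "\<And>x y. x \<le> y \<Longrightarrow> f y - f x = (LINT s:{x..y}|lborel. g s)"
  shows "AE x in lborel. \<forall>q::rat. g x < of_rat q \<longrightarrow>
           (\<forall>\<^sub>F h in at 0. (f (x + h) - f x) / h \<le> of_rat q)"
proof -
  have int: "set_integrable lborel {x..y} (\<lambda>s. g s - k)" for x y k
    using L by (intro set_integrable_bounded_real[where L="L + \<bar>k\<bar>"])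
      (auto intro: order_trans[OF abs_triangle_ineq4] add_mono simp: emeasure_lborel_Icc_eq)
  have int0: "set_integrable lborel {x..y} g" for x y
    using int[of x y 0] by simp
  have ic: "(LINT s:{x..y}|lborel. g s - k) = f y - f x - k * (y - x)" if "x \<le> y" for x y k
  proof -
    have "set_integrable lborel {x..y} (\<lambda>s. k)"
      by (intro set_integrable_bounded_real[where L="\<bar>k\<bar>"]) (auto simp: emeasure_lborel_Icc_eq)
    then show ?thesis using that fg[OF that] int0
      by (simp add: set_integral_diff set_integral_const mult.commute)
  qed
  have lip: "\<bar>f y - f x\<bar> \<le> L * \<bar>y - x\<bar>" for x y
  proof -
    have *: "\<bar>f y - f x\<bar> \<le> L * (y - x)" if "x \<le> y" for x y
    proof -
      have gL: "0 \<le> g s - (- L)" "g s - L \<le> 0" for s using L[of s] by (auto simp: abs_le_iff)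
      have z: "set_integrable lborel {x..y} (\<lambda>s. 0::real)" by (simp add: set_integrable_def)
      have "(LINT s:{x..y}|lborel. 0) \<le> (LINT s:{x..y}|lborel. g s - (- L))"
        by (rule set_integral_mono[OF z int gL(1)])
      moreover have "(LINT s:{x..y}|lborel. g s - L) \<le> (LINT s:{x..y}|lborel. 0)"
        by (rule set_integral_mono[OF int z gL(2)])
      ultimately show ?thesis unfolding ic[OF that] by (simp add: abs_le_iff)
    qed
    show ?thesis using *[of x y] *[of y x] by (cases "x \<le> y") (auto simp: abs_minus_commute)
  qed
  have cont: "continuous_on UNIV f"
    by (rule lipschitz_on_continuous_on[where L="L"], rule lipschitz_onI)
      (use lip L[of 0] in \<open>auto simp: dist_real_def\<close>)
  then have fm[measurable]: "f \<in> borel_measurable borel"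
    by (rule borel_measurable_continuous_onI)
  \<comment> \<open>The index \<open>k\<close> cuts the exceptional set into bounded pieces on which
    \<open>g\<close> stays below \<open>q\<close> by a fixed amount; restricting to rational
    increments makes each piece Borel.\<close>
  define A where "A q k = {x. \<bar>x\<bar> \<le> real k \<and> g x \<le> of_rat q - 1 / real (Suc k) \<and>
     (\<forall>m::nat. \<exists>h::rat. 0 < \<bar>of_rat h :: real\<bar> \<and> \<bar>of_rat h\<bar> < 1 / real (Suc m) \<and>
        of_rat q < (f (x + of_rat h) - f x) / of_rat h)}" for q :: rat and k :: nat
  have "A q k \<in> null_sets lborel" for q k
  proof (rule null_set_covering_intervals[where g="\<lambda>x. g x - of_rat q" and L="L + \<bar>of_rat q\<bar>" and c="1 / real (Suc k)"])
    show "A q k \<in> sets borel" unfolding A_def by measurable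
    show "bounded (A q k)" unfolding A_def bounded_iff by auto
    show "\<bar>g x - real_of_rat q\<bar> \<le> L + \<bar>real_of_rat q\<bar>" for x using L[of x] by linarith
    fix x d :: real assume x: "x \<in> A q k" and "d > 0"
    obtain m :: nat where m: "1 / real (Suc m) < d" using \<open>d > 0\<close> by (rule nat_approx_posE)
    obtain h :: real where h: "0 < \<bar>h\<bar>" "\<bar>h\<bar> < d" "of_rat q < (f (x + h) - f x) / h"
    proof -
      obtain h0 :: rat where "0 < \<bar>of_rat h0 :: real\<bar>" "\<bar>of_rat h0\<bar> < 1 / real (Suc m)"
        "of_rat q < (f (x + of_rat h0) - f x) / of_rat h0"
        using x unfolding A_def by blast
      then show ?thesis using m by (intro that[of "of_rat h0"]) auto
    qed
    show "\<exists>y r. 0 < r \<and> r < d \<and> x \<in> cball y r \<and> 0 \<le> (LINT s:cball y r|lborel. g s - of_rat q)"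
    proof (intro exI conjI)
      show "0 < \<bar>h\<bar> / 2" "\<bar>h\<bar> / 2 < d" using h by auto
      show "x \<in> cball (x + h / 2) (\<bar>h\<bar> / 2)" by (auto simp: dist_real_def)
      show "0 \<le> (LINT s:cball (x + h / 2) (\<bar>h\<bar> / 2)|lborel. g s - of_rat q)"
      proof (cases "h > 0")
        case True
        then have "cball (x + h / 2) (\<bar>h\<bar> / 2) = {x..x + h}" by (auto simp: cball_eq_atLeastAtMost)
        moreover have "of_rat q * h < f (x + h) - f x" using True h(3) by (simp add: field_simps)
        ultimately show ?thesis using True ic[of x "x + h" "of_rat q"] by simp
      next
        case False
        then have "cball (x + h / 2) (\<bar>h\<bar> / 2) = {x + h..x}" by (auto simp: cball_eq_atLeastAtMost)
        moreover have "f (x + h) - f x < of_rat q * h" using False h(1,3) by (simp add: field_simps)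
        ultimately show ?thesis using False ic[of "x + h" x "of_rat q"] by simp
      qed
    qed
  qed (auto simp: A_def)
  then have "AE x in lborel. \<forall>q k. x \<notin> A q k"
    by (simp add: AE_all_countable AE_not_in)
  then show ?thesis
  proof eventually_elim
    case (elim x)
    show ?case
    proof (intro allI impI)
      fix q :: rat assume q: "g x < of_rat q"
      obtain k1 :: nat where k1: "1 / real (Suc k1) < of_rat q - g x" using nat_approx_posE[of "of_rat q - g x"] q by auto
      obtain k2 :: nat where k2: "\<bar>x\<bar> \<le> real k2" using real_arch_simple by blast
      define k where "k = max k1 k2"
      have "1 / real (Suc k) \<le> 1 / real (Suc k1)" unfolding k_def by (simp add: frac_le)
      then have gk: "g x \<le> of_rat q - 1 / real (Suc k)" using k1 by linarith
      have "\<bar>x\<bar> \<le> real k" using k2 unfolding k_def by linarith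
      then obtain m :: nat where m: "\<And>h::rat. 0 < \<bar>of_rat h :: real\<bar> \<Longrightarrow> \<bar>of_rat h\<bar> < 1 / real (Suc m) \<Longrightarrow>
         (f (x + of_rat h) - f x) / of_rat h \<le> of_rat q"
        using elim[rule_format, of q k] gk unfolding A_def mem_Collect_eq by (meson not_less)
      have "(f (x + h) - f x) / h \<le> of_rat q" if h: "h \<noteq> 0" "\<bar>h\<bar> < 1 / real (Suc m)" for h
      proof (rule ccontr)
        assume neg: "\<not> (f (x + h) - f x) / h \<le> of_rat q"
        \<comment> \<open>From rational to real increments: the quotient is continuous in
          \<open>h\<close> away from \<open>0\<close>, so a violation at a real \<open>h\<close>
          persists at a nearby rational one.\<close>
        define S where "S = {h. h \<noteq> 0 \<and> \<bar>h\<bar> < 1 / real (Suc m)}"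
        have "open S" unfolding S_def by (intro open_Collect_conj open_Collect_neq open_Collect_less continuous_intros)
        have "continuous_on S (\<lambda>h. (f (x + h) - f x) / h)"
          unfolding S_def by (intro continuous_intros continuous_on_compose2[OF cont]) auto
        then have "open {h \<in> S. of_rat q < (f (x + h) - f x) / h}"
          using continuous_on_open_gen continuous_open_preimage[OF _ \<open>open S\<close>, of "\<lambda>h. (f (x + h) - f x) / h" "{real_of_rat q<..}"]
          by (auto simp: vimage_def Int_def)
        moreover have "h \<in> {h \<in> S. of_rat q < (f (x + h) - f x) / h}" using neg h unfolding S_def by auto
        ultimately obtain e where e: "e > 0" "ball h e \<subseteq> {h \<in> S. of_rat q < (f (x + h) - f x) / h}"
          using openE by blast
        obtain r :: rat where r: "h < of_rat r" "of_rat r < h + e"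
          using of_rat_dense[of h "h + e"] e by auto
        then have "of_rat r \<in> ball h e" by (auto simp: dist_real_def)
        then have "real_of_rat r \<in> S" "of_rat q < (f (x + of_rat r) - f x) / of_rat r" using e by auto
        then show False using m[of r] unfolding S_def by auto
      qed
      then show "\<forall>\<^sub>F h in at 0. (f (x + h) - f x) / h \<le> of_rat q"
        unfolding eventually_at by (intro exI[of _ "1 / real (Suc m)"]) (auto simp: dist_real_def)
    qed
  qed
qed

text \<open>The upper bound for the quotients of \<open>f\<close>, applied to \<open>- f\<close> and
  \<open>- g\<close>, is the matching lower bound.\<close>

lemma AE_has_derivative_of_bounded:
  fixes f g :: "real \<Rightarrow> real"
  assumes gm[measurable]: "g \<in> borel_measurable borel" and L: "\<And>x. \<bar>g x\<bar> \<le> L"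
    and fg: "\<And>x y. x \<le> y \<Longrightarrow> f y - f x = (LINT s:{x..y}|lborel. g s)"
  shows "AE x in lborel. (f has_real_derivative g x) (at x)"
proof -
  have fg': "(- f y) - (- f x) = (LINT s:{x..y}|lborel. - g s)" if "x \<le> y" for x y
    using fg[OF that] by (simp add: set_lebesgue_integral_def)
  have "AE x in lborel. \<forall>q::rat. g x < of_rat q \<longrightarrow> (\<forall>\<^sub>F h in at 0. (f (x + h) - f x) / h \<le> of_rat q)"
    by (rule AE_upper_derivative_le[OF gm L fg])
  moreover have "AE x in lborel. \<forall>q::rat. - g x < of_rat q \<longrightarrow>
      (\<forall>\<^sub>F h in at 0. (- f (x + h) - (- f x)) / h \<le> of_rat q)"
    by (rule AE_upper_derivative_le[where L=L]) (use L fg' in auto)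
  ultimately show ?thesis
  proof eventually_elim
    case (elim x)
    have "((\<lambda>h. (f (x + h) - f x) / h) \<longlongrightarrow> g x) (at 0)"
    proof (rule order_tendstoI)
      fix a assume "g x < a"
      then obtain q where q: "g x < of_rat q" "of_rat q < a" using of_rat_dense by blast
      show "\<forall>\<^sub>F h in at 0. (f (x + h) - f x) / h < a"
        by (rule eventually_mono[OF elim(1)[rule_format, OF q(1)]]) (use q in linarith)
    next
      fix a assume "a < g x"
      then obtain q where q: "- g x < of_rat q" "of_rat q < - a" using of_rat_dense[of "- g x" "- a"] by auto
      show "\<forall>\<^sub>F h in at 0. a < (f (x + h) - f x) / h"
      proof (rule eventually_mono[OF elim(2)[rule_format, OF q(1)]])
        fix h assume "(- f (x + h) - (- f x)) / h \<le> of_rat q"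
        moreover have "(- f (x + h) - (- f x)) / h = - ((f (x + h) - f x) / h)"
          by (simp add: minus_divide_left)
        ultimately show "a < (f (x + h) - f x) / h" using q by linarith
      qed
    qed
    then show ?case by (simp add: DERIV_def)
  qed
qed

text \<open>\<open>chi_eta\<close> is a \<open>deriv\<close>, hence defined also where
  \<open>chiHS\<close> is not differentiable, and its measurability has to be proved. The points of
  differentiability form the Borel set \<open>D\<close>, given by a Cauchy criterion for rational
  increments; on \<open>D\<close> the derivative is the limit along
  \<open>1 / (n + 1)\<close>.\<close>

lemma borel_measurable_deriv:
  fixes f :: "real \<Rightarrow> real"
  assumes I: "open I" and cont: "continuous_on I f" and fm[measurable]: "f \<in> borel_measurable borel"
  shows "(\<lambda>x. indicator I x * deriv f x) \<in> borel_measurable borel"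
proof -
  define Q where "Q x h = (f (x + h) - f x) / h" for x h
  have [measurable]: "(\<lambda>x. Q x h) \<in> borel_measurable borel" for h unfolding Q_def by measurable
  have Im[measurable]: "I \<in> sets borel" using I by simp
  define small where "small m h \<longleftrightarrow> 0 < \<bar>of_rat h :: real\<bar> \<and> \<bar>of_rat h\<bar> < 1 / real (Suc m)" for m :: nat and h :: rat
  define D where "D = {x. x \<in> I \<and> (\<forall>k::nat. \<exists>m::nat. \<forall>h h'. small m h \<and> small m h' \<longrightarrow>
      \<bar>Q x (of_rat h) - Q x (of_rat h')\<bar> \<le> 1 / real (Suc k))}"
  have Dm[measurable]: "D \<in> sets borel" unfolding D_def by measurable
  have diffD: "x \<in> D" if "x \<in> I" "(f has_real_derivative l) (at x)" for x l
  proof -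
    have lim: "(Q x \<longlongrightarrow> l) (at 0)" using that(2) unfolding DERIV_def Q_def .
    have "\<exists>m::nat. \<forall>h h'::rat. small m h \<and> small m h' \<longrightarrow> \<bar>Q x (of_rat h) - Q x (of_rat h')\<bar> \<le> 1 / real (Suc k)" for k
    proof -
      have "\<forall>\<^sub>F h in at 0. dist (Q x h) l < 1 / real (Suc k) / 2"
        by (rule tendstoD[OF lim]) simp
      then obtain d where d: "d > 0" "\<And>h. h \<noteq> 0 \<Longrightarrow> \<bar>h\<bar> < d \<Longrightarrow> \<bar>Q x h - l\<bar> < 1 / real (Suc k) / 2"
        unfolding eventually_at by (auto simp: dist_real_def)
      obtain m :: nat where m: "1 / real (Suc m) < d" using \<open>d > 0\<close> by (rule nat_approx_posE)
      show ?thesis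
      proof (intro exI[of _ m] allI impI)
        fix h h' :: rat
        assume a: "small m h \<and> small m h'"
        have "\<bar>Q x (of_rat h) - l\<bar> < 1 / real (Suc k) / 2" "\<bar>Q x (of_rat h') - l\<bar> < 1 / real (Suc k) / 2"
          using a m unfolding small_def by (intro d(2); force)+
        then show "\<bar>Q x (of_rat h) - Q x (of_rat h')\<bar> \<le> 1 / real (Suc k)"
          using field_sum_of_halves[of "1 / real (Suc k)"] by (simp only: abs_le_iff abs_less_iff) linarith
      qed
    qed
    then show ?thesis using that(1) unfolding D_def by blast
  qed
  define r where "r n = 1 / (rat_of_nat (Suc n))" for n
  have r: "of_rat (r n) = 1 / real (Suc n)" for n
    unfolding r_def by (simp add: of_rat_divide of_rat_add)
  have D_deriv: "(f has_real_derivative lim (\<lambda>n. Q x (1 / real (Suc n)))) (at x)" if "x \<in> D" for x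
  proof -
    have xI: "x \<in> I" using that unfolding D_def by auto
    have close: "\<exists>m::nat. \<forall>h h'::rat. small m h \<and> small m h' \<longrightarrow> \<bar>Q x (of_rat h) - Q x (of_rat h')\<bar> < e" if "e > 0" for e
    proof -
      obtain k :: nat where k: "1 / real (Suc k) < e" using \<open>e > 0\<close> by (rule nat_approx_posE)
      obtain m :: nat where m: "\<forall>h h'::rat. small m h \<and> small m h' \<longrightarrow> \<bar>Q x (of_rat h) - Q x (of_rat h')\<bar> \<le> 1 / real (Suc k)"
        using \<open>x \<in> D\<close> unfolding D_def by blast
      show ?thesis using m k by (intro exI[of _ m]) fastforce
    qed
    have small_r: "small m (r n)" if "n > m" for n m
      using that unfolding small_def r by (auto simp: frac_less2)
    have "Cauchy (\<lambda>n. Q x (1 / real (Suc n)))"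
    proof (rule metric_CauchyI)
      fix e :: real assume "e > 0"
      obtain m :: nat where m: "\<And>h h'::rat. small m h \<Longrightarrow> small m h' \<Longrightarrow> \<bar>Q x (of_rat h) - Q x (of_rat h')\<bar> < e"
        using close[OF \<open>e > 0\<close>] by blast
      have "dist (Q x (1 / real (Suc i))) (Q x (1 / real (Suc j))) < e" if "i \<ge> Suc m" "j \<ge> Suc m" for i j
        using m[OF small_r small_r, of i j] that unfolding r by (auto simp: dist_real_def)
      then show "\<exists>M. \<forall>i\<ge>M. \<forall>j\<ge>M. dist (Q x (1 / real (Suc i))) (Q x (1 / real (Suc j))) < e" by blast
    qed
    then have "convergent (\<lambda>n. Q x (1 / real (Suc n)))" by (simp add: Cauchy_convergent_iff)
    then have L: "(\<lambda>n. Q x (1 / real (Suc n))) \<longlonglongrightarrow> lim (\<lambda>n. Q x (1 / real (Suc n)))" (is "_ \<longlonglongrightarrow> ?l")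
      by (simp add: convergent_LIMSEQ_iff)
    obtain d0 where d0: "d0 > 0" "ball x d0 \<subseteq> I" using I xI openE by blast
    have "(Q x \<longlongrightarrow> ?l) (at 0)"
    proof (rule tendstoI)
      fix e :: real assume "e > 0"
      then have "e / 2 > 0" by simp
      obtain m :: nat where m: "\<And>h h'::rat. small m h \<Longrightarrow> small m h' \<Longrightarrow> \<bar>Q x (of_rat h) - Q x (of_rat h')\<bar> < e / 2"
        using close[OF \<open>e / 2 > 0\<close>] by blast
      have near: "\<bar>Q x (of_rat h) - ?l\<bar> \<le> e / 2" if "small m h" for h :: rat
      proof (rule LIMSEQ_le_const2)
        show "(\<lambda>n. \<bar>Q x (of_rat h) - Q x (1 / real (Suc n))\<bar>) \<longlonglongrightarrow> \<bar>Q x (of_rat h) - ?l\<bar>"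
          by (intro tendsto_intros L)
        show "\<exists>N. \<forall>n\<ge>N. \<bar>Q x (of_rat h) - Q x (1 / real (Suc n))\<bar> \<le> e / 2"
          using m[OF that small_r] unfolding r by (intro exI[of _ "Suc m"]) (auto intro: less_imp_le)
      qed
      define d where "d = min d0 (1 / real (Suc m))"
      have "d > 0" using d0 by (simp add: d_def)
      have "dist (Q x h) ?l < e" if h: "h \<noteq> 0" "\<bar>h\<bar> < d" for h
      proof -
        define S where "S = {h. h \<noteq> 0 \<and> \<bar>h\<bar> < d}"
        have "open S" unfolding S_def by (intro open_Collect_conj open_Collect_neq open_Collect_less continuous_intros)
        have "x + h \<in> I" if "h \<in> S" for h using that d0 unfolding S_def d_def by (auto simp: dist_real_def subset_iff)
        then have "continuous_on S (Q x)"
          unfolding Q_def S_def by (intro continuous_intros continuous_on_compose2[OF cont]) (auto simp: S_def)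
        then have c: "continuous (at h) (Q x)" using \<open>open S\<close> h by (auto simp: continuous_on_eq_continuous_at S_def)
        then have "\<forall>\<^sub>F k in nhds h. dist (Q x k) (Q x h) < e / 2"
          using \<open>e / 2 > 0\<close> by (metis isCont_def tendstoD tendsto_at_iff_tendsto_nhds)
        moreover have "\<forall>\<^sub>F k in nhds h. k \<in> S" using \<open>open S\<close> h by (intro eventually_nhds_in_open) (auto simp: S_def)
        ultimately have "\<forall>\<^sub>F k in nhds h. dist (Q x k) (Q x h) < e / 2 \<and> k \<in> S" by eventually_elim simp
        then obtain e1 where e1: "e1 > 0" "\<And>k. dist k h < e1 \<Longrightarrow> dist (Q x k) (Q x h) < e / 2 \<and> k \<in> S"
          unfolding eventually_nhds_metric by blast
        obtain k :: rat where k: "h < of_rat k" "of_rat k < h + e1" using of_rat_dense[of h "h + e1"] e1 by auto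
        then have k': "\<bar>Q x (of_rat k) - Q x h\<bar> < e / 2" "real_of_rat k \<in> S"
          using e1(2)[of "of_rat k"] by (auto simp: dist_real_def)
        then have "\<bar>Q x (of_rat k) - ?l\<bar> \<le> e / 2" by (intro near) (auto simp: S_def d_def small_def)
        then have "\<bar>Q x h - ?l\<bar> < e" using k'(1) by (smt (verit) field_sum_of_halves)
        then show ?thesis by (simp only: dist_real_def)
      qed
      then show "\<forall>\<^sub>F h in at 0. dist (Q x h) ?l < e"
        unfolding eventually_at using \<open>d > 0\<close> by (intro exI[of _ d]) auto
    qed
    then show ?thesis unfolding DERIV_def Q_def .
  qed
  \<comment> \<open>At points of \<open>I\<close> outside \<open>D\<close> no number is a
    derivative, so \<open>deriv f x\<close> is \<open>SOME l. False\<close>, one constant for all of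
    them.\<close>
  have "(\<lambda>x. indicator I x * deriv f x) =
     (\<lambda>x. if x \<in> D then lim (\<lambda>n. Q x (1 / real (Suc n))) else indicator I x * (SOME l::real. False))"
  proof
    fix x
    show "indicator I x * deriv f x =
     (if x \<in> D then lim (\<lambda>n. Q x (1 / real (Suc n))) else indicator I x * (SOME l::real. False))"
    proof (cases "x \<in> D")
      case True
      then have "x \<in> I" unfolding D_def by auto
      then show ?thesis using True DERIV_imp_deriv[OF D_deriv[OF True]] by simp
    next
      case False
      then have "\<not> (f has_real_derivative l) (at x)" if "x \<in> I" for l using diffD that by blast
      then show ?thesis using False by (auto simp: deriv_def indicator_def)
    qed
  qed
  moreover have "\<dots> \<in> borel_measurable borel" by measurable
  ultimately show ?thesis by simp
qed

section \<open>Closure properties of smooth functions of one variable\<close>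

lemma smooth1_deriv:
  assumes "smooth1 f"
  shows "smooth1 (deriv f)" "(f has_real_derivative deriv f x) (at x)"
proof -
  obtain S where S: "f \<in> S" "\<And>g. g \<in> S \<Longrightarrow> \<exists>g'\<in>S. \<forall>x. (g has_real_derivative g' x) (at x)"
    using assms unfolding smooth1_def by blast
  then obtain f' where f': "f' \<in> S" "\<And>x. (f has_real_derivative f' x) (at x)" by blast
  then have [simp]: "deriv f = f'" by (auto intro: DERIV_imp_deriv)
  show "smooth1 (deriv f)" unfolding smooth1_def using S f' by auto
  show "(f has_real_derivative deriv f x) (at x)" using f' by auto
qed

lemma smooth1_continuous: "smooth1 f \<Longrightarrow> continuous_on A f"
  by (meson smooth1_deriv(2) DERIV_continuous continuous_at_imp_continuous_on)

lemma smooth1_diff: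
  assumes "smooth1 f" "smooth1 g"
  shows "smooth1 (\<lambda>x. f x - g x)"
  unfolding smooth1_def
proof (intro exI[of _ "{\<lambda>x. f x - g x |f g. smooth1 f \<and> smooth1 g}"] conjI ballI)
  fix h :: "real \<Rightarrow> real" assume "h \<in> {\<lambda>x. f x - g x |f g. smooth1 f \<and> smooth1 g}"
  then obtain f g where h: "h = (\<lambda>x. f x - g x)" "smooth1 f" "smooth1 g" by blast
  then show "\<exists>g'\<in>{\<lambda>x. f x - g x |f g. smooth1 f \<and> smooth1 g}. \<forall>x. (h has_real_derivative g' x) (at x)"
    by (intro bexI[of _ "\<lambda>x. deriv f x - deriv g x"]) (auto intro!: DERIV_diff smooth1_deriv)
qed (use assms in auto)

lemma smooth1_affine:
  assumes "smooth1 f"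
  shows "smooth1 (\<lambda>x. f (a * x + b))"
  unfolding smooth1_def
\<comment> \<open>The witness class carries a factor \<open>c\<close> because each differentiation
  of \<open>f (a * x + b)\<close> produces another factor \<open>a\<close>.\<close>
proof (intro exI[of _ "{\<lambda>x. c * f (a * x + b) |f c. smooth1 f}"] conjI ballI)
  show "(\<lambda>x. f (a * x + b)) \<in> {\<lambda>x. c * f (a * x + b) |f c. smooth1 f}"
    using assms by (intro CollectI exI[of _ f] exI[of _ 1]) auto
next
  fix h :: "real \<Rightarrow> real" assume "h \<in> {\<lambda>x. c * f (a * x + b) |f c. smooth1 f}"
  then obtain f c where h: "h = (\<lambda>x. c * f (a * x + b))" "smooth1 f" by blast
  have "(h has_real_derivative c * a * deriv f (a * x + b)) (at x)" for x
    unfolding h by (auto intro!: derivative_eq_intros DERIV_chain2[OF smooth1_deriv(2)[OF h(2)]])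
  then show "\<exists>g'\<in>{\<lambda>x. c * f (a * x + b) |f c. smooth1 f}. \<forall>x. (h has_real_derivative g' x) (at x)"
    using smooth1_deriv(1)[OF h(2)] by (intro bexI[of _ "\<lambda>x. c * a * deriv f (a * x + b)"]) auto
qed

section \<open>Test functions in a moving frame\<close>

text \<open>Closed under both partial derivatives, so that it witnesses \<^const>\<open>smooth2\<close> for each of its members.\<close>
inductive_set travelling :: "real \<Rightarrow> (real \<Rightarrow> real \<Rightarrow> real) set" for c where
  mult: "smooth1 a \<Longrightarrow> smooth1 g \<Longrightarrow> (\<lambda>t x. k * a t * g (x - c * t)) \<in> travelling c"
| add: "p \<in> travelling c \<Longrightarrow> q \<in> travelling c \<Longrightarrow> (\<lambda>t x. p t x + q t x) \<in> travelling c"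

lemma travelling_deriv:
  assumes "p \<in> travelling c"
  shows "continuous_on UNIV (\<lambda>(t, x). p t x) \<and>
    (\<exists>p1\<in>travelling c. \<exists>p2\<in>travelling c. \<forall>t x. ((\<lambda>s. p s x) has_real_derivative p1 t x) (at t) \<and>
       ((\<lambda>y. p t y) has_real_derivative p2 t x) (at x))"
  using assms
proof induction
  case (mult a g k)
  \<comment> \<open>The frame speed enters the time derivative through the chain rule and splits it
    into two products; hence the scalar \<open>k\<close> and the closure under sums in
    \<open>travelling\<close>.\<close>
  let ?p1 = "\<lambda>t x. k * deriv a t * g (x - c * t) + (- (k * c)) * a t * deriv g (x - c * t)"
  let ?p2 = "\<lambda>t x. k * a t * deriv g (x - c * t)"
  note [derivative_intros] = DERIV_chain2[OF smooth1_deriv(2)[OF mult(1)]] DERIV_chain2[OF smooth1_deriv(2)[OF mult(2)]]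
  have "?p1 \<in> travelling c" "?p2 \<in> travelling c"
    by (intro travelling.intros smooth1_deriv mult)+
  moreover have "((\<lambda>s. k * a s * g (x - c * s)) has_real_derivative ?p1 t x) (at t)" for t x
    by (auto intro!: derivative_eq_intros)
  moreover have "((\<lambda>y. k * a t * g (y - c * t)) has_real_derivative ?p2 t x) (at x)" for t x
    by (auto intro!: derivative_eq_intros)
  moreover have "continuous_on UNIV (\<lambda>(t, x). k * a t * g (x - c * t))"
    unfolding split_beta
    by (intro continuous_intros continuous_on_compose2[OF smooth1_continuous[OF mult(1), of UNIV]]
        continuous_on_compose2[OF smooth1_continuous[OF mult(2), of UNIV]]) auto
  ultimately show ?case by (intro conjI bexI[of _ ?p1] bexI[of _ ?p2] allI)
next
  case (add p q)
  obtain p1 p2 where p: "p1 \<in> travelling c" "p2 \<in> travelling c"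
      "\<And>t x. ((\<lambda>s. p s x) has_real_derivative p1 t x) (at t)"
      "\<And>t x. ((\<lambda>y. p t y) has_real_derivative p2 t x) (at x)" using add by blast
  obtain q1 q2 where q: "q1 \<in> travelling c" "q2 \<in> travelling c"
      "\<And>t x. ((\<lambda>s. q s x) has_real_derivative q1 t x) (at t)"
      "\<And>t x. ((\<lambda>y. q t y) has_real_derivative q2 t x) (at x)" using add by blast
  have "continuous_on UNIV (\<lambda>(t, x). p t x + q t x)"
    using add.IH by (auto simp: split_beta intro!: continuous_on_add)
  then show ?case
    using p q
    by (intro conjI bexI[of _ "\<lambda>t x. p1 t x + q1 t x"] bexI[of _ "\<lambda>t x. p2 t x + q2 t x"] allI)
       (auto intro!: travelling.add DERIV_add)
qed

lemma test_fun_travelling: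
  assumes "smooth1 a" "smooth1 g" and a: "\<And>t. R < \<bar>t\<bar> \<Longrightarrow> a t = 0" and g: "\<And>x. R < \<bar>x\<bar> \<Longrightarrow> g x = 0"
  shows "test_fun (\<lambda>t x. a t * g (x - c * t))"
  unfolding test_fun_def
proof
  have "(\<lambda>t x. 1 * a t * g (x - c * t)) \<in> travelling c" by (rule travelling.mult[OF assms(1,2)])
  then show "smooth2 (\<lambda>t x. a t * g (x - c * t))"
    unfolding smooth2_def using travelling_deriv by (intro exI[of _ "travelling c"]) auto
  \<comment> \<open>The support lies in the sheared square \<open>\<bar>t\<bar> \<le> R\<close>,
    \<open>\<bar>x - c * t\<bar> \<le> R\<close>.\<close>
  have "{(t, x). a t * g (x - c * t) \<noteq> 0} \<subseteq> cbox (- R, - R - \<bar>c\<bar> * R) (R, R + \<bar>c\<bar> * R)"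
  proof
    fix p assume "p \<in> {(t, x). a t * g (x - c * t) \<noteq> 0}"
    then obtain t x where p: "p = (t, x)" "a t * g (x - c * t) \<noteq> 0" by auto
    then have *: "\<bar>t\<bar> \<le> R" "\<bar>x - c * t\<bar> \<le> R" using a[of t] g[of "x - c * t"] by (auto simp: not_less[symmetric])
    have "\<bar>c * t\<bar> \<le> \<bar>c\<bar> * R" using * by (simp add: abs_mult mult_left_mono)
    then show "p \<in> cbox (- R, - R - \<bar>c\<bar> * R) (R, R + \<bar>c\<bar> * R)"
      using * unfolding p by (auto simp: cbox_Pair_eq mem_box abs_le_iff)
  qed
  then show "bounded {(t, x). a t * g (x - c * t) \<noteq> 0}"
    using bounded_cbox bounded_subset by blast
qed

text \<open>\<open>\<psi>p\<close> equals \<open>1\<close> to the right of \<open>1\<close> because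
  the other member of the partition of unity vanishes there. The cutoff pair thus supplies a smooth
  step, and all smooth test functions below are built from its shifted and rescaled copies.\<close>

lemma cutoff_pair_step:
  assumes "cutoff_pair \<psi>p \<psi>m"
  shows "smooth1 \<psi>p" "x \<le> - 1 \<Longrightarrow> \<psi>p x = 0" "1 \<le> x \<Longrightarrow> \<psi>p x = 1" "0 \<le> \<psi>p x" "\<psi>p x \<le> 1"
proof -
  note c = assms[unfolded cutoff_pair_def]
  show "smooth1 \<psi>p" "0 \<le> \<psi>p x" "\<psi>p x \<le> 1" using c by auto
  show "\<psi>p x = 0" if "x \<le> - 1"
  proof (rule ccontr)
    assume "\<psi>p x \<noteq> 0"
    then have "x \<in> closure {x. \<psi>p x \<noteq> 0}" by (intro subsetD[OF closure_subset]) auto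
    then show False using c that by auto
  qed
  show "\<psi>p x = 1" if "1 \<le> x"
  proof (rule ccontr)
    assume "\<psi>p x \<noteq> 1"
    moreover have "\<psi>p x + \<psi>m x = 1" using c by auto
    ultimately have "\<psi>m x \<noteq> 0" by auto
    then have "x \<in> closure {x. \<psi>m x \<noteq> 0}" by (intro subsetD[OF closure_subset]) auto
    then show False using c that by auto
  qed
qed

lemma deriv_step_eq_0:
  fixes \<psi> :: "real \<Rightarrow> real"
  assumes "\<And>x. x \<le> - 1 \<Longrightarrow> \<psi> x = 0" "\<And>x. 1 \<le> x \<Longrightarrow> \<psi> x = 1" and "1 < \<bar>x\<bar>"
  shows "deriv \<psi> x = 0"
proof (cases "x > 1")
  case True
  have "((\<lambda>x. 1) has_real_derivative 0) (at x)" by simp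
  then have "(\<psi> has_real_derivative 0) (at x)"
    by (rule has_field_derivative_transform_within_open[of _ _ _ "{1<..}"]) (use True assms in auto)
  then show ?thesis by (rule DERIV_imp_deriv)
next
  case False
  have "((\<lambda>x. 0) has_real_derivative 0) (at x)" by simp
  then have "(\<psi> has_real_derivative 0) (at x)"
    by (rule has_field_derivative_transform_within_open[of _ _ _ "{..<-1}"]) (use False assms in auto)
  then show ?thesis by (rule DERIV_imp_deriv)
qed

section \<open>Compactly supported functions and mollification\<close>

lemma uniformly_continuous_on_compact_support:
  fixes g :: "real \<Rightarrow> real"
  assumes cont: "continuous_on UNIV g" and g0: "\<And>x. R < \<bar>x\<bar> \<Longrightarrow> g x = 0"
  shows "uniformly_continuous_on UNIV g"
  unfolding uniformly_continuous_on_def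
proof (intro allI impI)
  fix e :: real assume "e > 0"
  have "uniformly_continuous_on {-R-1..R+1} g"
    by (intro compact_uniformly_continuous continuous_on_subset[OF cont]) auto
  then obtain d where d: "d > 0" "\<And>x y. x \<in> {-R-1..R+1} \<Longrightarrow> y \<in> {-R-1..R+1} \<Longrightarrow> dist y x < d \<Longrightarrow> dist (g y) (g x) < e"
    using \<open>e > 0\<close> unfolding uniformly_continuous_on_def by meson
  have "dist (g y) (g x) < e" if "dist y x < min d 1" for x y
  proof (cases "x \<in> {-R-1..R+1} \<and> y \<in> {-R-1..R+1}")
    case False
    then have "R < \<bar>x\<bar>" "R < \<bar>y\<bar>" using that by (auto simp: dist_real_def)
    then show ?thesis using g0 \<open>e > 0\<close> by simp
  qed (use d that in auto)
  then show "\<exists>d>0. \<forall>x\<in>UNIV. \<forall>x'\<in>UNIV. dist x' x < d \<longrightarrow> dist (g x') (g x) < e"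
    using d by (intro exI[of _ "min d 1"]) auto
qed

lemma integrable_compact_support:
  fixes g :: "real \<Rightarrow> real"
  assumes cont: "continuous_on UNIV g" and g0: "\<And>x. R < \<bar>x\<bar> \<Longrightarrow> g x = 0"
  shows "integrable lborel g"
proof -
  have "set_integrable lborel {-R..R} g"
    by (rule borel_integrable_atLeastAtMost') (rule continuous_on_subset[OF cont], auto)
  moreover have "(\<lambda>x. indicator {-R..R} x *\<^sub>R g x) = g"
  proof
    show "indicator {-R..R} x *\<^sub>R g x = g x" for x
      using g0[of x] by (cases "R < \<bar>x\<bar>") (auto simp: indicator_def)
  qed
  ultimately show ?thesis by (simp add: set_integrable_def)
qed

lemma bounded_compact_support:
  fixes g :: "real \<Rightarrow> real"
  assumes cont: "continuous_on UNIV g" and g0: "\<And>x. R < \<bar>x\<bar> \<Longrightarrow> g x = 0"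
  obtains B where "B \<ge> 0" "\<And>x. \<bar>g x\<bar> \<le> B"
proof -
  have "compact (g ` {-R..R})" by (intro compact_continuous_image continuous_on_subset[OF cont]) auto
  then obtain B where B: "\<And>x. x \<in> {-R..R} \<Longrightarrow> \<bar>g x\<bar> \<le> B"
    using compact_imp_bounded bounded_iff by (metis imageI real_norm_def)
  have "\<bar>g x\<bar> \<le> max B 0" for x
  proof (cases "R < \<bar>x\<bar>")
    case False
    then have "x \<in> {-R..R}" by auto
    then show ?thesis using B[of x] by auto
  qed (simp add: g0)
  then show thesis by (intro that[of "max B 0"]) auto
qed

text \<open>At a point \<open>y \<noteq> 0\<close> a rescaled step
  \<open>\<psi> (y * real (Suc k))\<close> equals \<open>0\<close> or \<open>1\<close> exactly from
  some \<open>k\<close> on, so that its limit is that of an eventually constant sequence.\<close>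

lemma eventually_le_mult_Suc:
  fixes a :: real
  assumes a: "a > 0" shows "\<forall>\<^sub>F k in sequentially. 1 \<le> a * real (Suc k)"
proof -
  obtain k0 :: nat where k0: "1 / real (Suc k0) < a" using nat_approx_posE[OF a] .
  have "1 \<le> a * real (Suc k)" if "k \<ge> k0" for k
  proof -
    have "1 \<le> a * real (Suc k0)" using k0 by (simp add: field_simps)
    also have "\<dots> \<le> a * real (Suc k)" using that a by (intro mult_left_mono) auto
    finally show ?thesis .
  qed
  then show ?thesis unfolding eventually_sequentially by blast
qed

lemma mollifier_eq:
  fixes \<beta> f :: "real \<Rightarrow> real"
  shows "(\<integral>z. real (Suc k) * \<beta> ((x - z) * real (Suc k)) * f z \<partial>lborel) = (\<integral>w. \<beta> w * f (x - w / real (Suc k)) \<partial>lborel)"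
proof -
  have "(\<integral>z. real (Suc k) * \<beta> ((x - z) * real (Suc k)) * f z \<partial>lborel) =
    \<bar>- 1 / real (Suc k)\<bar> *\<^sub>R (\<integral>w. real (Suc k) * \<beta> ((x - (x + (- 1 / real (Suc k)) * w)) * real (Suc k)) * f (x + (- 1 / real (Suc k)) * w) \<partial>lborel)"
    by (rule lborel_integral_real_affine) simp
  also have "(\<lambda>w. real (Suc k) * \<beta> ((x - (x + (- 1 / real (Suc k)) * w)) * real (Suc k)) * f (x + (- 1 / real (Suc k)) * w))
     = (\<lambda>w. real (Suc k) * (\<beta> w * f (x - w / real (Suc k))))"
    by (auto simp del: of_nat_Suc)
  finally show ?thesis by (simp del: of_nat_Suc)
qed

text \<open>After the substitution \<open>w = (x - z) * real (Suc k)\<close> the kernel is fixed and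
  the argument of \<open>f\<close> tends to \<open>x\<close>. Since
  \<open>\<bar>w\<bar> \<le> 1\<close>, only values of \<open>f\<close> on \<open>{x-1..x+1}\<close>
  enter, and these are bounded by compactness.\<close>

lemma mollifier_tendsto:
  fixes \<beta> f :: "real \<Rightarrow> real"
  assumes cont: "continuous_on UNIV \<beta>" and b0: "\<And>x. 1 < \<bar>x\<bar> \<Longrightarrow> \<beta> x = 0" and f: "continuous_on UNIV f"
  shows "(\<lambda>k. \<integral>z. real (Suc k) * \<beta> ((x - z) * real (Suc k)) * f z \<partial>lborel) \<longlonglongrightarrow> (\<integral>w. \<beta> w \<partial>lborel) * f x"
proof -
  have bm[measurable]: "\<beta> \<in> borel_measurable borel" "f \<in> borel_measurable borel"
    using cont f by (auto intro: borel_measurable_continuous_onI)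
  have "compact (f ` {x-1..x+1})" by (intro compact_continuous_image continuous_on_subset[OF f]) auto
  then obtain B where B: "\<And>y. y \<in> {x-1..x+1} \<Longrightarrow> \<bar>f y\<bar> \<le> B"
    using compact_imp_bounded bounded_iff by (metis imageI real_norm_def)
  have "(\<lambda>k. \<integral>w. \<beta> w * f (x - w / real (Suc k)) \<partial>lborel) \<longlonglongrightarrow> (\<integral>w. \<beta> w * f x \<partial>lborel)"
  proof (rule integral_dominated_convergence[where w="\<lambda>w. \<bar>\<beta> w\<bar> * B"])
    show "integrable lborel (\<lambda>w. \<bar>\<beta> w\<bar> * B)"
      using integrable_compact_support[OF cont b0] by (intro integrable_mult_left integrable_abs) auto
    have "(\<lambda>k. w / real (Suc k)) \<longlonglongrightarrow> 0" for w :: real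
      by (rule lim_const_over_n[THEN LIMSEQ_Suc])
    then have "(\<lambda>k. x - w / real (Suc k)) \<longlonglongrightarrow> x" for w
      using tendsto_diff[OF tendsto_const, of "\<lambda>k. w / real (Suc k)" 0 sequentially x] by simp
    then have "(\<lambda>k. f (x - w / real (Suc k))) \<longlonglongrightarrow> f x" for w
      using f by (intro continuous_on_tendsto_compose[OF f]) auto
    then show "AE w in lborel. (\<lambda>k. \<beta> w * f (x - w / real (Suc k))) \<longlonglongrightarrow> \<beta> w * f x"
      by (intro AE_I2 tendsto_intros)
    show "AE w in lborel. norm (\<beta> w * f (x - w / real (Suc k))) \<le> \<bar>\<beta> w\<bar> * B" for k
    proof (intro AE_I2)
      fix w
      show "norm (\<beta> w * f (x - w / real (Suc k))) \<le> \<bar>\<beta> w\<bar> * B"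
      proof (cases "1 < \<bar>w\<bar>")
        case False
        then have "\<bar>w / real (Suc k)\<bar> \<le> 1" by (simp add: abs_divide divide_le_eq)
        then have "x - w / real (Suc k) \<in> {x-1..x+1}" unfolding abs_le_iff atLeastAtMost_iff by linarith
        then have "\<bar>f (x - w / real (Suc k))\<bar> \<le> B" by (rule B)
        then show ?thesis by (simp add: abs_mult mult_left_mono)
      qed (simp add: b0)
    qed
  qed measurable
  then show ?thesis unfolding mollifier_eq by simp
qed

text \<open>The constant is the integral of \<open>\<bar>\<beta>\<bar>\<close> rather than of
  \<open>\<beta>\<close>: the kernel will be the derivative of a step that is not assumed monotone,
  so it may change sign.\<close>

lemma mollifier_bound:
  fixes \<beta> f :: "real \<Rightarrow> real"
  assumes cont: "continuous_on UNIV \<beta>" and b0: "\<And>x. 1 < \<bar>x\<bar> \<Longrightarrow> \<beta> x = 0" and f: "continuous_on UNIV f"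
    and B: "\<And>x. \<bar>f x\<bar> \<le> B"
  shows "\<bar>\<integral>z. real (Suc k) * \<beta> ((x - z) * real (Suc k)) * f z \<partial>lborel\<bar> \<le> (\<integral>w. \<bar>\<beta> w\<bar> \<partial>lborel) * B"
proof -
  have bm[measurable]: "\<beta> \<in> borel_measurable borel" "f \<in> borel_measurable borel"
    using cont f by (auto intro: borel_measurable_continuous_onI)
  have ib: "integrable lborel (\<lambda>w. \<bar>\<beta> w\<bar> * B)"
    using integrable_compact_support[OF cont b0] by (intro integrable_mult_left integrable_abs) auto
  have le: "norm (\<beta> w * f (x - w / real (Suc k))) \<le> \<bar>\<beta> w\<bar> * B" for w
    using B by (simp add: abs_mult mult_left_mono)
  have "norm (\<integral>w. \<beta> w * f (x - w / real (Suc k)) \<partial>lborel) \<le> (\<integral>w. \<bar>\<beta> w\<bar> * B \<partial>lborel)"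
    by (rule Bochner_Integration.integral_norm_bound_integral[OF _ ib le], rule Bochner_Integration.integrable_bound[OF ib])
       (auto intro!: AE_I2 order_trans[OF le[unfolded real_norm_def] abs_ge_self] simp del: of_nat_Suc)
  then show ?thesis unfolding mollifier_eq by simp
qed

section \<open>The balance law\<close>

lemma borel_measurable_indicator_mult:
  fixes f :: "real \<Rightarrow> real"
  assumes "f \<in> borel_measurable borel"
  shows "(\<lambda>s. indicator {a..b} s * f s) \<in> borel_measurable lborel"
  using assms by simp

lemma integrable_indicator_const:
  fixes k :: real
  shows "integrable lborel (\<lambda>s. indicator {a..b::real} s * k)"
  by (intro integrable_mult_left integrable_real_indicator) (auto simp: emeasure_lborel_Icc_eq)

text \<open>What the transport of \<open>\<mu>\<close> rests on. A bound for \<open>u\<close> on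
  time strips gives finite speed of propagation; uniform continuity of \<open>u\<close> in
  \<open>(t, x)\<close> turns weak continuity of \<open>\<mu>\<close> into continuity of integrals
  whose integrand varies with time as well.\<close>

locale measure_transport =
  fixes \<psi> :: "real \<Rightarrow> real" and u :: "real \<Rightarrow> real \<Rightarrow> real" and \<mu> :: "real \<Rightarrow> real measure"
  assumes psi: "smooth1 \<psi>" "\<And>x. x \<le> - 1 \<Longrightarrow> \<psi> x = 0" "\<And>x. 1 \<le> x \<Longrightarrow> \<psi> x = 1"
      "\<And>x. 0 \<le> \<psi> x" "\<And>x. \<psi> x \<le> 1"
    and sets_mu: "\<And>t. t \<ge> 0 \<Longrightarrow> sets (\<mu> t) = sets borel"
    and finite_mu: "\<And>t. t \<ge> 0 \<Longrightarrow> finite_measure (\<mu> t)"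
    and u_bdd: "\<And>T. T > 0 \<Longrightarrow> \<exists>M. \<forall>t\<in>{0..T}. \<forall>x. \<bar>u t x\<bar> \<le> M"
    and u_unif: "\<And>T. T > 0 \<Longrightarrow> uniformly_continuous_on ({0..T} \<times> UNIV) (\<lambda>(t, x). u t x)"
    and weak_cont: "\<And>f :: real \<Rightarrow> real. continuous_on UNIV f \<Longrightarrow> bounded (range f) \<Longrightarrow>
      continuous_on {0..} (\<lambda>t. \<integral>x. f x \<partial>\<mu> t)"
    and weak_eq: "\<And>\<phi>. test_fun \<phi> \<Longrightarrow>
      (LINT t:{0..}|lborel. (\<integral>x. deriv (\<lambda>s. \<phi> s x) t + u t x * deriv (\<lambda>y. \<phi> t y) x \<partial>\<mu> t))
        = - (\<integral>x. \<phi> 0 x \<partial>\<mu> 0)"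
begin

section \<open>Integrals against \<open>\<mu>(t)\<close> and their continuity in time\<close>

lemma space_mu: "t \<ge> 0 \<Longrightarrow> space (\<mu> t) = UNIV"
  using sets_eq_imp_space_eq[OF sets_mu] by simp

lemma measurable_mu: "t \<ge> 0 \<Longrightarrow> f \<in> borel_measurable borel \<Longrightarrow> f \<in> borel_measurable (\<mu> t)"
  using measurable_cong_sets[OF sets_mu refl] by blast

lemma integrable_mu:
  fixes f :: "real \<Rightarrow> real"
  assumes "t \<ge> 0" "f \<in> borel_measurable borel" "\<And>x. \<bar>f x\<bar> \<le> B"
  shows "integrable (\<mu> t) f"
  by (rule finite_measure.integrable_const_bound[OF finite_mu, where B=B])
     (use assms measurable_mu in auto)

lemma integral_mu_bound:
  fixes f :: "real \<Rightarrow> real"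
  assumes "t \<ge> 0" "f \<in> borel_measurable borel" "\<And>x. \<bar>f x\<bar> \<le> B"
  shows "\<bar>\<integral>x. f x \<partial>\<mu> t\<bar> \<le> B * measure (\<mu> t) UNIV"
proof -
  have i1: "integrable (\<mu> t) f" using assms by (rule integrable_mu)
  have i2: "integrable (\<mu> t) (\<lambda>_. B)" using finite_mu[OF assms(1)] by (rule finite_measure.integrable_const)
  have "norm (\<integral>x. f x \<partial>\<mu> t) \<le> (\<integral>x. B \<partial>\<mu> t)"
    by (rule Bochner_Integration.integral_norm_bound_integral[OF i1 i2]) (simp add: assms(3))
  then show ?thesis using assms(1) by (simp add: space_mu mult.commute)
qed

lemma u_cont: "t \<ge> 0 \<Longrightarrow> continuous_on UNIV (u t)"
proof -
  assume t: "t \<ge> 0"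
  have "continuous_on ({0..t+1} \<times> UNIV) (\<lambda>(t, x). u t x)"
    using u_unif[of "t + 1"] t by (intro uniformly_continuous_imp_continuous) auto
  then have "continuous_on UNIV (\<lambda>x. (\<lambda>(t, x). u t x) (t, x))"
    by (rule continuous_on_compose2) (use t in \<open>auto intro!: continuous_intros\<close>)
  then show ?thesis by simp
qed

lemma u_meas: "t \<ge> 0 \<Longrightarrow> u t \<in> borel_measurable borel"
  by (intro borel_measurable_continuous_onI u_cont)

lemma continuous_mass: "continuous_on {0..} (\<lambda>t. measure (\<mu> t) UNIV)"
proof -
  have "continuous_on {0..} (\<lambda>t. \<integral>x. (1::real) \<partial>\<mu> t)"
    by (rule weak_cont[of "\<lambda>_. 1"]) (auto intro: finite_imp_bounded)
  then show ?thesis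
    by (rule continuous_on_eq) (simp add: space_mu)
qed

lemma mass_bound: obtains B where "B \<ge> 0" "\<And>t. t \<in> {0..T} \<Longrightarrow> measure (\<mu> t) UNIV \<le> B"
proof -
  have "compact ((\<lambda>t. measure (\<mu> t) UNIV) ` {0..T})"
    by (intro compact_continuous_image continuous_on_subset[OF continuous_mass]) auto
  then obtain B where B: "\<And>t. t \<in> {0..T} \<Longrightarrow> \<bar>measure (\<mu> t) UNIV\<bar> \<le> B"
    using compact_imp_bounded bounded_iff by (metis imageI real_norm_def)
  then show thesis by (intro that[of "max B 0"]) force+
qed

lemma uniform_limit_u:
  assumes lim: "(\<tau> \<longlongrightarrow> t0) F" and pos: "\<forall>\<^sub>F i in F. 0 \<le> \<tau> i" and t0: "0 \<le> t0"
  shows "uniform_limit UNIV (\<lambda>i. u (\<tau> i)) (u t0) F"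
proof (rule uniform_limitI)
  fix e :: real assume "e > 0"
  obtain d where d: "d > 0" "\<And>p q. p \<in> {0..t0 + 1} \<times> UNIV \<Longrightarrow> q \<in> {0..t0 + 1} \<times> UNIV \<Longrightarrow> dist q p < d \<Longrightarrow>
      dist ((\<lambda>(t, x). u t x) q) ((\<lambda>(t, x). u t x) p) < e"
    using u_unif[of "t0 + 1"] t0 \<open>e > 0\<close> unfolding uniformly_continuous_on_def by (metis add_nonneg_pos zero_less_one)
  have "\<forall>\<^sub>F i in F. dist (\<tau> i) t0 < min d 1" using tendstoD[OF lim, of "min d 1"] d(1) by simp
  then show "\<forall>\<^sub>F i in F. \<forall>x\<in>UNIV. dist (u (\<tau> i) x) (u t0 x) < e"
    using pos
  proof eventually_elim
    case (elim i)
    show ?case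
    proof
      fix x :: real
      have "dist (\<tau> i, x) (t0, x) < d" using elim by (simp add: dist_Pair_Pair)
      moreover have "\<tau> i \<le> t0 + 1" using elim by (auto simp: dist_real_def)
      ultimately show "dist (u (\<tau> i) x) (u t0 x) < e"
        using d(2)[of "(t0, x)" "(\<tau> i, x)"] elim t0 by auto
    qed
  qed
qed

text \<open>Weak continuity settles the fixed integrand \<open>g0\<close>; the remaining error is at
  most the uniform distance of \<open>g i\<close> and \<open>g0\<close> times the mass, and masses
  stay bounded because the constant \<open>1\<close> is a bounded continuous function. The filter is
  arbitrary because limits in time, position and frame speed are all taken with it.\<close>

lemma tendsto_integral_mu:
  fixes g :: "'i \<Rightarrow> real \<Rightarrow> real"
  assumes lim: "(\<tau> \<longlongrightarrow> t0) F" and pos: "\<forall>\<^sub>F i in F. 0 \<le> \<tau> i" and t0: "0 \<le> t0"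
    and gm: "\<forall>\<^sub>F i in F. g i \<in> borel_measurable borel" and ul: "uniform_limit UNIV g g0 F"
    and cont: "continuous_on UNIV g0" and bdd: "\<And>x. \<bar>g0 x\<bar> \<le> B"
  shows "((\<lambda>i. \<integral>x. g i x \<partial>\<mu> (\<tau> i)) \<longlongrightarrow> (\<integral>x. g0 x \<partial>\<mu> t0)) F"
proof -
  have g0m: "g0 \<in> borel_measurable borel" using cont by (rule borel_measurable_continuous_onI)
  have pos': "\<forall>\<^sub>F i in F. \<tau> i \<in> {0..}" using pos by simp
  have "((\<lambda>i. \<integral>x. g0 x \<partial>\<mu> (\<tau> i)) \<longlongrightarrow> (\<integral>x. g0 x \<partial>\<mu> t0)) F"
    by (rule continuous_on_tendsto_compose[OF weak_cont lim _ pos'])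
       (use cont bdd t0 in \<open>auto simp: bounded_iff\<close>)
  moreover have "((\<lambda>i. (\<integral>x. g i x \<partial>\<mu> (\<tau> i)) - (\<integral>x. g0 x \<partial>\<mu> (\<tau> i))) \<longlongrightarrow> 0) F"
  proof (rule tendstoI)
    fix e :: real assume "e > 0"
    \<comment> \<open>An eventual bound for the masses, positive even if \<open>\<mu> t0\<close> is
      the zero measure.\<close>
    define K where "K = measure (\<mu> t0) UNIV + 1"
    have "K > 0" unfolding K_def by (simp add: add_nonneg_pos)
    have "((\<lambda>i. measure (\<mu> (\<tau> i)) UNIV) \<longlongrightarrow> measure (\<mu> t0) UNIV) F"
      by (rule continuous_on_tendsto_compose[OF continuous_mass lim _ pos']) (use t0 in auto)
    then have "\<forall>\<^sub>F i in F. dist (measure (\<mu> (\<tau> i)) UNIV) (measure (\<mu> t0) UNIV) < 1"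
      by (rule tendstoD) simp
    moreover have "\<forall>\<^sub>F i in F. \<forall>x\<in>UNIV. dist (g i x) (g0 x) < e / (2 * K)"
      by (rule uniform_limitD[OF ul]) (use \<open>e > 0\<close> \<open>K > 0\<close> in simp)
    ultimately show "\<forall>\<^sub>F i in F. dist ((\<integral>x. g i x \<partial>\<mu> (\<tau> i)) - (\<integral>x. g0 x \<partial>\<mu> (\<tau> i))) 0 < e"
      using pos gm
    proof eventually_elim
      case (elim i)
      have d: "\<bar>g i x - g0 x\<bar> \<le> e / (2 * K)" for x using elim(2) by (auto simp: dist_real_def intro: less_imp_le)
      have "\<bar>g i x\<bar> \<le> B + e / (2 * K)" for x using d[of x] bdd[of x] by linarith
      then have "(\<integral>x. g i x \<partial>\<mu> (\<tau> i)) - (\<integral>x. g0 x \<partial>\<mu> (\<tau> i)) = (\<integral>x. g i x - g0 x \<partial>\<mu> (\<tau> i))"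
        using elim bdd g0m by (subst Bochner_Integration.integral_diff) (auto intro!: integrable_mu)
      moreover have "\<bar>\<integral>x. g i x - g0 x \<partial>\<mu> (\<tau> i)\<bar> \<le> e / (2 * K) * measure (\<mu> (\<tau> i)) UNIV"
        by (rule integral_mu_bound) (use elim g0m d in auto)
      moreover have "e / (2 * K) * measure (\<mu> (\<tau> i)) UNIV \<le> e / (2 * K) * K"
        using elim(1) \<open>e > 0\<close> \<open>K > 0\<close> unfolding K_def by (intro mult_left_mono) (auto simp: dist_real_def)
      moreover have "e / (2 * K) * K = e / 2" using \<open>K > 0\<close> by simp
      ultimately show ?case using \<open>e > 0\<close> by (simp add: dist_real_def)
    qed
  qed
  ultimately show ?thesis using tendsto_add by fastforce
qed

lemma uniform_limit_shift:
  fixes g :: "real \<Rightarrow> real"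
  assumes "uniformly_continuous_on UNIV g" "(\<sigma> \<longlongrightarrow> \<sigma>0) F"
  shows "uniform_limit UNIV (\<lambda>i x. g (x - \<sigma> i)) (\<lambda>x. g (x - \<sigma>0)) F"
proof (rule uniform_limitI)
  fix e :: real assume "e > 0"
  obtain d where d: "d > 0" "\<And>x y. dist y x < d \<Longrightarrow> dist (g y) (g x) < e"
    using assms(1) \<open>e > 0\<close> unfolding uniformly_continuous_on_def by auto
  have "\<forall>\<^sub>F i in F. dist (\<sigma> i) \<sigma>0 < d" using tendstoD[OF assms(2) d(1)] .
  then show "\<forall>\<^sub>F i in F. \<forall>x\<in>UNIV. dist (g (x - \<sigma> i)) (g (x - \<sigma>0)) < e"
    by eventually_elim (use d(2) in \<open>simp add: dist_real_def abs_minus_commute\<close>)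
qed

definition flux :: "real \<Rightarrow> (real \<Rightarrow> real) \<Rightarrow> real \<Rightarrow> real" where
  "flux c g s = (\<integral>x. (u s x - c) * g (x - c * s) \<partial>\<mu> s)"

lemma u_bound:
  obtains M where "M \<ge> 0" "\<And>t x. t \<in> {0..T} \<Longrightarrow> \<bar>u t x\<bar> \<le> M"
proof -
  have "0 < max T 1" by simp
  then obtain M where M: "\<forall>t\<in>{0..max T 1}. \<forall>x. \<bar>u t x\<bar> \<le> M" using u_bdd by blast
  have "\<bar>u t x\<bar> \<le> max M 0" if "t \<in> {0..T}" for t x
    using bspec[OF M, of t] that by (auto simp: le_max_iff_disj)
  then show thesis by (intro that[of "max M 0"]) auto
qed

text \<open>Time, shift and frame speed vary together: \<open>GHS_local\<close> needs a nearly
  constant flux along all lines of slope close to \<open>u0\<close> through points near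
  \<open>(t0, x0)\<close>.\<close>

lemma flux_tendsto:
  assumes g: "uniformly_continuous_on UNIV g" "\<And>x. \<bar>g x\<bar> \<le> B"
    and lim: "(\<tau> \<longlongrightarrow> t0) F" and pos: "\<forall>\<^sub>F i in F. 0 \<le> \<tau> i" and t0: "0 \<le> t0"
    and z: "(\<sigma> \<longlongrightarrow> \<sigma>0) F" and c: "(\<kappa> \<longlongrightarrow> c) F"
  shows "((\<lambda>i. \<integral>x. (u (\<tau> i) x - \<kappa> i) * g (x - \<sigma> i) \<partial>\<mu> (\<tau> i)) \<longlongrightarrow> (\<integral>x. (u t0 x - c) * g (x - \<sigma>0) \<partial>\<mu> t0)) F"
proof -
  have gc: "continuous_on UNIV g" by (rule uniformly_continuous_imp_continuous[OF g(1)])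
  obtain M where M: "M \<ge> 0" "\<And>t x. t \<in> {0..t0} \<Longrightarrow> \<bar>u t x\<bar> \<le> M" using u_bound[of t0] by blast
  have bu: "\<bar>u t0 x - c\<bar> \<le> M + \<bar>c\<bar>" for x
    using M(2)[of t0 x] t0 by (intro order_trans[OF abs_triangle_ineq4]) auto
  show ?thesis
  proof (rule tendsto_integral_mu[OF lim pos t0])
    have [measurable]: "g \<in> borel_measurable borel" using gc by (rule borel_measurable_continuous_onI)
    show "\<forall>\<^sub>F i in F. (\<lambda>x. (u (\<tau> i) x - \<kappa> i) * g (x - \<sigma> i)) \<in> borel_measurable borel"
      using pos
    proof eventually_elim
      case (elim i)
      have [measurable]: "u (\<tau> i) \<in> borel_measurable borel" using elim by (rule u_meas)
      show ?case by measurable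
    qed
    have "uniform_limit UNIV (\<lambda>i (x::real). \<kappa> i) (\<lambda>x. c) F"
      using c by (auto simp: uniform_limit_iff tendsto_iff)
    then show "uniform_limit UNIV (\<lambda>i x. (u (\<tau> i) x - \<kappa> i) * g (x - \<sigma> i)) (\<lambda>x. (u t0 x - c) * g (x - \<sigma>0)) F"
      by (intro uniform_lim_mult uniform_limit_minus uniform_limit_u[OF lim pos t0] uniform_limit_shift[OF g(1) z])
         (use bu g(2) in \<open>auto simp: bounded_iff\<close>)
    show "continuous_on UNIV (\<lambda>x. (u t0 x - c) * g (x - \<sigma>0))"
      by (intro continuous_intros u_cont t0 continuous_on_compose2[OF gc]) auto
    show "\<bar>(u t0 x - c) * g (x - \<sigma>0)\<bar> \<le> (M + \<bar>c\<bar>) * B" for x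
      unfolding abs_mult using bu g(2) by (intro mult_mono) (use M in auto)
  qed
qed

text \<open>Joint continuity in shift and time supplies the measurability for Fubini when shifted
  copies are superposed.\<close>

lemma flux_continuous:
  assumes g: "uniformly_continuous_on UNIV g" "\<And>x. \<bar>g x\<bar> \<le> B"
  shows "continuous_on (UNIV \<times> {0..}) (\<lambda>(z, s). flux c (\<lambda>x. g (x - z)) s)"
proof -
  define H where "H i = (\<integral>x. (u (snd i) x - c) * g (x - (c * snd i + fst i)) \<partial>\<mu> (snd i))" for i :: "real \<times> real"
  have "(H \<longlongrightarrow> H p) (at p within UNIV \<times> {0..})" if p: "p \<in> UNIV \<times> {0..}" for p
  proof -
    have pos: "\<forall>\<^sub>F i in at p within UNIV \<times> {0..}. 0 \<le> snd i"
      unfolding eventually_at_topological by auto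
    have id: "((\<lambda>i. i) \<longlongrightarrow> p) (at p within UNIV \<times> {0..})" by (rule tendsto_ident_at)
    show ?thesis
      unfolding H_def
      by (rule flux_tendsto[OF g _ pos]) (use p in \<open>auto intro!: tendsto_intros id\<close>)
  qed
  then have "continuous_on (UNIV \<times> {0..}) H" by (simp add: continuous_on_def)
  moreover have "(\<lambda>(z, s). flux c (\<lambda>x. g (x - z)) s) = H"
    unfolding flux_def by (auto simp: H_def fun_eq_iff diff_diff_eq)
  ultimately show ?thesis by (simp only:)
qed

lemma flux_continuous_time:
  assumes g: "uniformly_continuous_on UNIV g" "\<And>x. \<bar>g x\<bar> \<le> B"
  shows "continuous_on {0..} (flux c g)"
proof -
  have "continuous_on {0..} (\<lambda>s::real. (0::real, s))"
    by (intro continuous_on_Pair continuous_on_const continuous_on_id)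
  moreover have "(\<lambda>s::real. (0::real, s)) ` {0..} \<subseteq> UNIV \<times> {0..}" by auto
  ultimately have "continuous_on {0..} ((\<lambda>(z, s). flux c (\<lambda>x. g (x - z)) s) \<circ> (\<lambda>s. (0, s)))"
    using continuous_on_compose continuous_on_subset[OF flux_continuous[OF g]] by blast
  moreover have "((\<lambda>(z, s). flux c (\<lambda>x. g (x - z)) s) \<circ> (\<lambda>s. (0, s))) = flux c g"
    unfolding o_def prod.case diff_zero ..
  ultimately show ?thesis by (simp only:)
qed

lemma moving_integral_continuous:
  fixes g :: "real \<Rightarrow> real"
  assumes g: "uniformly_continuous_on UNIV g" "\<And>x. \<bar>g x\<bar> \<le> B"
  shows "continuous_on {0..} (\<lambda>t. \<integral>x. g (x - c * t) \<partial>\<mu> t)"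
  unfolding continuous_on_def
proof
  fix t0 :: real assume t0: "t0 \<in> {0..}"
  have gc: "continuous_on UNIV g" by (rule uniformly_continuous_imp_continuous[OF g(1)])
  have [measurable]: "g \<in> borel_measurable borel" using gc by (rule borel_measurable_continuous_onI)
  have lim: "((\<lambda>t. t) \<longlongrightarrow> t0) (at t0 within {0..})" by (rule tendsto_ident_at)
  show "((\<lambda>t. \<integral>x. g (x - c * t) \<partial>\<mu> t) \<longlongrightarrow> (\<integral>x. g (x - c * t0) \<partial>\<mu> t0)) (at t0 within {0..})"
  proof (rule tendsto_integral_mu[OF lim, where B=B])
    show "\<forall>\<^sub>F i in at t0 within {0..}. 0 \<le> i" unfolding eventually_at_topological by auto
    show "0 \<le> t0" using t0 by simp
    show "uniform_limit UNIV (\<lambda>i x. g (x - c * i)) (\<lambda>x. g (x - c * t0)) (at t0 within {0..})"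
      by (rule uniform_limit_shift[OF g(1)]) (intro tendsto_intros)
    show "continuous_on UNIV (\<lambda>x. g (x - c * t0))"
      by (rule continuous_on_compose2[OF gc]) (auto intro!: continuous_intros)
  qed (use g in auto)
qed

text \<open>\<open>g\<close> stands for the derivative of \<open>\<theta>\<close> but is a separate
  argument, so that the law passes to limits of pairs without differentiating the limit.
  Measurability of the flux in time is carried along for the next dominated convergence; the
  indicator removes negative times, where \<open>\<mu>\<close> is arbitrary.\<close>

definition balance :: "real \<Rightarrow> (real \<Rightarrow> real) \<Rightarrow> (real \<Rightarrow> real) \<Rightarrow> bool" where
  "balance c \<theta> g \<longleftrightarrow> (\<lambda>s. indicator {0..} s * flux c g s) \<in> borel_measurable borel \<and>
     (\<forall>t\<ge>0. (\<integral>x. \<theta> (x - c * t) \<partial>\<mu> t) - (\<integral>x. \<theta> x \<partial>\<mu> 0) = (LINT s:{0..t}|lborel. flux c g s))"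

lemma flux_bound:
  fixes B :: real
  assumes g: "g \<in> borel_measurable borel" "\<And>x. \<bar>g x\<bar> \<le> B"
    and M: "\<And>x. \<bar>u s x\<bar> \<le> M" and s: "s \<ge> 0"
  shows "\<bar>flux c g s\<bar> \<le> (M + \<bar>c\<bar>) * B * measure (\<mu> s) UNIV"
  unfolding flux_def
proof (rule integral_mu_bound[OF s])
  note [measurable] = g(1) u_meas[OF s]
  show "(\<lambda>x. (u s x - c) * g (x - c * s)) \<in> borel_measurable borel" by measurable
  fix x
  have a: "\<bar>u s x - c\<bar> \<le> M + \<bar>c\<bar>" using M[of x] by linarith
  show "\<bar>(u s x - c) * g (x - c * s)\<bar> \<le> (M + \<bar>c\<bar>) * B"
    unfolding abs_mult by (rule mult_mono[OF a g(2) order_trans[OF abs_ge_zero a] abs_ge_zero])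
qed

text \<open>One constant for all \<open>g\<close> bounded by \<open>B\<close>, hence a common
  majorant for a sequence of functions or a family of shifts.\<close>

lemma flux_bounded:
  fixes B c t :: real
  assumes B0: "0 \<le> B"
  obtains K where "K \<ge> 0"
    "\<And>(g :: real \<Rightarrow> real) s. g \<in> borel_measurable borel \<Longrightarrow> (\<And>x. \<bar>g x\<bar> \<le> B) \<Longrightarrow> s \<in> {0..t} \<Longrightarrow> \<bar>flux c g s\<bar> \<le> K"
proof -
  obtain M where M: "M \<ge> 0" "\<And>s x. s \<in> {0..t} \<Longrightarrow> \<bar>u s x\<bar> \<le> M" using u_bound[of t] by blast
  obtain K where K: "K \<ge> 0" "\<And>s. s \<in> {0..t} \<Longrightarrow> measure (\<mu> s) UNIV \<le> K" using mass_bound[of t] by blast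
  show thesis
  proof (rule that)
    show "0 \<le> (M + \<bar>c\<bar>) * B * K" using M(1) K(1) B0 by simp
    fix g :: "real \<Rightarrow> real" and s assume g: "g \<in> borel_measurable borel" "\<And>x. \<bar>g x\<bar> \<le> B" and s: "s \<in> {0..t}"
    have "0 \<le> s" using s by simp
    have "\<bar>flux c g s\<bar> \<le> (M + \<bar>c\<bar>) * B * measure (\<mu> s) UNIV"
      by (rule flux_bound[OF g M(2)[OF s] \<open>0 \<le> s\<close>])
    also have "\<dots> \<le> (M + \<bar>c\<bar>) * B * K"
      using K(2)[OF s] M(1) B0 by (intro mult_left_mono) auto
    finally show "\<bar>flux c g s\<bar> \<le> (M + \<bar>c\<bar>) * B * K" .
  qed
qed

text \<open>Dominated convergence three times: under \<open>\<mu>(s)\<close> for the flux, under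
  \<open>\<mu>(t)\<close> for the \<open>\<theta> j\<close>, and in time. Constants are integrable
  majorants since the measures are finite and the time interval is bounded.\<close>

lemma balance_limit:
  assumes bal: "\<And>j::nat. balance c (\<theta> j) (g j)"
    and m[measurable]: "\<And>j. \<theta> j \<in> borel_measurable borel" "\<And>j. g j \<in> borel_measurable borel"
    and lim: "\<And>x. (\<lambda>j. \<theta> j x) \<longlonglongrightarrow> \<theta>' x" "\<And>x. (\<lambda>j. g j x) \<longlonglongrightarrow> g' x"
    and A: "\<And>j x. \<bar>\<theta> j x\<bar> \<le> A" and B: "\<And>j x. \<bar>g j x\<bar> \<le> B"
  shows "balance c \<theta>' g'"
proof -
  have m'[measurable]: "\<theta>' \<in> borel_measurable borel" "g' \<in> borel_measurable borel"
    by (rule borel_measurable_LIMSEQ_real[OF lim(1) m(1)], rule borel_measurable_LIMSEQ_real[OF lim(2) m(2)])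
  have A0: "A \<ge> 0" and B0: "B \<ge> 0" using A[of 0 0] B[of 0 0] by linarith+
  have fl: "(\<lambda>j. flux c (g j) s) \<longlonglongrightarrow> flux c g' s" if s: "s \<ge> 0" for s
  proof -
    obtain M where M: "M \<ge> 0" "\<And>t x. t \<in> {0..s} \<Longrightarrow> \<bar>u t x\<bar> \<le> M" using u_bound[of s] by blast
    show ?thesis
    unfolding flux_def
  proof (rule integral_dominated_convergence[where w="\<lambda>_. (M + \<bar>c\<bar>) * B"])
    note [measurable] = u_meas[OF s]
    show "integrable (\<mu> s) (\<lambda>x. (M + \<bar>c\<bar>) * B)" using finite_mu[OF s] by (rule finite_measure.integrable_const)
    show "(\<lambda>x. (u s x - c) * g j (x - c * s)) \<in> borel_measurable (\<mu> s)" for j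
      by (rule measurable_mu[OF s]) measurable
    show "(\<lambda>x. (u s x - c) * g' (x - c * s)) \<in> borel_measurable (\<mu> s)"
      by (rule measurable_mu[OF s]) measurable
    show "AE x in \<mu> s. (\<lambda>j. (u s x - c) * g j (x - c * s)) \<longlonglongrightarrow> (u s x - c) * g' (x - c * s)"
      by (intro AE_I2 tendsto_intros lim)
    show "AE x in \<mu> s. norm ((u s x - c) * g j (x - c * s)) \<le> (M + \<bar>c\<bar>) * B" for j
    proof (intro AE_I2)
      fix x
      have "\<bar>u s x - c\<bar> \<le> M + \<bar>c\<bar>" using M(2)[of s x] s by auto
      then show "norm ((u s x - c) * g j (x - c * s)) \<le> (M + \<bar>c\<bar>) * B"
        unfolding real_norm_def abs_mult using B M(1) by (intro mult_mono) auto
    qed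
  qed
  qed
  have mf: "(\<lambda>s. indicator {0..} s * flux c (g j) s) \<in> borel_measurable borel" for j
    using bal unfolding balance_def by blast
  have "(\<lambda>j. indicator {0..} s * flux c (g j) s) \<longlonglongrightarrow> indicator {0..} s * flux c g' s" for s
    using fl[of s] by (cases "s \<ge> 0") auto
  then have mf': "(\<lambda>s. indicator {0..} s * flux c g' s) \<in> borel_measurable borel"
    using mf by (rule borel_measurable_LIMSEQ_real)
  have "(\<integral>x. \<theta>' (x - c * t) \<partial>\<mu> t) - (\<integral>x. \<theta>' x \<partial>\<mu> 0) = (LINT s:{0..t}|lborel. flux c g' s)" if t: "t \<ge> 0" for t
  proof -
    have th: "(\<lambda>j. \<integral>x. \<theta> j (x - z) \<partial>\<mu> t) \<longlonglongrightarrow> (\<integral>x. \<theta>' (x - z) \<partial>\<mu> t)" if t: "t \<ge> 0" for z t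
    proof (rule integral_dominated_convergence[where w="\<lambda>_. A"])
      show "integrable (\<mu> t) (\<lambda>x. A)" using finite_mu[OF t] by (rule finite_measure.integrable_const)
      show "(\<lambda>x. \<theta>' (x - z)) \<in> borel_measurable (\<mu> t)" by (rule measurable_mu[OF t]) measurable
      show "(\<lambda>x. \<theta> j (x - z)) \<in> borel_measurable (\<mu> t)" for j by (rule measurable_mu[OF t]) measurable
    qed (use A lim in auto)
    obtain K where K: "\<And>h s. h \<in> borel_measurable borel \<Longrightarrow> (\<And>x. \<bar>h x\<bar> \<le> B) \<Longrightarrow> s \<in> {0..t} \<Longrightarrow> \<bar>flux c h s\<bar> \<le> K"
      using flux_bounded[OF B0] by blast
    have eq: "(LINT s:{0..t}|lborel. flux c h s) = (\<integral>s. indicator {0..t} s * (indicator {0..} s * flux c h s) \<partial>lborel)" for h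
      unfolding set_lebesgue_integral_def by (rule Bochner_Integration.integral_cong) (auto simp: indicator_def)
    define F where "F h s = indicator {0..t} s * (indicator {0..} s * flux c h s)" for h s
    have Fm: "F h \<in> borel_measurable lborel" if "(\<lambda>s. indicator {0..} s * flux c h s) \<in> borel_measurable borel" for h
      unfolding F_def by (rule borel_measurable_indicator_mult[OF that])
    have w: "integrable lborel (\<lambda>s. indicator {0..t} s * K)"
      by (rule integrable_indicator_const)
    have Fl: "AE s in lborel. (\<lambda>j. F (g j) s) \<longlonglongrightarrow> F g' s"
    proof (rule AE_I2)
      fix s
      show "(\<lambda>j. F (g j) s) \<longlonglongrightarrow> F g' s"
        unfolding F_def using fl[of s] by (cases "s \<in> {0..t}") auto
    qed
    have Fb: "AE s in lborel. norm (F (g j) s) \<le> indicator {0..t} s * K" for j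
    proof (rule AE_I2)
      fix s
      show "norm (F (g j) s) \<le> indicator {0..t} s * K"
        unfolding F_def using K[OF m(2) B, of s j] by (cases "s \<in> {0..t}") auto
    qed
    have "(\<lambda>j. \<integral>s. F (g j) s \<partial>lborel) \<longlonglongrightarrow> (\<integral>s. F g' s \<partial>lborel)"
      by (rule integral_dominated_convergence[OF Fm[OF mf'] Fm[OF mf] w Fl Fb])
    moreover have "(\<integral>s. F (g j) s \<partial>lborel) = (\<integral>x. \<theta> j (x - c * t) \<partial>\<mu> t) - (\<integral>x. \<theta> j x \<partial>\<mu> 0)" for j
      using bal[of j, unfolded balance_def, THEN conjunct2, rule_format, OF t] eq[of "g j"] unfolding F_def by linarith
    ultimately have "(\<lambda>j. (\<integral>x. \<theta> j (x - c * t) \<partial>\<mu> t) - (\<integral>x. \<theta> j x \<partial>\<mu> 0)) \<longlonglongrightarrow> (\<integral>s. F g' s \<partial>lborel)"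
      by (simp only:)
    moreover have "(\<lambda>j. (\<integral>x. \<theta> j (x - c * t) \<partial>\<mu> t) - (\<integral>x. \<theta> j x \<partial>\<mu> 0)) \<longlonglongrightarrow>
        (\<integral>x. \<theta>' (x - c * t) \<partial>\<mu> t) - (\<integral>x. \<theta>' x \<partial>\<mu> 0)"
      using th[OF t, of "c * t"] th[OF order_refl, of 0, unfolded diff_zero] by (rule tendsto_diff)
    ultimately have "(\<integral>s. F g' s \<partial>lborel) = (\<integral>x. \<theta>' (x - c * t) \<partial>\<mu> t) - (\<integral>x. \<theta>' x \<partial>\<mu> 0)"
      by (rule LIMSEQ_unique)
    then show ?thesis using eq[of g'] unfolding F_def by linarith
  qed
  then show ?thesis unfolding balance_def using mf' by blast
qed

end

text \<open>\<open>M\<close> will be \<open>\<mu>(t)\<close>, to move a superposition out of the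
  space integral, and also Lebesgue measure in time. On the product,
  \<open>B * \<bar>f\<bar> * \<bar>g\<bar>\<close> is an integrable majorant.\<close>

lemma fubini_bounded:
  fixes M :: "real measure" and h :: "real \<Rightarrow> real \<Rightarrow> real"
  assumes sM: "sets M = sets borel" and sf: "sigma_finite_measure M"
    and f: "integrable lborel f" and g: "integrable M g"
    and h: "(\<lambda>p. h (fst p) (snd p)) \<in> borel_measurable borel" and B: "\<And>z x. \<bar>h z x\<bar> \<le> B"
  shows "(\<integral>x. g x * (\<integral>z. h z x * f z \<partial>lborel) \<partial>M) = (\<integral>z. f z * (\<integral>x. g x * h z x \<partial>M) \<partial>lborel)"
proof -
  interpret M: sigma_finite_measure M by (rule sf)
  interpret pair_sigma_finite lborel M ..
  have s: "sets (lborel \<Otimes>\<^sub>M M) = sets (borel :: (real \<times> real) measure)"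
    unfolding borel_prod[symmetric] by (intro sets_pair_measure_cong sM) simp
  have hm[measurable]: "(\<lambda>p. h (fst p) (snd p)) \<in> borel_measurable (lborel \<Otimes>\<^sub>M M)"
    using h measurable_cong_sets[OF s refl] by blast
  have h1[measurable]: "(\<lambda>x. h z x) \<in> borel_measurable M" for z
  proof -
    have "Pair z \<in> M \<rightarrow>\<^sub>M lborel \<Otimes>\<^sub>M M" by simp
    from measurable_compose[OF this hm] show ?thesis by simp
  qed
  have fm[measurable]: "f \<in> borel_measurable lborel" "g \<in> borel_measurable M"
    using f g by (auto dest: borel_measurable_integrable)
  have B0: "B \<ge> 0" using B[of 0 0] by linarith
  have dom: "integrable (lborel \<Otimes>\<^sub>M M) (\<lambda>p. B * \<bar>f (fst p)\<bar> * \<bar>g (snd p)\<bar>)"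
  proof (rule Fubini_integrable)
    show "integrable lborel (\<lambda>x. \<integral>y. norm (B * \<bar>f (fst (x, y))\<bar> * \<bar>g (snd (x, y))\<bar>) \<partial>M)"
      using f B0 by (simp add: abs_mult)
    show "AE x in lborel. integrable M (\<lambda>y. B * \<bar>f (fst (x, y))\<bar> * \<bar>g (snd (x, y))\<bar>)"
      using g by simp
  qed measurable
  have "integrable (lborel \<Otimes>\<^sub>M M) (case_prod (\<lambda>z x. f z * (g x * h z x)))"
  proof (rule Bochner_Integration.integrable_bound[OF dom])
    show "AE p in lborel \<Otimes>\<^sub>M M. norm (case_prod (\<lambda>z x. f z * (g x * h z x)) p) \<le> norm (B * \<bar>f (fst p)\<bar> * \<bar>g (snd p)\<bar>)"
    proof (rule AE_I2)
      fix p :: "real \<times> real"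
      have "\<bar>h (fst p) (snd p)\<bar> * (\<bar>f (fst p)\<bar> * \<bar>g (snd p)\<bar>) \<le> B * (\<bar>f (fst p)\<bar> * \<bar>g (snd p)\<bar>)"
        using B by (intro mult_right_mono) auto
      then show "norm (case_prod (\<lambda>z x. f z * (g x * h z x)) p) \<le> norm (B * \<bar>f (fst p)\<bar> * \<bar>g (snd p)\<bar>)"
        using B0 by (simp add: split_beta abs_mult mult_ac)
    qed
    show "(\<lambda>(z, x). f z * (g x * h z x)) \<in> borel_measurable (lborel \<Otimes>\<^sub>M M)"
      unfolding split_beta by measurable
  qed
  from Fubini_integral[OF this]
  have "(\<integral>x. (\<integral>z. f z * (g x * h z x) \<partial>lborel) \<partial>M) = (\<integral>z. (\<integral>x. f z * (g x * h z x) \<partial>M) \<partial>lborel)" .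
  moreover have "(\<integral>z. f z * (g x * h z x) \<partial>lborel) = g x * (\<integral>z. h z x * f z \<partial>lborel)" for x
    by (subst integral_mult_right_zero[symmetric]) (simp add: mult_ac)
  ultimately show ?thesis by simp
qed

section \<open>From compactly supported smooth functions to primitives of continuous integrable
  functions\<close>

context measure_transport
begin

abbreviation "\<beta> \<equiv> deriv \<psi>"

lemma beta_continuous: "continuous_on A \<beta>"
  by (intro smooth1_continuous smooth1_deriv psi)

lemma beta_0: "1 < \<bar>x\<bar> \<Longrightarrow> \<beta> x = 0"
  by (rule deriv_step_eq_0) (use psi in auto)

lemma psi_deriv: "(\<psi> has_real_derivative \<beta> x) (at x)"
  by (rule smooth1_deriv(2)[OF psi(1)])

lemma beta_integral: "(\<integral>x. \<beta> x \<partial>lborel) = 1"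
proof -
  have "(\<integral>x. indicator {-1..1} x *\<^sub>R \<beta> x \<partial>lborel) = \<psi> 1 - \<psi> (- 1)"
    by (rule integral_FTC_atLeastAtMost)
       (auto intro!: beta_continuous has_field_derivative_at_within psi_deriv
          simp: has_real_derivative_iff_has_vector_derivative[symmetric])
  moreover have "(\<lambda>x. indicator {-1..1} x *\<^sub>R \<beta> x) = \<beta>"
  proof
    show "indicator {-1..1} x *\<^sub>R \<beta> x = \<beta> x" for x
      using beta_0[of x] by (cases "1 < \<bar>x\<bar>") (auto simp: indicator_def abs_le_iff)
  qed
  ultimately show ?thesis using psi(2)[of "- 1"] psi(3)[of 1] by simp
qed

text \<open>The test function is \<open>a(t) * g(x - c * t)\<close>, where \<open>a\<close> is
  \<open>1\<close> from time \<open>0\<close> on and is switched off around \<open>t1\<close> on the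
  scale \<open>1 / K\<close>. In the weak equation \<open>a'\<close> is minus a mollifier at
  \<open>t1\<close> and yields \<open>- m t1\<close>, \<open>a\<close> itself tends to the indicator
  of \<open>[0, t1]\<close>, and the initial term is \<open>- m 0\<close>.\<close>

lemma balance_smooth:
  assumes g: "smooth1 g" and g0: "\<And>x. R < \<bar>x\<bar> \<Longrightarrow> g x = 0"
  shows "balance c g (deriv g)"
proof -
  have gc: "continuous_on UNIV g" "continuous_on UNIV (deriv g)"
    by (intro smooth1_continuous smooth1_deriv g)+
  note [measurable] = gc[THEN borel_measurable_continuous_onI]
  have g'0: "deriv g x = 0" if "R < \<bar>x\<bar>" for x
  proof -
    have "open {x::real. R < \<bar>x\<bar>}" by (intro open_Collect_less continuous_intros)
    then have "(g has_real_derivative 0) (at x)"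
      by (rule has_field_derivative_transform_within_open[OF DERIV_const[of 0]]) (use that g0 in auto)
    then show ?thesis by (rule DERIV_imp_deriv)
  qed
  obtain B where B: "B \<ge> 0" "\<And>x. \<bar>g x\<bar> \<le> B" using bounded_compact_support[OF gc(1) g0] by blast
  obtain B' where B': "B' \<ge> 0" "\<And>x. \<bar>deriv g x\<bar> \<le> B'" using bounded_compact_support[OF gc(2) g'0] by blast
  have uc: "uniformly_continuous_on UNIV g" "uniformly_continuous_on UNIV (deriv g)"
    using uniformly_continuous_on_compact_support[OF gc(1) g0] uniformly_continuous_on_compact_support[OF gc(2) g'0] by auto
  define m where "m t = (\<integral>x. g (x - c * t) \<partial>\<mu> t)" for t
  define n where "n = flux c (deriv g)"
  have cm: "continuous_on {0..} m" unfolding m_def by (rule moving_integral_continuous[OF uc(1) B(2)])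
  have cn: "continuous_on {0..} n" unfolding n_def by (rule flux_continuous_time[OF uc(2) B'(2)])
  \<comment> \<open>The mollifier lemmas are about functions on the whole line;
    \<open>max 0 t\<close> extends \<open>m\<close> and \<open>n\<close> continuously by their
    values at \<open>0\<close>.\<close>
  define m1 where "m1 t = m (max 0 t)" for t
  define n1 where "n1 t = n (max 0 t)" for t
  have mx: "continuous_on UNIV (\<lambda>t::real. max 0 t)" by (intro continuous_intros)
  have cm1: "continuous_on UNIV m1" unfolding m1_def
    by (rule continuous_on_compose2[OF cm mx]) auto
  have cn1: "continuous_on UNIV n1" unfolding n1_def
    by (rule continuous_on_compose2[OF cn mx]) auto
  note [measurable] = cm1[THEN borel_measurable_continuous_onI] cn1[THEN borel_measurable_continuous_onI]
    beta_continuous[of UNIV, THEN borel_measurable_continuous_onI] smooth1_continuous[OF psi(1), of UNIV, THEN borel_measurable_continuous_onI]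
  have meas: "(\<lambda>s. indicator {0..} s * flux c (deriv g) s) \<in> borel_measurable borel"
    using borel_measurable_continuous_on_indicator[OF _ cn, of ] unfolding n_def by simp
  have main: "m t1 - m 0 = (\<integral>t. indicator {0..t1} t * n1 t \<partial>lborel)" if t1: "t1 > 0" for t1
  proof -
    define I1 where "I1 k = (\<integral>t. real (Suc k) * \<beta> ((t - t1) * real (Suc k)) * m1 t \<partial>lborel)" for k
    define I2 where "I2 k = (\<integral>t. indicator {0..t1+1} t * ((1 - \<psi> ((t - t1) * real (Suc k))) * n1 t) \<partial>lborel)" for k
    \<comment> \<open>For such \<open>k\<close> the switching-off does not begin before time
      \<open>0\<close>, so that \<open>a 0 = 1\<close>.\<close>
    have key: "I2 k - I1 k = - m 0" if k: "1 \<le> t1 * real (Suc k)" for k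
    proof -
      define K where "K = real (Suc k)"
      have K: "K \<ge> 1" "1 \<le> t1 * K" using k unfolding K_def by auto
      \<comment> \<open>The step \<open>\<psi> (t + 2)\<close> has its transition in
        \<open>[- 3, - 1]\<close>, outside the time range of the equation; it makes the support of
        \<open>a\<close> compact.\<close>
      define a where "a t = \<psi> (1 * t + 2) - \<psi> (K * t + (- t1 * K))" for t
      have a_smooth: "smooth1 a" unfolding a_def by (intro smooth1_diff smooth1_affine psi)
      have a_eq: "a t = 1 - \<psi> ((t - t1) * K)" if "t \<ge> 0" for t
        unfolding a_def using that psi(3)[of "1 * t + 2"] by (simp add: algebra_simps)
      have ad: "(a has_real_derivative (\<beta> (1 * t + 2) * 1 - \<beta> (K * t + (- t1 * K)) * K)) (at t)" for t
        unfolding a_def by (intro DERIV_diff DERIV_chain2[OF psi_deriv]) (auto intro!: derivative_eq_intros)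
      have ad': "deriv a t = - K * \<beta> ((t - t1) * K)" if "t \<ge> 0" for t
        using DERIV_imp_deriv[OF ad, of t] that beta_0[of "1 * t + 2"] by (simp add: algebra_simps)
      define R1 where "R1 = max (max (t1 + 1) 3) R"
      have a0: "a t = 0" if "R1 < \<bar>t\<bar>" for t
      proof (cases "t > 0")
        case True
        then have "t > t1 + 1" using that unfolding R1_def by auto
        then have "1 * 1 \<le> (t - t1) * K" using K by (intro mult_mono) auto
        then show ?thesis using True psi(3)[of "(t - t1) * K"] by (simp add: a_eq)
      next
        case False
        then have "t < - 3" using that unfolding R1_def by auto
        moreover have "K * t + (- t1 * K) \<le> - 1"
          using mult_left_mono[of t "- 3" K] K \<open>t < - 3\<close> by auto
        ultimately show ?thesis unfolding a_def using psi(2) by simp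
      qed
      have tf: "test_fun (\<lambda>t x. a t * g (x - c * t))"
        by (rule test_fun_travelling[where R=R1]) (use a_smooth g a0 g0 in \<open>auto simp: R1_def\<close>)
      \<comment> \<open>The term with \<open>- c * deriv g\<close> from the time derivative joins
        the one with \<open>u * deriv g\<close>: in the moving frame only the relative velocity
        \<open>u - c\<close> appears.\<close>
      have inner: "(\<integral>x. deriv (\<lambda>s. a s * g (x - c * s)) t + u t x * deriv (\<lambda>y. a t * g (y - c * t)) x \<partial>\<mu> t)
          = deriv a t * m t + a t * n t" if t: "t \<ge> 0" for t
      proof -
        note [derivative_intros] = DERIV_chain2[OF smooth1_deriv(2)[OF a_smooth]] DERIV_chain2[OF smooth1_deriv(2)[OF g]]
        have d1: "deriv (\<lambda>s. a s * g (x - c * s)) t = deriv a t * g (x - c * t) + a t * (- c * deriv g (x - c * t))" for x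
          by (rule DERIV_imp_deriv) (auto intro!: derivative_eq_intros)
        have d2: "deriv (\<lambda>y. a t * g (y - c * t)) x = a t * deriv g (x - c * t)" for x
          by (rule DERIV_imp_deriv) (auto intro!: derivative_eq_intros)
        obtain M where M: "M \<ge> 0" "\<And>s x. s \<in> {0..t} \<Longrightarrow> \<bar>u s x\<bar> \<le> M" using u_bound[of t] by blast
        note [measurable] = u_meas[OF t]
        have i1: "integrable (\<mu> t) (\<lambda>x. g (x - c * t))" by (rule integrable_mu[OF t _ B(2)]) measurable
        have i2: "integrable (\<mu> t) (\<lambda>x. (u t x - c) * deriv g (x - c * t))"
        proof (rule integrable_mu[OF t])
          fix x
          have a: "\<bar>u t x - c\<bar> \<le> M + \<bar>c\<bar>" using M(2)[of t x] t by auto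
          show "\<bar>(u t x - c) * deriv g (x - c * t)\<bar> \<le> (M + \<bar>c\<bar>) * B'"
            unfolding abs_mult by (rule mult_mono[OF a B'(2) order_trans[OF abs_ge_zero a] abs_ge_zero])
        qed measurable
        have "(\<integral>x. deriv (\<lambda>s. a s * g (x - c * s)) t + u t x * deriv (\<lambda>y. a t * g (y - c * t)) x \<partial>\<mu> t)
           = (\<integral>x. deriv a t * g (x - c * t) + a t * ((u t x - c) * deriv g (x - c * t)) \<partial>\<mu> t)"
          unfolding d1 d2 by (rule Bochner_Integration.integral_cong) (auto simp: algebra_simps)
        also have "\<dots> = deriv a t * m t + a t * n t"
          using i1 i2 unfolding m_def n_def flux_def by simp
        finally show ?thesis .
      qed
      have "(LINT t:{0..}|lborel. deriv a t * m t + a t * n t) =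
         (LINT t:{0..}|lborel. (\<integral>x. deriv (\<lambda>s. a s * g (x - c * s)) t + u t x * deriv (\<lambda>y. a t * g (y - c * t)) x \<partial>\<mu> t))"
        unfolding set_lebesgue_integral_def by (rule Bochner_Integration.integral_cong) (auto simp: inner indicator_def)
      also have "\<dots> = - (\<integral>x. a 0 * g (x - c * 0) \<partial>\<mu> 0)"
        by (rule weak_eq[OF tf])
      also have "a 0 = 1" using a_eq[of 0] psi(2)[of "- (t1 * K)"] K by simp
      finally have w: "(LINT t:{0..}|lborel. deriv a t * m t + a t * n t) = - m 0" by (simp add: m_def)
      \<comment> \<open>Both integrals may now be taken over the whole line: for
        \<open>t < 0\<close> the mollifier vanishes as well, its support being within
        \<open>1 / K \<le> t1\<close> of \<open>t1\<close>.\<close>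
      have pw: "indicator {0..} t *\<^sub>R (deriv a t * m t + a t * n t) =
          indicator {0..t1+1} t * ((1 - \<psi> ((t - t1) * K)) * n1 t) - K * \<beta> ((t - t1) * K) * m1 t" for t
      proof (cases "t \<ge> 0")
        case True
        have "1 - \<psi> ((t - t1) * K) = 0" if "t > t1 + 1"
        proof -
          have "1 * 1 \<le> (t - t1) * K" using that K by (intro mult_mono) auto
          then show ?thesis using psi(3)[of "(t - t1) * K"] by simp
        qed
        then show ?thesis using True by (auto simp: ad' a_eq m1_def n1_def indicator_def max_def)
      next
        case False
        have "t * K < 0" using False K by (simp add: mult_neg_pos)
        then have "1 < \<bar>(t - t1) * K\<bar>" using K(2) by (simp add: left_diff_distrib)
        then show ?thesis using False beta_0 by simp
      qed
      have i1: "integrable lborel (\<lambda>t. indicator {0..t1+1} t * ((1 - \<psi> ((t - t1) * K)) * n1 t))"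
      proof -
        have "set_integrable lborel {0..t1+1} (\<lambda>t. (1 - \<psi> ((t - t1) * K)) * n1 t)"
          by (intro borel_integrable_atLeastAtMost' continuous_intros continuous_on_subset[OF cn1]
            continuous_on_compose2[OF smooth1_continuous[OF psi(1), of UNIV]]) auto
        then show ?thesis by (simp add: set_integrable_def)
      qed
      have i2: "integrable lborel (\<lambda>t. K * \<beta> ((t - t1) * K) * m1 t)"
      proof (rule integrable_compact_support[where R="t1 + 1"])
        show "continuous_on UNIV (\<lambda>t. K * \<beta> ((t - t1) * K) * m1 t)"
          by (intro continuous_intros cm1 continuous_on_compose2[OF beta_continuous[of UNIV]]) auto
        fix t :: real assume "t1 + 1 < \<bar>t\<bar>"
        then have "1 < \<bar>t - t1\<bar>" using t1 by linarith
        then have "1 < \<bar>t - t1\<bar> * K" 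
          by (rule less_le_trans) (use mult_left_mono[OF K(1) abs_ge_zero[of "t - t1"]] in simp)
        then have "1 < \<bar>(t - t1) * K\<bar>" using K(1) by (simp add: abs_mult)
        then show "K * \<beta> ((t - t1) * K) * m1 t = 0" using beta_0 by simp
      qed
      show ?thesis
        using w unfolding set_lebesgue_integral_def pw I1_def I2_def K_def[symmetric]
        by (subst (asm) Bochner_Integration.integral_diff[OF i1 i2]) simp
    qed
    have lim1: "I1 \<longlonglongrightarrow> m t1"
    proof -
      \<comment> \<open>In \<open>mollifier_tendsto\<close> the kernel is
        \<open>\<beta> ((x - z) * real (Suc k))\<close>, here the sign of the argument is opposite;
        since \<open>\<beta>\<close> is not assumed even, the variable is reflected.\<close>
      have "I1 = (\<lambda>k. \<integral>z. real (Suc k) * \<beta> ((- t1 - z) * real (Suc k)) * m1 (- z) \<partial>lborel)"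
      proof
        show "I1 k = (\<integral>z. real (Suc k) * \<beta> ((- t1 - z) * real (Suc k)) * m1 (- z) \<partial>lborel)" for k
          unfolding I1_def by (subst lborel_integral_real_affine[where c="-1" and t=0]) (simp_all add: algebra_simps)
      qed
      moreover have "(\<lambda>k. \<integral>z. real (Suc k) * \<beta> ((- t1 - z) * real (Suc k)) * m1 (- z) \<partial>lborel)
          \<longlonglongrightarrow> (\<integral>w. \<beta> w \<partial>lborel) * m1 (- (- t1))"
        by (rule mollifier_tendsto[OF beta_continuous beta_0])
           (auto intro!: continuous_on_compose2[OF cm1] continuous_intros)
      ultimately show ?thesis using t1 by (simp add: beta_integral m1_def)
    qed
    have "compact (n1 ` {0..t1+1})" by (intro compact_continuous_image continuous_on_subset[OF cn1]) auto
    then obtain Bn where Bn: "\<And>t. t \<in> {0..t1+1} \<Longrightarrow> \<bar>n1 t\<bar> \<le> Bn"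
      using compact_imp_bounded bounded_iff by (metis imageI real_norm_def)
    have lim2: "I2 \<longlonglongrightarrow> (\<integral>t. indicator {0..t1} t * n1 t \<partial>lborel)"
      unfolding I2_def
    proof (rule integral_dominated_convergence[where w="\<lambda>t. indicator {0..t1+1} t * Bn"])
      show "integrable lborel (\<lambda>t. indicator {0..t1+1} t * Bn)" by (rule integrable_indicator_const)
      show "AE t in lborel. (\<lambda>k. indicator {0..t1+1} t * ((1 - \<psi> ((t - t1) * real (Suc k))) * n1 t)) \<longlonglongrightarrow> indicator {0..t1} t * n1 t"
        using AE_lborel_singleton[of t1]
      proof eventually_elim
        case (elim t)
        then have ev: "\<forall>\<^sub>F k in sequentially. 1 \<le> \<bar>t - t1\<bar> * real (Suc k)"
          by (intro eventually_le_mult_Suc) simp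
        show ?case
        proof (cases "t < t1")
          case True
          have "\<forall>\<^sub>F k in sequentially. indicator {0..t1+1} t * ((1 - \<psi> ((t - t1) * real (Suc k))) * n1 t) = indicator {0..t1} t * n1 t"
            using ev
          proof eventually_elim
            case (elim k)
            then have "(t - t1) * real (Suc k) \<le> - 1" using True by (simp add: algebra_simps)
            then show ?case using True by (simp add: psi(2) indicator_def del: of_nat_Suc)
          qed
          then show ?thesis by (rule tendsto_eventually)
        next
          case False
          have "\<forall>\<^sub>F k in sequentially. indicator {0..t1+1} t * ((1 - \<psi> ((t - t1) * real (Suc k))) * n1 t) = indicator {0..t1} t * n1 t"
            using ev
          proof eventually_elim
            case (elim k)
            then have "1 \<le> (t - t1) * real (Suc k)" using False by simp
            then show ?case using False \<open>t \<noteq> t1\<close> by (simp add: psi(3) indicator_def del: of_nat_Suc)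
          qed
          then show ?thesis by (rule tendsto_eventually)
        qed
      qed
      show "AE t in lborel. norm (indicator {0..t1+1} t * ((1 - \<psi> ((t - t1) * real (Suc k))) * n1 t)) \<le> indicator {0..t1+1} t * Bn" for k
      proof (rule AE_I2)
        fix t
        have "\<bar>1 - \<psi> ((t - t1) * real (Suc k))\<bar> \<le> 1" using psi(4,5)[of "(t - t1) * real (Suc k)"] by linarith
        then have "\<bar>1 - \<psi> ((t - t1) * real (Suc k))\<bar> * \<bar>n1 t\<bar> \<le> 1 * Bn" if "t \<in> {0..t1+1}"
          using Bn[OF that] by (intro mult_mono) auto
        then show "norm (indicator {0..t1+1} t * ((1 - \<psi> ((t - t1) * real (Suc k))) * n1 t)) \<le> indicator {0..t1+1} t * Bn"
          by (auto simp: indicator_def abs_mult simp del: of_nat_Suc)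
      qed
    qed measurable
    have "\<forall>\<^sub>F k in sequentially. I2 k - I1 k = - m 0"
      using eventually_le_mult_Suc[OF t1] by eventually_elim (rule key)
    then have "(\<lambda>k. I2 k - I1 k) \<longlonglongrightarrow> - m 0" by (rule tendsto_eventually)
    moreover have "(\<lambda>k. I2 k - I1 k) \<longlonglongrightarrow> (\<integral>t. indicator {0..t1} t * n1 t \<partial>lborel) - m t1"
      by (intro tendsto_diff lim1 lim2)
    ultimately have "- m 0 = (\<integral>t. indicator {0..t1} t * n1 t \<partial>lborel) - m t1" by (rule LIMSEQ_unique)
    then show ?thesis by simp
  qed
  have "m t - m 0 = (LINT s:{0..t}|lborel. flux c (deriv g) s)" if "t \<ge> 0" for t
  proof -
    have "(LINT s:{0..t}|lborel. flux c (deriv g) s) = (\<integral>s. indicator {0..t} s * n1 s \<partial>lborel)"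
      unfolding set_lebesgue_integral_def by (rule Bochner_Integration.integral_cong) (auto simp: n1_def n_def indicator_def max_def)
    moreover have "m t - m 0 = (\<integral>s. indicator {0..t} s * n1 s \<partial>lborel)"
    proof (cases "t = 0")
      case True
      have "(\<integral>s. indicator {0..0::real} s * n1 s \<partial>lborel) = 0"
      proof (rule integral_eq_zero_AE)
        show "AE s in lborel. indicator {0..0::real} s * n1 s = 0"
          using AE_lborel_singleton[of 0] by eventually_elim (auto simp: indicator_def)
      qed
      then show ?thesis using True by simp
    qed (use main that in auto)
    ultimately show ?thesis by simp
  qed
  then show ?thesis using meas unfolding balance_def m_def by simp
qed

end

context measure_transport
begin

lemma beta_bound: obtains Bb where "Bb \<ge> 0" "\<And>x. \<bar>\<beta> x\<bar> \<le> Bb"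
  using bounded_compact_support[OF beta_continuous beta_0] by blast

lemma psi_meas[measurable]: "\<psi> \<in> borel_measurable borel"
  by (rule borel_measurable_continuous_onI[OF smooth1_continuous[OF psi(1)]])

lemma beta_meas[measurable]: "\<beta> \<in> borel_measurable borel"
  by (rule borel_measurable_continuous_onI[OF beta_continuous])

lemma psi_abs: "\<bar>\<psi> x\<bar> \<le> 1"
  using psi(4,5)[of x] by linarith

text \<open>A step is the limit of plateaus \<open>\<theta> j\<close> whose second edge, at
  \<open>z + j\<close>, moves to infinity. Each plateau has compact support, and at every fixed
  \<open>x\<close> it eventually equals the step.\<close>

lemma balance_step:
  assumes K: "K > 0"
  shows "balance c (\<lambda>x. \<psi> ((x - z) * K)) (\<lambda>x. K * \<beta> ((x - z) * K))"
proof -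
  obtain Bb where Bb: "Bb \<ge> 0" "\<And>x. \<bar>\<beta> x\<bar> \<le> Bb" by (rule beta_bound) blast
  define \<theta> where "\<theta> j x = \<psi> (K * x + (- z * K)) - \<psi> (K * x + (- (z + real j) * K))" for j :: nat and x
  have sm: "smooth1 (\<theta> j)" for j unfolding \<theta>_def by (intro smooth1_diff smooth1_affine psi)
  have d: "deriv (\<theta> j) = (\<lambda>x. \<beta> (K * x + (- z * K)) * K - \<beta> (K * x + (- (z + real j) * K)) * K)" for j
    unfolding \<theta>_def by (intro ext DERIV_imp_deriv DERIV_diff DERIV_chain2[OF psi_deriv]) (auto intro!: derivative_eq_intros)
  have bal: "balance c (\<theta> j) (deriv (\<theta> j))" for j
  proof (rule balance_smooth[OF sm])
    fix x assume x: "\<bar>z\<bar> + real j + 1 / K < \<bar>x\<bar>"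
    show "\<theta> j x = 0"
    proof (cases "x > 0")
      case True
      then have "1 / K < x - z - real j" "1 / K < x - z" using x by linarith+
      then have "1 < (x - z - real j) * K" "1 < (x - z) * K" using K by (simp_all add: pos_divide_less_eq)
      then show ?thesis unfolding \<theta>_def by (simp add: psi(3) algebra_simps)
    next
      case False
      then have "x - z - real j < - (1 / K)" "x - z < - (1 / K)" using x by linarith+
      then have "1 / K < - (x - z - real j)" "1 / K < - (x - z)" by linarith+
      then have "1 < - (x - z - real j) * K" "1 < - (x - z) * K" using K by (simp_all add: pos_divide_less_eq)
      then show ?thesis unfolding \<theta>_def by (simp add: psi(2) algebra_simps)
    qed
  qed
  have far: "\<forall>\<^sub>F j in sequentially. K * x + (- (z + real j) * K) < - 1" for x
  proof -
    obtain N :: nat where N: "real N > x - z + 1 / K" using reals_Archimedean2 by blast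
    have "K * x + (- (z + real j) * K) < - 1" if "j \<ge> N" for j
    proof -
      have "1 / K < - (x - z - real j)" using N that by linarith
      then have "1 < - (x - z - real j) * K" using K by (simp add: pos_divide_less_eq)
      then show ?thesis by (simp add: algebra_simps)
    qed
    then show ?thesis unfolding eventually_sequentially by blast
  qed
  show ?thesis
  proof (rule balance_limit[where A=2 and B="2 * (K * Bb)", OF bal])
    show "\<theta> j \<in> borel_measurable borel" for j unfolding \<theta>_def by measurable
    show "deriv (\<theta> j) \<in> borel_measurable borel" for j unfolding d by measurable
    show "(\<lambda>j. \<theta> j x) \<longlonglongrightarrow> \<psi> ((x - z) * K)" for x
    proof (rule tendsto_eventually)
      show "\<forall>\<^sub>F j in sequentially. \<theta> j x = \<psi> ((x - z) * K)"
        using far[of x]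
      proof eventually_elim
        case (elim j)
        then have "\<psi> (K * x + (- (z + real j) * K)) = 0" by (intro psi(2)) simp
        then show ?case unfolding \<theta>_def by (simp add: algebra_simps)
      qed
    qed
    show "(\<lambda>j. deriv (\<theta> j) x) \<longlonglongrightarrow> K * \<beta> ((x - z) * K)" for x
    proof (rule tendsto_eventually)
      show "\<forall>\<^sub>F j in sequentially. deriv (\<theta> j) x = K * \<beta> ((x - z) * K)"
        using far[of x]
      proof eventually_elim
        case (elim j)
        then have "\<beta> (K * x + (- (z + real j) * K)) = 0" by (intro beta_0) simp
        then show ?case unfolding d by (simp add: algebra_simps)
      qed
    qed
    show "\<bar>\<theta> j x\<bar> \<le> 2" for j x
      unfolding \<theta>_def using psi_abs[of "K * x + (- z * K)"] psi_abs[of "K * x + (- (z + real j) * K)"] by linarith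
    show "\<bar>deriv (\<theta> j) x\<bar> \<le> 2 * (K * Bb)" for j x
    proof -
      have "\<bar>\<beta> y * K\<bar> \<le> K * Bb" for y using Bb(2)[of y] K by (simp add: abs_mult mult.commute)
      from this[of "K * x + (- z * K)"] this[of "K * x + (- (z + real j) * K)"] show ?thesis unfolding d by linarith
    qed
  qed
qed

text \<open>The constant \<open>1\<close> is the limit of steps moved to the left, whose derivatives
  tend to \<open>0\<close> under a common bound. The flux vanishes in the limit, so no mass is lost
  at infinity.\<close>

lemma mass_const: "t \<ge> 0 \<Longrightarrow> measure (\<mu> t) UNIV = measure (\<mu> 0) UNIV"
proof -
  assume t: "t \<ge> 0"
  obtain Bb where Bb: "Bb \<ge> 0" "\<And>x. \<bar>\<beta> x\<bar> \<le> Bb" by (rule beta_bound) blast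
  have far: "\<forall>\<^sub>F j in sequentially. 1 < x + real j" for x
  proof -
    obtain N :: nat where N: "real N > 1 - x" using reals_Archimedean2 by blast
    then show ?thesis unfolding eventually_sequentially by (intro exI[of _ N]) auto
  qed
  have "balance 0 (\<lambda>_. 1) (\<lambda>_. 0)"
  proof (rule balance_limit[where A=1 and B=Bb])
    show "balance 0 (\<lambda>x. \<psi> (x + real j)) (\<lambda>x. \<beta> (x + real j))" for j
      using balance_step[of 1 0 "- real j"] by simp
    show "(\<lambda>j. \<psi> (x + real j)) \<longlonglongrightarrow> 1" for x
      by (rule tendsto_eventually, rule eventually_mono[OF far[of x]]) (simp add: psi(3))
    show "(\<lambda>j. \<beta> (x + real j)) \<longlonglongrightarrow> 0" for x
      by (rule tendsto_eventually, rule eventually_mono[OF far[of x]]) (simp add: beta_0)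
  qed (use Bb psi_abs in \<open>auto\<close>)
  then have "(\<integral>x. 1 \<partial>\<mu> t) - (\<integral>x. 1 \<partial>\<mu> 0) = (LINT s:{0..t}|lborel. flux 0 (\<lambda>_. 0) s)"
    using t unfolding balance_def by blast
  then show ?thesis using t by (simp add: space_mu flux_def)
qed

text \<open>The law is linear in the pair, so it survives integration over shifts against an
  integrable weight \<open>f\<close>. The content is Fubini: in space for both sides, in time for
  the flux.\<close>

lemma balance_superpose:
  assumes bal: "\<And>z. balance c (\<lambda>x. S (x - z)) (\<lambda>x. s (x - z))"
    and S: "continuous_on UNIV S" "\<And>x. \<bar>S x\<bar> \<le> BS" and s: "uniformly_continuous_on UNIV s" "\<And>x. \<bar>s x\<bar> \<le> Bs"
    and f: "integrable lborel f"
  shows "balance c (\<lambda>x. \<integral>z. S (x - z) * f z \<partial>lborel) (\<lambda>x. \<integral>z. s (x - z) * f z \<partial>lborel)"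
proof -
  have sc: "continuous_on UNIV s" by (rule uniformly_continuous_imp_continuous[OF s(1)])
  note [measurable] = S(1)[THEN borel_measurable_continuous_onI] sc[THEN borel_measurable_continuous_onI]
  have [measurable]: "f \<in> borel_measurable borel" using f by auto
  have Bs0: "Bs \<ge> 0" using s(2)[of 0] by linarith
  let ?g = "\<lambda>x. \<integral>z. s (x - z) * f z \<partial>lborel"
  have fl: "flux c ?g t = (\<integral>z. f z * flux c (\<lambda>x. s (x - z)) t \<partial>lborel)" if t: "t \<ge> 0" for t
  proof -
    interpret M: finite_measure "\<mu> t" by (rule finite_mu[OF t])
    obtain M where M: "M \<ge> 0" "\<And>r x. r \<in> {0..t} \<Longrightarrow> \<bar>u r x\<bar> \<le> M" using u_bound[of t] by blast
    note [measurable] = u_meas[OF t]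
    have ub: "\<bar>u t x - c\<bar> \<le> M + \<bar>c\<bar>" for x using M(2)[of t x] t by auto
    have "(\<integral>x. 1 * (\<integral>z. ((u t x - c) * s (x - c * t - z)) * f z \<partial>lborel) \<partial>\<mu> t) =
        (\<integral>z. f z * (\<integral>x. 1 * ((u t x - c) * s (x - c * t - z)) \<partial>\<mu> t) \<partial>lborel)"
    proof (rule fubini_bounded[OF sets_mu[OF t] _ f])
      show "\<bar>(u t x - c) * s (x - c * t - z)\<bar> \<le> (M + \<bar>c\<bar>) * Bs" for z x
        unfolding abs_mult by (rule mult_mono[OF ub s(2) order_trans[OF abs_ge_zero ub[of x]] abs_ge_zero])
      show "(\<lambda>p. (u t (snd p) - c) * s (snd p - c * t - fst p)) \<in> borel_measurable borel"
        unfolding borel_prod[symmetric] by measurable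
    qed (auto intro: M.sigma_finite_measure_axioms)
    moreover have "(\<integral>z. ((u t x - c) * s (x - c * t - z)) * f z \<partial>lborel) = (u t x - c) * ?g (x - c * t)" for x
      by (subst integral_mult_right_zero[symmetric]) (simp add: mult_ac)
    ultimately show ?thesis unfolding flux_def by simp
  qed
  have cf: "continuous_on (UNIV \<times> {0..}) (\<lambda>(z, r). flux c (\<lambda>x. s (x - z)) r)"
    by (rule flux_continuous[OF s])
  \<comment> \<open>For a general closed set of times because two are used: \<open>{0..}\<close> for
    the measurability clause of \<open>balance\<close>, \<open>{0..t}\<close> for the exchange with
    the time integral.\<close>
  have hm: "(\<lambda>p. indicator A (snd p) * flux c (\<lambda>x. s (x - fst p)) (snd p)) \<in> borel_measurable borel"
    if A: "A \<subseteq> {0..}" "closed A" for A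
  proof -
    have "continuous_on (UNIV \<times> A) (\<lambda>(z, r). flux c (\<lambda>x. s (x - z)) r)"
      by (rule continuous_on_subset[OF cf]) (use A in auto)
    moreover have "UNIV \<times> A \<in> sets (borel :: (real \<times> real) measure)"
      using A by (intro borel_closed closed_Times) auto
    ultimately have "(\<lambda>p. indicator (UNIV \<times> A) p *\<^sub>R (\<lambda>(z, r). flux c (\<lambda>x. s (x - z)) r) p) \<in> borel_measurable borel"
      by (intro borel_measurable_continuous_on_indicator)
    moreover have "(\<lambda>p. indicator (UNIV \<times> A) p *\<^sub>R (\<lambda>(z, r). flux c (\<lambda>x. s (x - z)) r) p)
       = (\<lambda>p. indicator A (snd p) * flux c (\<lambda>x. s (x - fst p)) (snd p))"
      by (auto simp: fun_eq_iff indicator_def)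
    ultimately show ?thesis by (simp only:)
  qed
  have meas: "(\<lambda>r. indicator {0..} r * flux c ?g r) \<in> borel_measurable borel"
  proof -
    have h0: "(\<lambda>p::real \<times> real. indicator {0..} (snd p) * flux c (\<lambda>x. s (x - fst p)) (snd p)) \<in> borel_measurable (borel \<Otimes>\<^sub>M borel)"
      using hm[of "{0..}"] by (simp add: borel_prod)
    have "(\<lambda>q::real \<times> real. (snd q, fst q)) \<in> borel \<Otimes>\<^sub>M lborel \<rightarrow>\<^sub>M borel \<Otimes>\<^sub>M borel" by measurable
    from measurable_compose[OF this h0]
    have "(\<lambda>q::real \<times> real. indicator {0..} (fst q) * flux c (\<lambda>x. s (x - snd q)) (fst q)) \<in> borel_measurable (borel \<Otimes>\<^sub>M lborel)"
      by simp
    note h1 = this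
    have f1: "(\<lambda>q::real \<times> real. f (snd q)) \<in> borel_measurable (borel \<Otimes>\<^sub>M lborel)" by measurable
    have "(\<lambda>(r, z). f z * (indicator {0..} r * flux c (\<lambda>x. s (x - z)) r)) \<in> borel_measurable (borel \<Otimes>\<^sub>M lborel)"
      unfolding split_beta by (rule borel_measurable_times[OF f1 h1])
    then have "(\<lambda>r. \<integral>z. f z * (indicator {0..} r * flux c (\<lambda>x. s (x - z)) r) \<partial>lborel) \<in> borel_measurable borel"
      by (rule lborel.borel_measurable_lebesgue_integral)
    moreover have "(\<integral>z. f z * (indicator {0..} r * flux c (\<lambda>x. s (x - z)) r) \<partial>lborel) = indicator {0..} r * flux c ?g r" for r
      using fl[of r] by (cases "r \<ge> 0") auto
    ultimately show ?thesis by (simp only:)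
  qed
  have "(\<integral>x. (\<integral>z. S (x - c * t - z) * f z \<partial>lborel) \<partial>\<mu> t) - (\<integral>x. (\<integral>z. S (x - z) * f z \<partial>lborel) \<partial>\<mu> 0) =
      (LINT r:{0..t}|lborel. flux c ?g r)" if t: "t \<ge> 0" for t
  proof -
    have th: "(\<integral>x. (\<integral>z. S (x - y - z) * f z \<partial>lborel) \<partial>\<mu> t) = (\<integral>z. f z * (\<integral>x. S (x - y - z) \<partial>\<mu> t) \<partial>lborel)"
      and thi: "integrable lborel (\<lambda>z. f z * (\<integral>x. S (x - y - z) \<partial>\<mu> t))" if t: "t \<ge> 0" for t y
    proof -
      interpret M: finite_measure "\<mu> t" by (rule finite_mu[OF t])
      have "(\<integral>x. 1 * (\<integral>z. S (x - y - z) * f z \<partial>lborel) \<partial>\<mu> t) = (\<integral>z. f z * (\<integral>x. 1 * S (x - y - z) \<partial>\<mu> t) \<partial>lborel)"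
      proof (rule fubini_bounded[OF sets_mu[OF t] _ f])
        show "(\<lambda>p. S (snd p - y - fst p)) \<in> borel_measurable borel"
          unfolding borel_prod[symmetric] by measurable
      qed (use S(2) in \<open>auto intro: M.sigma_finite_measure_axioms\<close>)
      then show "(\<integral>x. (\<integral>z. S (x - y - z) * f z \<partial>lborel) \<partial>\<mu> t) = (\<integral>z. f z * (\<integral>x. S (x - y - z) \<partial>\<mu> t) \<partial>lborel)"
        by simp
      have s': "sets (borel \<Otimes>\<^sub>M \<mu> t) = sets (borel \<Otimes>\<^sub>M borel)"
        by (intro sets_pair_measure_cong sets_mu[OF t] refl)
      have "(\<lambda>(z, x). S (x - y - z)) \<in> borel_measurable (borel \<Otimes>\<^sub>M borel)"
        by measurable
      then have "(\<lambda>(z, x). S (x - y - z)) \<in> borel_measurable (borel \<Otimes>\<^sub>M \<mu> t)"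
        using measurable_cong_sets[OF s' refl] by blast
      then have [measurable]: "(\<lambda>z. \<integral>x. S (x - y - z) \<partial>\<mu> t) \<in> borel_measurable borel"
        by (rule M.borel_measurable_lebesgue_integral)
      show "integrable lborel (\<lambda>z. f z * (\<integral>x. S (x - y - z) \<partial>\<mu> t))"
      proof (rule Bochner_Integration.integrable_bound)
        show "integrable lborel (\<lambda>z. \<bar>f z\<bar> * (BS * measure (\<mu> t) UNIV))"
          using f by (intro integrable_mult_left integrable_abs)
        show "AE z in lborel. norm (f z * (\<integral>x. S (x - y - z) \<partial>\<mu> t)) \<le> norm (\<bar>f z\<bar> * (BS * measure (\<mu> t) UNIV))"
        proof (rule AE_I2)
          fix z
          have "\<bar>\<integral>x. S (x - y - z) \<partial>\<mu> t\<bar> \<le> BS * measure (\<mu> t) UNIV"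
            by (rule integral_mu_bound[OF t _ S(2)]) measurable
          then show "norm (f z * (\<integral>x. S (x - y - z) \<partial>\<mu> t)) \<le> norm (\<bar>f z\<bar> * (BS * measure (\<mu> t) UNIV))"
            unfolding real_norm_def abs_mult[of "f z"] abs_mult[of "\<bar>f z\<bar>"] abs_idempotent
            by (intro mult_left_mono) (auto intro: order_trans[OF _ abs_ge_self])
        qed
      qed measurable
    qed
    obtain K where K: "K \<ge> 0" "\<And>h r. h \<in> borel_measurable borel \<Longrightarrow> (\<And>x. \<bar>h x\<bar> \<le> Bs) \<Longrightarrow> r \<in> {0..t} \<Longrightarrow> \<bar>flux c h r\<bar> \<le> K"
      using flux_bounded[OF Bs0] by blast
    have fb: "\<bar>indicator {0..t} r * flux c (\<lambda>x. s (x - z)) r\<bar> \<le> K" for r z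
      using K(1) K(2)[of "\<lambda>x. s (x - z)" r] s(2) by (cases "r \<in> {0..t}") auto
    \<comment> \<open>The indicator is doubled: one copy is the integrable factor in time, the other
      belongs to the kernel, which has to be bounded and measurable for all
      \<open>r\<close>.\<close>
    have "(LINT r:{0..t}|lborel. flux c ?g r) = (\<integral>r. indicator {0..t} r * (\<integral>z. (indicator {0..t} r * flux c (\<lambda>x. s (x - z)) r) * f z \<partial>lborel) \<partial>lborel)"
      unfolding set_lebesgue_integral_def
    proof (rule Bochner_Integration.integral_cong[OF refl])
      fix r
      show "indicator {0..t} r *\<^sub>R flux c ?g r = indicator {0..t} r * (\<integral>z. (indicator {0..t} r * flux c (\<lambda>x. s (x - z)) r) * f z \<partial>lborel)"
      proof (cases "r \<in> {0..t}")
        case True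
        have "(\<integral>z. flux c (\<lambda>x. s (x - z)) r * f z \<partial>lborel) = (\<integral>z. f z * flux c (\<lambda>x. s (x - z)) r \<partial>lborel)"
          by (rule Bochner_Integration.integral_cong[OF refl]) (rule mult.commute)
        then show ?thesis using True fl[of r] by simp
      qed simp
    qed
    also have "\<dots> = (\<integral>z. f z * (\<integral>r. indicator {0..t} r * (indicator {0..t} r * flux c (\<lambda>x. s (x - z)) r) \<partial>lborel) \<partial>lborel)"
    proof (rule fubini_bounded[OF sets_lborel lborel.sigma_finite_measure_axioms f _ hm fb])
      show "integrable lborel (indicator {0..t} :: real \<Rightarrow> real)"
        by (intro integrable_real_indicator) (auto simp: emeasure_lborel_Icc_eq)
    qed auto
    also have "\<dots> = (\<integral>z. f z * (LINT r:{0..t}|lborel. flux c (\<lambda>x. s (x - z)) r) \<partial>lborel)"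
      unfolding set_lebesgue_integral_def
      by (intro Bochner_Integration.integral_cong refl arg_cong2[where f="(*)"]) (auto simp: indicator_def)
    also have "\<dots> = (\<integral>z. f z * (\<integral>x. S (x - c * t - z) \<partial>\<mu> t) - f z * (\<integral>x. S (x - 0 - z) \<partial>\<mu> 0) \<partial>lborel)"
    proof (rule Bochner_Integration.integral_cong[OF refl])
      fix z
      have "(LINT r:{0..t}|lborel. flux c (\<lambda>x. s (x - z)) r) = (\<integral>x. S (x - c * t - z) \<partial>\<mu> t) - (\<integral>x. S (x - z) \<partial>\<mu> 0)"
        using bal[of z] t unfolding balance_def by auto
      then show "f z * (LINT r:{0..t}|lborel. flux c (\<lambda>x. s (x - z)) r) = f z * (\<integral>x. S (x - c * t - z) \<partial>\<mu> t) - f z * (\<integral>x. S (x - 0 - z) \<partial>\<mu> 0)"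
        by (simp add: right_diff_distrib)
    qed
    also have "\<dots> = (\<integral>z. f z * (\<integral>x. S (x - c * t - z) \<partial>\<mu> t) \<partial>lborel) - (\<integral>z. f z * (\<integral>x. S (x - 0 - z) \<partial>\<mu> 0) \<partial>lborel)"
      by (rule Bochner_Integration.integral_diff[OF thi[OF t] thi[OF order_refl]])
    also have "\<dots> = (\<integral>x. (\<integral>z. S (x - c * t - z) * f z \<partial>lborel) \<partial>\<mu> t) - (\<integral>x. (\<integral>z. S (x - 0 - z) * f z \<partial>lborel) \<partial>\<mu> 0)"
      unfolding th[OF t] th[OF order_refl] ..
    finally show ?thesis by simp
  qed
  then show ?thesis unfolding balance_def using meas by blast
qed

text \<open>Superposing sharp steps at \<open>z\<close> with weight \<open>f z\<close> approximates
  the primitive of \<open>f\<close>, and the corresponding derivative is a mollification of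
  \<open>f\<close>. Continuity of \<open>f\<close> makes the mollifications converge at every point;
  convergence almost everywhere would not do, as \<open>\<mu>(s)\<close> may charge Lebesgue null
  sets.\<close>

lemma balance_primitive:
  assumes f: "continuous_on UNIV f" "integrable lborel f" "\<And>x. \<bar>f x\<bar> \<le> B"
  shows "balance c (\<lambda>x. LINT z:{..x}|lborel. f z) f"
proof -
  obtain Bb where Bb: "Bb \<ge> 0" "\<And>x. \<bar>\<beta> x\<bar> \<le> Bb" by (rule beta_bound) blast
  have fm[measurable]: "f \<in> borel_measurable borel" by (rule borel_measurable_continuous_onI[OF f(1)])
  show ?thesis
  proof (rule balance_limit)
    show "balance c (\<lambda>x. \<integral>z. \<psi> ((x - z) * real (Suc k)) * f z \<partial>lborel)
       (\<lambda>x. \<integral>z. (real (Suc k) * \<beta> ((x - z) * real (Suc k))) * f z \<partial>lborel)" for k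
    proof (rule balance_superpose[OF balance_step _ psi_abs _ _ f(2)])
      show "continuous_on UNIV (\<lambda>x. \<psi> (x * real (Suc k)))"
        by (intro continuous_on_compose2[OF smooth1_continuous[OF psi(1), of UNIV]] continuous_intros) auto
      show "uniformly_continuous_on UNIV (\<lambda>x. real (Suc k) * \<beta> (x * real (Suc k)))"
      proof (rule uniformly_continuous_on_compact_support[where R=1])
        show "continuous_on UNIV (\<lambda>x. real (Suc k) * \<beta> (x * real (Suc k)))"
          by (intro continuous_on_compose2[OF beta_continuous[of UNIV]] continuous_intros) auto
        fix x :: real assume "1 < \<bar>x\<bar>"
        then have "1 * 1 < \<bar>x\<bar> * real (Suc k)" by (intro mult_less_le_imp_less) auto
        then show "real (Suc k) * \<beta> (x * real (Suc k)) = 0" using beta_0[of "x * real (Suc k)"] by (simp add: abs_mult)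
      qed
      show "\<bar>real (Suc k) * \<beta> (x * real (Suc k))\<bar> \<le> real (Suc k) * Bb" for x
        unfolding abs_mult using Bb by (intro mult_mono) auto
    qed simp
    show "(\<lambda>x. \<integral>z. \<psi> ((x - z) * real (Suc k)) * f z \<partial>lborel) \<in> borel_measurable borel" for k
      by (rule lborel.borel_measurable_lebesgue_integral) measurable
    show "(\<lambda>x. \<integral>z. (real (Suc k) * \<beta> ((x - z) * real (Suc k))) * f z \<partial>lborel) \<in> borel_measurable borel" for k
      by (rule lborel.borel_measurable_lebesgue_integral) measurable
    show "(\<lambda>k. \<integral>z. (real (Suc k) * \<beta> ((x - z) * real (Suc k))) * f z \<partial>lborel) \<longlonglongrightarrow> f x" for x
      using mollifier_tendsto[OF beta_continuous beta_0 f(1), of x] by (simp add: beta_integral)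
    show "\<bar>\<integral>z. (real (Suc k) * \<beta> ((x - z) * real (Suc k))) * f z \<partial>lborel\<bar> \<le> (\<integral>w. \<bar>\<beta> w\<bar> \<partial>lborel) * B" for k x
      by (rule mollifier_bound[OF beta_continuous beta_0 f(1,3)])
    show "\<bar>\<integral>z. \<psi> ((x - z) * real (Suc k)) * f z \<partial>lborel\<bar> \<le> (\<integral>z. \<bar>f z\<bar> \<partial>lborel)" for k x
    proof -
      have le: "\<bar>\<psi> ((x - z) * real (Suc k)) * f z\<bar> \<le> \<bar>f z\<bar>" for z
        unfolding abs_mult using psi_abs[of "(x - z) * real (Suc k)"] by (intro mult_left_le_one_le) auto
      have "integrable lborel (\<lambda>z. \<psi> ((x - z) * real (Suc k)) * f z)"
        by (rule Bochner_Integration.integrable_bound[OF f(2)]) (use le in \<open>auto simp del: of_nat_Suc\<close>)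
      then have "norm (\<integral>z. \<psi> ((x - z) * real (Suc k)) * f z \<partial>lborel) \<le> (\<integral>z. \<bar>f z\<bar> \<partial>lborel)"
        by (rule Bochner_Integration.integral_norm_bound_integral[OF _ integrable_abs[OF f(2)]]) (use le in \<open>simp del: of_nat_Suc\<close>)
      then show ?thesis by simp
    qed
    show "(\<lambda>k. \<integral>z. \<psi> ((x - z) * real (Suc k)) * f z \<partial>lborel) \<longlonglongrightarrow> (LINT z:{..x}|lborel. f z)" for x
      unfolding set_lebesgue_integral_def real_scaleR_def
    proof (rule integral_dominated_convergence[where w="\<lambda>z. \<bar>f z\<bar>"])
      show "integrable lborel (\<lambda>z. \<bar>f z\<bar>)" by (rule integrable_abs[OF f(2)])
      show "AE z in lborel. (\<lambda>k. \<psi> ((x - z) * real (Suc k)) * f z) \<longlonglongrightarrow> indicator {..x} z * f z"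
        using AE_lborel_singleton[of x]
      proof eventually_elim
        case (elim z)
        then have ev: "\<forall>\<^sub>F k in sequentially. 1 \<le> \<bar>x - z\<bar> * real (Suc k)"
          by (intro eventually_le_mult_Suc) simp
        have "\<forall>\<^sub>F k in sequentially. \<psi> ((x - z) * real (Suc k)) * f z = indicator {..x} z * f z"
          using ev
        proof eventually_elim
          case (elim k)
          show ?case
          proof (cases "z < x")
            case True
            then have "1 \<le> (x - z) * real (Suc k)" using elim by simp
            then show ?thesis using True by (simp add: psi(3) del: of_nat_Suc)
          next
            case False
            then have "(x - z) * real (Suc k) \<le> - 1" using elim by (simp add: algebra_simps)
            then show ?thesis using False \<open>z \<noteq> x\<close> by (simp add: psi(2) del: of_nat_Suc)
          qed
        qed
        then show ?case by (rule tendsto_eventually)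
      qed
      show "AE z in lborel. norm (\<psi> ((x - z) * real (Suc k)) * f z) \<le> \<bar>f z\<bar>" for k
        unfolding real_norm_def abs_mult using psi_abs by (intro AE_I2 mult_left_le_one_le) auto
    qed measurable
  qed
qed

end

section \<open>The kernel and the transport of distribution functions\<close>

lemma integrable_inverse_1_plus_square: "integrable lborel (\<lambda>x::real. 1 / (1 + x\<^sup>2))"
proof -
  have pos: "1 + x\<^sup>2 > 0" for x :: real by (simp add: add_pos_nonneg)
  have "(\<integral>\<^sup>+x. ennreal (1 / (1 + x\<^sup>2)) * indicator {0..} x \<partial>lborel) = ennreal (pi / 2 - arctan 0)"
  proof (rule nn_integral_FTC_atLeast)
    show "(arctan has_real_derivative 1 / (1 + x\<^sup>2)) (at x)" for x
      using DERIV_arctan[of x] by (simp add: divide_inverse)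
    show "(arctan \<longlongrightarrow> pi / 2) at_top" by (rule tendsto_arctan_at_top)
  qed (use pos in \<open>auto simp: less_imp_le\<close>)
  then have fin: "(\<integral>\<^sup>+x. ennreal (norm (indicator {0..} x * (1 / (1 + x\<^sup>2)) :: real)) \<partial>lborel) < \<infinity>"
  proof -
    assume e: "(\<integral>\<^sup>+x. ennreal (1 / (1 + x\<^sup>2)) * indicator {0..} x \<partial>lborel) = ennreal (pi / 2 - arctan 0)"
    have "(\<integral>\<^sup>+x. ennreal (norm (indicator {0..} x * (1 / (1 + x\<^sup>2)) :: real)) \<partial>lborel) =
      (\<integral>\<^sup>+x. ennreal (1 / (1 + x\<^sup>2)) * indicator {0..} x \<partial>lborel)"
      using pos by (intro nn_integral_cong) (auto simp: indicator_def less_imp_le)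
    then show ?thesis unfolding e by simp
  qed
  have g: "integrable lborel (\<lambda>x::real. indicator {0..} x * (1 / (1 + x\<^sup>2)))"
    by (rule integrableI_bounded[OF _ fin]) measurable
  have g': "integrable lborel (\<lambda>x::real. indicator {0..} (- x) * (1 / (1 + (- x)\<^sup>2)))"
    using lborel_integrable_real_affine[OF g, of "- 1" 0] by simp
  show ?thesis
  proof (rule Bochner_Integration.integrable_bound[OF Bochner_Integration.integrable_add[OF g g']])
    show "AE x in lborel. norm (1 / (1 + x\<^sup>2) :: real) \<le>
      norm (indicator {0..} x * (1 / (1 + x\<^sup>2)) + indicator {0..} (- x) * (1 / (1 + (- x)\<^sup>2)) :: real)"
      using pos by (intro AE_I2) (auto simp: indicator_def less_imp_le)
  qed measurable
qed

lemma Kn_pos: "Kn n x > 0"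
proof -
  have "1 + x\<^sup>2 > 0" by (intro add_pos_nonneg) auto
  then show ?thesis unfolding Kn_def by simp
qed

lemma Kn_nonneg: "0 \<le> Kn n x"
  by (rule less_imp_le[OF Kn_pos])

lemma Kn_le_1: "Kn n x \<le> 1"
proof -
  have "1 \<le> (1 + x\<^sup>2) ^ n" by (intro one_le_power) auto
  then show ?thesis unfolding Kn_def by (simp add: divide_le_eq)
qed

lemma Kn_abs: "\<bar>Kn n x\<bar> \<le> 1"
  using Kn_pos[of n x] Kn_le_1[of n x] by simp

lemma Kn_minus: "Kn n (- x) = Kn n x"
  unfolding Kn_def by simp

lemma Kn_commute: "Kn n (x - y) = Kn n (y - x)"
  using Kn_minus[of n "x - y"] by simp

text \<open>\<open>K\<close> is the \<open>n\<close>-th power of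
  \<open>q = 1 / (1 + x\<^sup>2)\<close>. The bound \<open>\<bar>x\<bar> * q x \<le> 1 / 2\<close>
  makes \<open>q\<close> Lipschitz with constant \<open>1\<close>, and the \<open>n\<close>-th power
  has Lipschitz constant \<open>n\<close> on \<open>[0, 1]\<close>.\<close>

lemma Kn_uniform: "uniformly_continuous_on UNIV (Kn n)"
proof -
  define q :: "real \<Rightarrow> real" where "q x = 1 / (1 + x\<^sup>2)" for x
  have pos: "1 + x\<^sup>2 > 0" for x :: real by (simp add: add_pos_nonneg)
  have K: "Kn n x = q x ^ n" for x unfolding Kn_def q_def by (simp add: power_one_over)
  have q01: "0 \<le> q x" "q x \<le> 1" for x unfolding q_def using pos[of x] by (auto simp: divide_le_eq)
  have ql: "\<bar>q x - q y\<bar> \<le> \<bar>x - y\<bar>" for x y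
  proof -
    have half: "\<bar>x\<bar> * q x \<le> 1 / 2" for x
    proof -
      have "0 \<le> (\<bar>x\<bar> - 1)\<^sup>2" by simp
      then have "2 * \<bar>x\<bar> \<le> 1 + x\<^sup>2" by (simp add: power2_diff)
      then show ?thesis unfolding q_def using pos[of x] by (simp add: divide_le_eq)
    qed
    have "q x - q y = (y - x) * ((x + y) * (q x * q y))"
      unfolding q_def using pos[of x] pos[of y] by (simp add: field_simps power2_eq_square)
    then have "\<bar>q x - q y\<bar> = \<bar>x - y\<bar> * (\<bar>x + y\<bar> * (q x * q y))"
      using q01 by (simp add: abs_mult abs_minus_commute)
    moreover have "\<bar>x + y\<bar> * (q x * q y) \<le> 1"
    proof -
      have "\<bar>x + y\<bar> * (q x * q y) \<le> (\<bar>x\<bar> + \<bar>y\<bar>) * (q x * q y)"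
        using q01 by (intro mult_right_mono) auto
      also have "\<dots> = (\<bar>x\<bar> * q x) * q y + (\<bar>y\<bar> * q y) * q x" by (simp add: algebra_simps)
      also have "\<dots> \<le> (1 / 2) * 1 + (1 / 2) * 1"
        using half[of x] half[of y] q01[of x] q01[of y] by (intro add_mono mult_mono) auto
      finally show ?thesis by simp
    qed
    ultimately show ?thesis using mult_left_mono[of "\<bar>x + y\<bar> * (q x * q y)" 1 "\<bar>x - y\<bar>"] by simp
  qed
  have "\<bar>Kn n x - Kn n y\<bar> \<le> real n * \<bar>x - y\<bar>" for x y
  proof -
    have "\<bar>q x ^ n - q y ^ n\<bar> \<le> real n * \<bar>q x - q y\<bar>"
      using norm_power_diff[of "q x" "q y" n] q01[of x] q01[of y] by simp
    also have "\<dots> \<le> real n * \<bar>x - y\<bar>" using ql by (intro mult_left_mono) auto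
    finally show ?thesis unfolding K .
  qed
  then have "(real n)-lipschitz_on UNIV (Kn n)"
    by (intro lipschitz_onI) (auto simp: dist_real_def)
  then show ?thesis by (rule lipschitz_on_uniformly_continuous)
qed

lemma Kn_continuous: "continuous_on A (Kn n)"
  using uniformly_continuous_imp_continuous[OF Kn_uniform] continuous_on_subset by blast

lemma Kn_meas[measurable]: "Kn n \<in> borel_measurable borel"
  by (rule borel_measurable_continuous_onI[OF Kn_continuous])

lemma Kn_le_inverse_square:
  assumes "n \<ge> 1" shows "Kn n x \<le> 1 / (1 + x\<^sup>2)"
proof -
  have "1 + x\<^sup>2 \<le> (1 + x\<^sup>2) ^ n" using assms power_increasing[of 1 n "1 + x\<^sup>2"] by simp
  then show ?thesis unfolding Kn_def by (intro divide_left_mono mult_pos_pos) (auto simp: add_pos_nonneg)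
qed

lemma Kn_integrable:
  assumes "n \<ge> 1" shows "integrable lborel (Kn n)"
proof (rule Bochner_Integration.integrable_bound[OF integrable_inverse_1_plus_square])
  show "AE x in lborel. norm (Kn n x) \<le> norm (1 / (1 + x\<^sup>2) :: real)"
    using Kn_le_inverse_square[OF assms] Kn_pos[of n] by (intro AE_I2) (simp add: less_imp_le add_nonneg_nonneg)
qed measurable

lemma set_integral_atMost_shift:
  fixes f :: "real \<Rightarrow> real"
  shows "(LINT z:{..x + a}|lborel. f z) = (LINT z:{..x}|lborel. f (z + a))"
  unfolding set_lebesgue_integral_def
  by (subst lborel_integral_real_affine[where c=1 and t=a]) (auto intro!: Bochner_Integration.integral_cong simp: indicator_def add.commute)

lemma borel_measurable_primitive:
  fixes f :: "real \<Rightarrow> real"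
  assumes [measurable]: "f \<in> borel_measurable borel"
  shows "(\<lambda>x. LINT z:{..x}|lborel. f z) \<in> borel_measurable borel"
proof -
  have "(\<lambda>x. \<integral>z. (if z \<le> x then f z else 0) \<partial>lborel) \<in> borel_measurable borel"
    by (rule lborel.borel_measurable_lebesgue_integral) measurable
  moreover have "indicator {..x} z *\<^sub>R f z = (if z \<le> x then f z else 0)" for x z
    by (simp add: indicator_def)
  ultimately show ?thesis unfolding set_lebesgue_integral_def by simp
qed

text \<open>A parabola cut off at zero: continuity is all that \<open>balance_primitive\<close> asks
  of it. It is nonnegative, as the sign arguments for the flux require, so its primitive is a
  monotone step from \<open>0\<close> to \<open>\<kappa>\<close> across
  \<open>[a, b]\<close>.\<close>

lemma bump_integral:
  fixes a b :: real assumes ab: "a < b"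
  obtains f :: "real \<Rightarrow> real" and \<kappa> where "continuous_on UNIV f" "integrable lborel f" "\<And>x. f x \<ge> 0" "\<And>x. x \<notin> {a..b} \<Longrightarrow> f x = 0"
    "\<kappa> > 0" "\<And>x. \<bar>f x\<bar> \<le> (b - a) * (b - a)"
    "\<And>x. 0 \<le> (LINT z:{..x}|lborel. f z)" "\<And>x. (LINT z:{..x}|lborel. f z) \<le> \<kappa>"
    "\<And>x. x \<le> a \<Longrightarrow> (LINT z:{..x}|lborel. f z) = 0" "\<And>x. b \<le> x \<Longrightarrow> (LINT z:{..x}|lborel. f z) = \<kappa>"
proof -
  define f where "f y = max 0 ((y - a) * (b - y))" for y :: real
  define \<kappa> where "\<kappa> = (\<integral>x. f x \<partial>lborel)"
  have cont: "continuous_on UNIV f" unfolding f_def by (intro continuous_intros)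
  have [measurable]: "f \<in> borel_measurable borel" by (rule borel_measurable_continuous_onI[OF cont])
  have nn: "f x \<ge> 0" for x unfolding f_def by simp
  have out: "f x = 0" if "x \<notin> {a..b}" for x
  proof -
    from that ab have "(x - a) * (b - x) \<le> 0"
      using mult_nonpos_nonneg[of "x - a" "b - x"] mult_nonneg_nonpos[of "x - a" "b - x"] by (cases "x < a") auto
    then show ?thesis unfolding f_def by simp
  qed
  have int: "integrable lborel f"
  proof (rule integrable_compact_support[OF cont, where R="max \<bar>a\<bar> \<bar>b\<bar>"])
    show "f x = 0" if "max \<bar>a\<bar> \<bar>b\<bar> < \<bar>x\<bar>" for x using that by (intro out) auto
  qed
  have bound: "\<bar>f x\<bar> \<le> (b - a) * (b - a)" for x
  proof (cases "x \<in> {a..b}")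
    case True
    then have "(x - a) * (b - x) \<le> (b - a) * (b - a)" by (intro mult_mono) auto
    then show ?thesis unfolding f_def by simp
  qed (use ab out in simp)
  have pos: "\<kappa> > 0"
  proof -
    have "\<kappa> \<noteq> 0"
    proof
      assume "\<kappa> = 0"
      then have "AE x in lborel. f x = 0"
        unfolding \<kappa>_def using integral_nonneg_eq_0_iff_AE[OF int] nn by auto
      then have "AE x in lborel. x \<notin> {a<..<b}"
        by eventually_elim (auto simp: f_def mult_pos_pos)
      then have "{a<..<b} \<in> null_sets lborel" by (subst (asm) AE_iff_null_sets[symmetric]) auto
      then show False using ab by (simp add: null_sets_def)
    qed
    moreover have "\<kappa> \<ge> 0" unfolding \<kappa>_def using nn by (intro integral_nonneg_AE) auto
    ultimately show ?thesis by simp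
  qed
  have i2: "integrable lborel (\<lambda>z. indicator {..x} z * f z)" for x
    using integrable_real_mult_indicator[OF _ int, of "{..x}"] by (simp add: mult.commute)
  show thesis
  proof (rule that[of f \<kappa>, OF cont int nn out pos bound])
    fix x
    show "0 \<le> (LINT z:{..x}|lborel. f z)"
      unfolding set_lebesgue_integral_def using nn by (intro integral_nonneg_AE) auto
    show "(LINT z:{..x}|lborel. f z) \<le> \<kappa>"
      unfolding set_lebesgue_integral_def \<kappa>_def real_scaleR_def
      by (rule integral_mono[OF i2 int]) (use nn in \<open>auto simp: indicator_def\<close>)
    show "(LINT z:{..x}|lborel. f z) = 0" if "x \<le> a"
    proof -
      have "(LINT z:{..x}|lborel. f z) = (\<integral>z. (0::real) \<partial>(lborel :: real measure))"
        unfolding set_lebesgue_integral_def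
      proof (rule Bochner_Integration.integral_cong[OF refl])
        show "indicator {..x} z *\<^sub>R f z = 0" for z
          using that ab out[of z] by (cases "z = a") (auto simp: indicator_def f_def)
      qed
      then show ?thesis by simp
    qed
    show "(LINT z:{..x}|lborel. f z) = \<kappa>" if "b \<le> x"
      unfolding set_lebesgue_integral_def \<kappa>_def
      by (rule Bochner_Integration.integral_cong) (use that ab in \<open>auto simp: indicator_def intro!: out\<close>)
  qed
qed

lemma atMost_borel: "{..a::real} \<in> sets borel" and lessThan_borel: "{..<a::real} \<in> sets borel"
  by auto

text \<open>The open half-line is the increasing union of the half-lines
  \<open>{..x - \<delta> / (i + 1)}\<close>. This removes the width of the bump from the estimates
  below.\<close>

lemma measure_lessThan_limit:
  fixes x \<delta> K :: real
  assumes fin: "finite_measure M" and sM: "sets M = sets borel"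
    and le: "\<And>d. 0 < d \<Longrightarrow> d \<le> \<delta> \<Longrightarrow> measure M {..x - d} \<le> K" and d: "\<delta> > 0"
  shows "measure M {..<x} \<le> K"
proof -
  interpret M: finite_measure M by (rule fin)
  have U: "(\<Union>i. {..x - \<delta> / real (Suc i)}) = {..<x}"
  proof
    show "(\<Union>i. {..x - \<delta> / real (Suc i)}) \<subseteq> {..<x}" 
    proof clarsimp
      fix y i assume "y \<le> x - \<delta> / (1 + real i)"
      moreover have "0 < \<delta> / (1 + real i)" using d by simp
      ultimately show "y < x" by linarith
    qed
    show "{..<x} \<subseteq> (\<Union>i. {..x - \<delta> / real (Suc i)})"
    proof
      fix y assume "y \<in> {..<x}"
      then have "0 < (x - y) / \<delta>" using d by simp
      then obtain i where "1 / real (Suc i) < (x - y) / \<delta>" by (rule nat_approx_posE)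
      then have "\<delta> / real (Suc i) < x - y" using d by (simp add: field_simps)
      then show "y \<in> (\<Union>i. {..x - \<delta> / real (Suc i)})" by (auto intro!: exI[of _ i])
    qed
  qed
  have "(\<lambda>i. measure M {..x - \<delta> / real (Suc i)}) \<longlonglongrightarrow> measure M (\<Union>i. {..x - \<delta> / real (Suc i)})"
  proof (rule M.finite_Lim_measure_incseq)
    show "range (\<lambda>i. {..x - \<delta> / real (Suc i)}) \<subseteq> sets M" unfolding sM by (intro image_subsetI atMost_borel)
    have "\<delta> / real (Suc j) \<le> \<delta> / real (Suc i)" if "i \<le> j" for i j
      using that d by (intro divide_left_mono) auto
    then show "incseq (\<lambda>i. {..x - \<delta> / real (Suc i)})" unfolding incseq_def by simp
  qed
  then have "(\<lambda>i. measure M {..x - \<delta> / real (Suc i)}) \<longlonglongrightarrow> measure M {..<x}" unfolding U .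
  then show ?thesis
    by (rule LIMSEQ_le_const2) (intro exI[of _ 0] allI impI le, use d in \<open>auto simp: divide_le_eq\<close>)
qed

section \<open>Transport of half-lines between two times\<close>

context measure_transport
begin

text \<open>Anchors the frame at time \<open>t1\<close> instead of \<open>0\<close>: the balance law
  for the shifted \<open>f0\<close> is taken at \<open>t2\<close> and at \<open>t1\<close>, and the
  difference leaves the flux over \<open>{t1<..t2}\<close>.\<close>

lemma transport_diff:
  fixes c :: real and f :: "real \<Rightarrow> real"
  assumes f: "continuous_on UNIV f" "integrable lborel f" "\<And>x. \<bar>f x\<bar> \<le> B" and t: "0 \<le> t1" "t1 \<le> t2"
  defines "\<Theta> \<equiv> \<lambda>x. LINT z:{..x}|lborel. f z"
    and "I \<equiv> \<lambda>s. \<integral>x. (u s x - c) * f (x - c * (s - t1)) \<partial>\<mu> s"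
  shows "set_integrable lborel {t1<..t2} I"
    and "(\<integral>x. \<Theta> (x - c * (t2 - t1)) \<partial>\<mu> t2) - (\<integral>x. \<Theta> x \<partial>\<mu> t1) = (LINT s:{t1<..t2}|lborel. I s)"
proof -
  define f0 where "f0 x = f (x + c * t1)" for x
  have f0: "continuous_on UNIV f0" "\<bar>f0 x\<bar> \<le> B" "integrable lborel f0" for x
    unfolding f0_def using f lborel_integrable_real_affine[OF f(2), of 1 "c * t1"]
    by (auto intro!: continuous_on_compose2[OF f(1)] continuous_intros simp: add.commute)
  have fm: "f0 \<in> borel_measurable borel" by (rule borel_measurable_continuous_onI[OF f0(1)])
  have bal: "balance c (\<lambda>x. LINT z:{..x}|lborel. f0 z) f0" by (rule balance_primitive[OF f0(1,3,2)])
  have Th: "(LINT z:{..x}|lborel. f0 z) = \<Theta> (x + c * t1)" for x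
    unfolding \<Theta>_def f0_def by (rule set_integral_atMost_shift[symmetric])
  have FI: "flux c f0 s = I s" for s
    unfolding flux_def f0_def I_def by (simp add: algebra_simps)
  have "0 \<le> B" using f(3)[of 0] by linarith
  then obtain K where K: "\<And>h s. h \<in> borel_measurable borel \<Longrightarrow> (\<And>x. \<bar>h x\<bar> \<le> B) \<Longrightarrow> s \<in> {0..t2} \<Longrightarrow> \<bar>flux c h s\<bar> \<le> K"
    using flux_bounded by blast
  have Im: "(\<lambda>s. indicator {0..} s * I s) \<in> borel_measurable borel"
    using bal unfolding balance_def FI by blast
  have si: "set_integrable lborel {0..t2} I"
  proof -
    have "set_integrable lborel {0..t2} (\<lambda>s. indicator {0..} s * I s)"
      by (rule set_integrable_bounded_real[OF Im, where L=K]) (use K[OF fm f0(2), unfolded FI] in \<open>auto simp: emeasure_lborel_Icc_eq\<close>)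
    moreover have "(\<lambda>s. indicator {0..t2} s *\<^sub>R (indicator {0..} s * I s)) = (\<lambda>s. indicator {0..t2} s *\<^sub>R I s)"
      by (auto simp: fun_eq_iff indicator_def)
    ultimately show ?thesis unfolding set_integrable_def by simp
  qed
  show si2: "set_integrable lborel {t1<..t2} I" by (rule set_integrable_subset[OF si]) (use t in auto)
  have si1: "set_integrable lborel {0..t1} I" by (rule set_integrable_subset[OF si]) (use t in auto)
  have disj: "{0..t1} \<inter> {t1<..t2} = {}" by auto
  have "{0..t2} = {0..t1} \<union> {t1<..t2}" using t by auto
  then have "(LINT s:{0..t2}|lborel. I s) = (LINT s:{0..t1}|lborel. I s) + (LINT s:{t1<..t2}|lborel. I s)"
    using set_integral_Un[OF _ si1 si2] disj by simp
  moreover have "(\<integral>x. \<Theta> (x - c * r + c * t1) \<partial>\<mu> r) - (\<integral>x. \<Theta> (x + c * t1) \<partial>\<mu> 0) = (LINT s:{0..r}|lborel. I s)" if "r \<ge> 0" for r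
    using bal that unfolding balance_def FI Th by blast
  from this[of t1] this[of t2]
  have "(\<integral>x. \<Theta> x \<partial>\<mu> t1) - (\<integral>x. \<Theta> (x + c * t1) \<partial>\<mu> 0) = (LINT s:{0..t1}|lborel. I s)"
     "(\<integral>x. \<Theta> (x - c * (t2 - t1)) \<partial>\<mu> t2) - (\<integral>x. \<Theta> (x + c * t1) \<partial>\<mu> 0) = (LINT s:{0..t2}|lborel. I s)"
    using t by (auto simp: algebra_simps)
  ultimately show "(\<integral>x. \<Theta> (x - c * (t2 - t1)) \<partial>\<mu> t2) - (\<integral>x. \<Theta> x \<partial>\<mu> t1) = (LINT s:{t1<..t2}|lborel. I s)"
    by linarith
qed

lemma transport_ge:
  assumes f: "continuous_on UNIV f" "integrable lborel f" "\<And>x. \<bar>f x\<bar> \<le> B" and t: "0 \<le> t1" "t1 \<le> t2"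
    and k: "\<And>s. t1 < s \<Longrightarrow> s \<le> t2 \<Longrightarrow> k \<le> (\<integral>x. (u s x - c) * f (x - c * (s - t1)) \<partial>\<mu> s)"
  shows "k * (t2 - t1) \<le> (\<integral>x. (LINT z:{..x - c * (t2 - t1)}|lborel. f z) \<partial>\<mu> t2) - (\<integral>x. (LINT z:{..x}|lborel. f z) \<partial>\<mu> t1)"
proof -
  note d = transport_diff[OF f t, where c=c]
  have "(LINT s:{t1<..t2}|lborel. k) \<le> (LINT s:{t1<..t2}|lborel. (\<integral>x. (u s x - c) * f (x - c * (s - t1)) \<partial>\<mu> s))"
    by (rule set_integral_mono[OF _ d(1)]) (use k t in \<open>auto intro!: set_integrable_bounded_real[where L="\<bar>k\<bar>"]\<close>)
  moreover have "(LINT s:{t1<..t2}|lborel. k) = k * (t2 - t1)"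
    using t by (subst set_integral_const) auto
  ultimately show ?thesis unfolding d(2) by simp
qed

lemma transport_le:
  assumes f: "continuous_on UNIV f" "integrable lborel f" "\<And>x. \<bar>f x\<bar> \<le> B" and t: "0 \<le> t1" "t1 \<le> t2"
    and k: "\<And>s. t1 < s \<Longrightarrow> s \<le> t2 \<Longrightarrow> (\<integral>x. (u s x - c) * f (x - c * (s - t1)) \<partial>\<mu> s) \<le> k"
  shows "(\<integral>x. (LINT z:{..x - c * (t2 - t1)}|lborel. f z) \<partial>\<mu> t2) - (\<integral>x. (LINT z:{..x}|lborel. f z) \<partial>\<mu> t1) \<le> k * (t2 - t1)"
proof -
  note d = transport_diff[OF f t, where c=c]
  have "(LINT s:{t1<..t2}|lborel. (\<integral>x. (u s x - c) * f (x - c * (s - t1)) \<partial>\<mu> s)) \<le> (LINT s:{t1<..t2}|lborel. k)"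
    by (rule set_integral_mono[OF d(1)]) (use k t in \<open>auto intro!: set_integrable_bounded_real[where L="\<bar>k\<bar>"]\<close>)
  moreover have "(LINT s:{t1<..t2}|lborel. k) = k * (t2 - t1)"
    using t by (subst set_integral_const) auto
  ultimately show ?thesis unfolding d(2) by simp
qed

lemma measure_mu_compl:
  assumes t: "t \<ge> 0" and A: "A \<in> sets borel"
  shows "measure (\<mu> t) (- A) = measure (\<mu> 0) UNIV - measure (\<mu> t) A"
  using finite_measure.finite_measure_compl[OF finite_mu[OF t], of A] A t
  unfolding mass_const[OF t, symmetric] by (simp add: sets_mu[OF t] space_mu[OF t] Compl_eq_Diff_UNIV)

lemma integral_tail:
  assumes t: "t \<ge> 0" and A: "A \<in> sets borel"
  shows "(\<integral>y. \<kappa> * indicator (- A) y \<partial>\<mu> t) = \<kappa> * (measure (\<mu> 0) UNIV - measure (\<mu> t) A)"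
proof -
  have "- A \<in> sets (\<mu> t)" using A by (simp add: sets_mu[OF t])
  then have "(\<integral>y. \<kappa> * indicator (- A) y \<partial>\<mu> t) = \<kappa> * measure (\<mu> t) (- A)"
    by (simp add: space_mu[OF t])
  then show ?thesis unfolding measure_mu_compl[OF t A] .
qed

text \<open>The primitive of a bump on \<open>[x - d, x]\<close> lies between
  \<open>\<kappa>\<close> times the indicators of \<open>[x, \<infinity>)\<close> and
  \<open>(x - d, \<infinity>)\<close>. If \<open>u \<le> c\<close> on the moving window, the flux is
  nonpositive and the mass to the right, weighted in this way, does not increase; total mass is
  constant, so mass on the left does not decrease. The window is the support of the bump, and its
  width is the gap between the two half-lines.\<close>

lemma
  assumes t: "0 \<le> t1" "t1 \<le> t2" and d: "d > 0"
  shows tail_transport_le: "(\<And>s y. t1 < s \<Longrightarrow> s \<le> t2 \<Longrightarrow> x + c * (s - t1) - d \<le> y \<Longrightarrow> y \<le> x + c * (s - t1) \<Longrightarrow> u s y \<le> c)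
      \<Longrightarrow> measure (\<mu> t1) {..x - d} \<le> measure (\<mu> t2) {..<x + c * (t2 - t1)}"
    and tail_transport_ge: "(\<And>s y. t1 < s \<Longrightarrow> s \<le> t2 \<Longrightarrow> x + c * (s - t1) - d \<le> y \<Longrightarrow> y \<le> x + c * (s - t1) \<Longrightarrow> c \<le> u s y)
      \<Longrightarrow> measure (\<mu> t2) {..x - d + c * (t2 - t1)} \<le> measure (\<mu> t1) {..<x}"
proof -
  have t2: "0 \<le> t2" using t by simp
  have "x - d < x" using d by simp
  from bump_integral[OF this] obtain f \<kappa> where f: "continuous_on UNIV f" "integrable lborel f" "\<And>y. f y \<ge> 0" "\<And>y. y \<notin> {x - d..x} \<Longrightarrow> f y = 0"
    "\<kappa> > 0" "\<And>y. \<bar>f y\<bar> \<le> (x - (x - d)) * (x - (x - d))"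
    "\<And>y. 0 \<le> (LINT z:{..y}|lborel. f z)" "\<And>y. (LINT z:{..y}|lborel. f z) \<le> \<kappa>"
    "\<And>y. y \<le> x - d \<Longrightarrow> (LINT z:{..y}|lborel. f z) = 0" "\<And>y. x \<le> y \<Longrightarrow> (LINT z:{..y}|lborel. f z) = \<kappa>" by metis
  define \<Theta> where "\<Theta> y = (LINT z:{..y}|lborel. f z)" for y
  have Tm[measurable]: "\<Theta> \<in> borel_measurable borel"
    unfolding \<Theta>_def by (rule borel_measurable_primitive[OF borel_measurable_continuous_onI[OF f(1)]])
  have Tb: "\<bar>\<Theta> y\<bar> \<le> \<kappa>" for y unfolding \<Theta>_def using f(7,8)[of y] by simp
  have sandwich: "\<kappa> * (measure (\<mu> 0) UNIV - measure (\<mu> s) {..<x + z}) \<le> (\<integral>y. \<Theta> (y - z) \<partial>\<mu> s) \<and>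
      (\<integral>y. \<Theta> (y - z) \<partial>\<mu> s) \<le> \<kappa> * (measure (\<mu> 0) UNIV - measure (\<mu> s) {..x - d + z})" if s: "s \<ge> 0" for s z
  proof -
    have Tm2: "(\<lambda>y. \<Theta> (y - z)) \<in> borel_measurable borel" by measurable
    have "(\<integral>y. \<kappa> * indicator (- {..<x + z}) y \<partial>\<mu> s) \<le> (\<integral>y. \<Theta> (y - z) \<partial>\<mu> s)"
      by (intro integral_mono integrable_mu[OF s, where B=\<kappa>] Tm2 Tb)
         (use f(5,7,10) in \<open>auto simp: indicator_def \<Theta>_def\<close>)
    moreover have "(\<integral>y. \<Theta> (y - z) \<partial>\<mu> s) \<le> (\<integral>y. \<kappa> * indicator (- {..x - d + z}) y \<partial>\<mu> s)"
      by (intro integral_mono integrable_mu[OF s, where B=\<kappa>] Tm2 Tb)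
         (use f(5,8,9) in \<open>auto simp: indicator_def \<Theta>_def\<close>)
    ultimately show ?thesis using s by (simp only: integral_tail atMost_borel lessThan_borel)
  qed
  note sw = sandwich[OF t(1), of 0] sandwich[OF t2, of "c * (t2 - t1)"]
  let ?A = "\<integral>y. \<Theta> (y - c * (t2 - t1)) \<partial>\<mu> t2" and ?B = "\<integral>y. \<Theta> y \<partial>\<mu> t1"
  show "measure (\<mu> t1) {..x - d} \<le> measure (\<mu> t2) {..<x + c * (t2 - t1)}"
    if uc: "\<And>s y. t1 < s \<Longrightarrow> s \<le> t2 \<Longrightarrow> x + c * (s - t1) - d \<le> y \<Longrightarrow> y \<le> x + c * (s - t1) \<Longrightarrow> u s y \<le> c"
  proof -
    have "?A - ?B \<le> 0 * (t2 - t1)"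
      unfolding \<Theta>_def
    proof (rule transport_le[OF f(1,2,6) t])
      fix s assume s: "t1 < s" "s \<le> t2"
      have "(u s y - c) * f (y - c * (s - t1)) \<le> 0" for y
      proof (cases "y - c * (s - t1) \<in> {x - d..x}")
        case True
        then have "u s y \<le> c" by (intro uc[OF s]) auto
        then show ?thesis using f(3) by (intro mult_nonpos_nonneg) auto
      qed (simp add: f(4))
      then have "0 \<le> (\<integral>y. - ((u s y - c) * f (y - c * (s - t1))) \<partial>\<mu> s)"
        by (intro integral_nonneg_AE AE_I2) (simp only: neg_0_le_iff_le)
      then show "(\<integral>y. (u s y - c) * f (y - c * (s - t1)) \<partial>\<mu> s) \<le> 0" by simp
    qed
    then have "\<kappa> * (measure (\<mu> 0) UNIV - measure (\<mu> t2) {..<x + c * (t2 - t1)}) \<le> \<kappa> * (measure (\<mu> 0) UNIV - measure (\<mu> t1) {..x - d})"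
      using sw by simp
    then show ?thesis using f(5) by simp
  qed
  show "measure (\<mu> t2) {..x - d + c * (t2 - t1)} \<le> measure (\<mu> t1) {..<x}"
    if uc: "\<And>s y. t1 < s \<Longrightarrow> s \<le> t2 \<Longrightarrow> x + c * (s - t1) - d \<le> y \<Longrightarrow> y \<le> x + c * (s - t1) \<Longrightarrow> c \<le> u s y"
  proof -
    have "0 * (t2 - t1) \<le> ?A - ?B"
      unfolding \<Theta>_def
    proof (rule transport_ge[OF f(1,2,6) t], intro integral_nonneg_AE AE_I2)
      fix s y assume s: "t1 < s" "s \<le> t2"
      show "0 \<le> (u s y - c) * f (y - c * (s - t1))"
      proof (cases "y - c * (s - t1) \<in> {x - d..x}")
        case True
        then have "c \<le> u s y" by (intro uc[OF s]) auto
        then show ?thesis using f(3) by simp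
      qed (simp add: f(4))
    qed
    then have "\<kappa> * (measure (\<mu> 0) UNIV - measure (\<mu> t1) {..<x}) \<le> \<kappa> * (measure (\<mu> 0) UNIV - measure (\<mu> t2) {..x - d + c * (t2 - t1)})"
      using sw by simp
    then show ?thesis using f(5) by simp
  qed
qed

text \<open>The gap closes as the width of the bump tends to \<open>0\<close>. A bound for
  \<open>u\<close> on a strip to the left of the line, however thin, decides in which direction mass
  crosses it.\<close>

lemma distribution_transport_le:
  assumes t: "0 \<le> t1" "t1 \<le> t2" and d: "\<delta> > 0"
    and uc: "\<And>s y. t1 < s \<Longrightarrow> s \<le> t2 \<Longrightarrow> x + c * (s - t1) - \<delta> \<le> y \<Longrightarrow> y \<le> x + c * (s - t1) \<Longrightarrow> u s y \<le> c"
  shows "measure (\<mu> t1) {..<x} \<le> measure (\<mu> t2) {..<x + c * (t2 - t1)}"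
proof (rule measure_lessThan_limit[OF finite_mu[OF t(1)] sets_mu[OF t(1)] _ d])
  fix d assume "0 < d" "d \<le> \<delta>"
  then show "measure (\<mu> t1) {..x - d} \<le> measure (\<mu> t2) {..<x + c * (t2 - t1)}"
    by (intro tail_transport_le[OF t] uc) auto
qed

lemma distribution_transport_ge:
  assumes t: "0 \<le> t1" "t1 \<le> t2" and d: "\<delta> > 0"
    and uc: "\<And>s y. t1 < s \<Longrightarrow> s \<le> t2 \<Longrightarrow> x + c * (s - t1) - \<delta> \<le> y \<Longrightarrow> y \<le> x + c * (s - t1) \<Longrightarrow> c \<le> u s y"
  shows "measure (\<mu> t2) {..<x + c * (t2 - t1)} \<le> measure (\<mu> t1) {..<x}"
proof -
  have t2: "0 \<le> t2" using t by simp
  show ?thesis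
  proof (rule measure_lessThan_limit[OF finite_mu[OF t2] sets_mu[OF t2] _ d])
    fix d assume d: "0 < d" "d \<le> \<delta>"
    then have "measure (\<mu> t2) {..x - d + c * (t2 - t1)} \<le> measure (\<mu> t1) {..<x}"
      by (intro tail_transport_ge[OF t] uc) auto
    then show "measure (\<mu> t2) {..x + c * (t2 - t1) - d} \<le> measure (\<mu> t1) {..<x}" by (simp add: algebra_simps)
  qed
qed

end

section \<open>Transport of \<open>p\<close> and of \<open>G\<close>\<close>

context measure_transport
begin

text \<open>The factor in \<open>B = kap n * C\<close>.\<close>

definition kap :: "nat \<Rightarrow> real" where "kap n = (\<integral>x. Kn n x \<partial>lborel)"

lemma pHS_eq: "pHS n \<mu> t x = (\<integral>y. Kn n (y - x) \<partial>\<mu> t)"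
  unfolding pHS_def by (simp add: Kn_commute[of n x])

lemma Kn_shift_integrable: "t \<ge> 0 \<Longrightarrow> integrable (\<mu> t) (\<lambda>y. Kn n (y - x))"
  by (rule integrable_mu[where B=1]) (auto intro: Kn_abs)

lemma pHS_nonneg: "0 \<le> pHS n \<mu> t x"
  unfolding pHS_def using Kn_pos[of n] by (intro integral_nonneg_AE AE_I2) (auto intro: less_imp_le)

lemma pHS_pos:
  assumes t: "t \<ge> 0" and C: "measure (\<mu> 0) UNIV > 0"
  shows "0 < pHS n \<mu> t x"
proof -
  have "pHS n \<mu> t x \<noteq> 0"
  proof
    assume "pHS n \<mu> t x = 0"
    then have "AE y in \<mu> t. Kn n (y - x) = 0"
      unfolding pHS_eq using integral_nonneg_eq_0_iff_AE[OF Kn_shift_integrable[OF t, of n x]] Kn_pos[of n] by (auto intro: less_imp_le)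
    then have "AE y in \<mu> t. False" by eventually_elim (use Kn_pos[of n] in \<open>auto simp: less_le\<close>)
    then have "emeasure (\<mu> t) (space (\<mu> t)) = 0" by (simp add: eventually_False ae_filter_eq_bot_iff)
    then show False using C mass_const[OF t] space_mu[OF t] by (simp add: measure_def)
  qed
  then show ?thesis using pHS_nonneg[of n t x] by simp
qed

lemma pHS_continuous:
  assumes t: "t \<ge> 0" shows "continuous_on UNIV (pHS n \<mu> t)"
  unfolding continuous_on_def
proof
  fix x0 :: real
  have lim: "((\<lambda>x. t) \<longlongrightarrow> t) (at x0 within UNIV)" by simp
  have "((\<lambda>x. \<integral>y. Kn n (y - x) \<partial>\<mu> t) \<longlongrightarrow> (\<integral>y. Kn n (y - x0) \<partial>\<mu> t)) (at x0 within UNIV)"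
  proof (rule tendsto_integral_mu[OF lim _ t, where B=1])
    show "uniform_limit UNIV (\<lambda>x y. Kn n (y - x)) (\<lambda>y. Kn n (y - x0)) (at x0 within UNIV)"
      by (rule uniform_limit_shift[OF Kn_uniform]) (rule tendsto_ident_at)
    show "continuous_on UNIV (\<lambda>y. Kn n (y - x0))"
      by (intro continuous_on_compose2[OF Kn_continuous[of UNIV]] continuous_intros) auto
  qed (use t Kn_abs in auto)
  then show "(pHS n \<mu> t \<longlongrightarrow> pHS n \<mu> t x0) (at x0 within UNIV)" unfolding pHS_eq[abs_def] .
qed

lemma pHS_meas: "t \<ge> 0 \<Longrightarrow> pHS n \<mu> t \<in> borel_measurable borel"
  by (intro borel_measurable_continuous_onI pHS_continuous)

lemma Kn_reflect:
  assumes n: "n \<ge> 1"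
  shows "(LINT z:{..a}|lborel. Kn n z) = kap n - (LINT z:{..- a}|lborel. Kn n z)"
proof -
  have i: "integrable lborel (\<lambda>z. indicator {..b} z * Kn n z)" for b
    using integrable_real_mult_indicator[OF _ Kn_integrable[OF n], of "{..b}"] by (simp add: mult.commute)
  have "(\<integral>z. indicator {..- a} z * Kn n z \<partial>lborel) = (\<integral>z. indicator {..- a} (- z) * Kn n (- z) \<partial>lborel)"
    by (subst lborel_integral_real_affine[where c="- 1" and t=0]) simp_all
  also have "\<dots> = (\<integral>z. Kn n z - indicator {..a} z * Kn n z \<partial>lborel)"
  proof (rule integral_cong_AE)
    show "AE z in lborel. indicator {..- a} (- z) * Kn n (- z) = Kn n z - indicator {..a} z * Kn n z"
      using AE_lborel_singleton[of a] by eventually_elim (auto simp: Kn_minus indicator_def)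
  qed measurable
  also have "\<dots> = kap n - (\<integral>z. indicator {..a} z * Kn n z \<partial>lborel)"
    unfolding kap_def by (rule Bochner_Integration.integral_diff[OF Kn_integrable[OF n] i])
  finally show ?thesis unfolding set_lebesgue_integral_def by simp
qed

text \<open>By evenness of \<open>K\<close> the integral of \<open>K(y - z)\<close> over
  \<open>y \<le> x\<close> is \<open>kap n - \<Theta>(z - x)\<close>, with \<open>\<Theta>\<close>
  the primitive of \<open>K\<close>. Fubini then writes the primitive of \<open>p\<close> as an
  integral of \<open>\<Theta>\<close> against \<open>\<mu>(t)\<close>, to which the balance law
  applies.\<close>

lemma
  assumes t: "t \<ge> 0" and n: "n \<ge> 1"
  shows pHS_integrable: "integrable lborel (pHS n \<mu> t)"
    and pHS_primitive: "(LINT y:{..x}|lborel. pHS n \<mu> t y) =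
      kap n * measure (\<mu> 0) UNIV - (\<integral>y. (LINT z:{..y - x}|lborel. Kn n z) \<partial>\<mu> t)"
    and pHS_integral: "(\<integral>y. pHS n \<mu> t y \<partial>lborel) = kap n * measure (\<mu> 0) UNIV"
proof -
  interpret M: finite_measure "\<mu> t" by (rule finite_mu[OF t])
  interpret P: pair_sigma_finite "\<mu> t" lborel ..
  have s: "sets (\<mu> t \<Otimes>\<^sub>M lborel) = sets (borel \<Otimes>\<^sub>M borel)"
    by (intro sets_pair_measure_cong sets_mu[OF t]) simp
  have mK: "(\<lambda>(z, y). Kn n (y - z)) \<in> borel_measurable (\<mu> t \<Otimes>\<^sub>M lborel)"
    unfolding measurable_cong_sets[OF s refl] by measurable
  have Ks: "integrable lborel (\<lambda>y. Kn n (y - z))" "(\<integral>y. Kn n (y - z) \<partial>lborel) = kap n" for z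
    using lborel_integrable_real_affine[OF Kn_integrable[OF n], of 1 "- z"]
      lborel_integral_real_affine[of 1 "Kn n" "- z"] unfolding kap_def by simp_all
  have Ki: "integrable (\<mu> t \<Otimes>\<^sub>M lborel) (\<lambda>(z, y). Kn n (y - z))"
  proof (rule P.Fubini_integrable[OF mK])
    show "integrable (\<mu> t) (\<lambda>z. \<integral>y. norm (case (z, y) of (z, y) \<Rightarrow> Kn n (y - z)) \<partial>lborel)"
      using Kn_pos[of n] Ks(2) by (simp add: abs_of_pos)
    show "AE z in \<mu> t. integrable lborel (\<lambda>y. case (z, y) of (z, y) \<Rightarrow> Kn n (y - z))"
      using Ks(1) by simp
  qed
  have Kx: "integrable (\<mu> t \<Otimes>\<^sub>M lborel) (\<lambda>(z, y). indicator S y * Kn n (y - z))" if S: "S \<in> sets borel" for S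
  proof (rule Bochner_Integration.integrable_bound[OF Ki])
    have "(\<lambda>(z, y). indicator S y * Kn n (y - z)) \<in> borel_measurable (borel \<Otimes>\<^sub>M borel)"
      using S by measurable
    then show "(\<lambda>(z, y). indicator S y * Kn n (y - z)) \<in> borel_measurable (\<mu> t \<Otimes>\<^sub>M lborel)"
      unfolding measurable_cong_sets[OF s refl] .
    show "AE p in \<mu> t \<Otimes>\<^sub>M lborel. norm (case p of (z, y) \<Rightarrow> indicator S y * Kn n (y - z)) \<le> norm (case p of (z, y) \<Rightarrow> Kn n (y - z))"
      by (rule AE_I2) (auto simp: indicator_def)
  qed
  have sw: "(\<integral>y. indicator S y * pHS n \<mu> t y \<partial>lborel) = (\<integral>z. (\<integral>y. indicator S y * Kn n (y - z) \<partial>lborel) \<partial>\<mu> t)"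
    if S: "S \<in> sets borel" for S
    using P.Fubini_integral[OF Kx[OF S]] unfolding pHS_def by simp
  show "integrable lborel (pHS n \<mu> t)"
    using P.integrable_snd[OF Ki] unfolding pHS_def[abs_def] .
  show "(\<integral>y. pHS n \<mu> t y \<partial>lborel) = kap n * measure (\<mu> 0) UNIV"
    using sw[of UNIV] Ks(2) by (simp add: mass_const[OF t] space_mu[OF t] mult.commute)
  have in1: "(\<integral>y. indicator {..x} y * Kn n (y - z) \<partial>lborel) = kap n - (LINT y:{..z - x}|lborel. Kn n y)" for z
    using set_integral_atMost_shift[of "x - z" z "\<lambda>y. Kn n (y - z)"] Kn_reflect[OF n, of "x - z"]
    unfolding set_lebesgue_integral_def by simp
  define \<Theta> where "\<Theta> y = (LINT z:{..y}|lborel. Kn n z)" for y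
  have Tm: "\<Theta> \<in> borel_measurable borel" unfolding \<Theta>_def by (rule borel_measurable_primitive) measurable
  have Ti: "integrable (\<mu> t) (\<lambda>z. \<Theta> (z - x))"
  proof (rule integrable_mu[OF t])
    show "(\<lambda>z. \<Theta> (z - x)) \<in> borel_measurable borel" using Tm by measurable
    show "\<bar>\<Theta> (z - x)\<bar> \<le> kap n" for z
    proof -
      have "0 \<le> \<Theta> y" for y unfolding \<Theta>_def set_lebesgue_integral_def
        by (intro integral_nonneg_AE AE_I2) (simp add: Kn_nonneg)
      from this[of "z - x"] this[of "x - z"] show ?thesis
        using Kn_reflect[OF n, of "z - x"] unfolding \<Theta>_def by simp
    qed
  qed
  have "(LINT y:{..x}|lborel. pHS n \<mu> t y) = (\<integral>z. kap n - \<Theta> (z - x) \<partial>\<mu> t)"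
    using sw[of "{..x}"] unfolding in1 \<Theta>_def set_lebesgue_integral_def by simp
  also have "\<dots> = kap n * measure (\<mu> 0) UNIV - (\<integral>y. \<Theta> (y - x) \<partial>\<mu> t)"
    using Ti by (simp add: mass_const[OF t] space_mu[OF t] mult.commute)
  finally show "(LINT y:{..x}|lborel. pHS n \<mu> t y) =
      kap n * measure (\<mu> 0) UNIV - (\<integral>y. (LINT z:{..y - x}|lborel. Kn n z) \<partial>\<mu> t)"
    unfolding \<Theta>_def .
qed

text \<open>The primitive of \<open>K\<close> enters \<open>pHS_primitive\<close> with a minus sign:
  a flux of at most \<open>- k\<close> makes \<open>Q\<close> grow at rate at least \<open>k\<close>
  along the line, and a flux of at least \<open>- k\<close> at rate at most
  \<open>k\<close>.\<close>

lemma pHS_primitive_transport: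
  assumes t: "0 \<le> t1" "t1 \<le> t2" and n: "n \<ge> 1"
  defines "Q \<equiv> \<lambda>t x. LINT y:{..x}|lborel. pHS n \<mu> t y"
    and "H \<equiv> \<lambda>c s x. \<integral>y. (u s y - c) * Kn n (y - x) \<partial>\<mu> s"
  shows "(\<And>s. t1 < s \<Longrightarrow> s \<le> t2 \<Longrightarrow> H c s (x + c * (s - t1)) \<le> - k) \<Longrightarrow> Q t1 x + k * (t2 - t1) \<le> Q t2 (x + c * (t2 - t1))"
    and "(\<And>s. t1 < s \<Longrightarrow> s \<le> t2 \<Longrightarrow> - k \<le> H c s (x + c * (s - t1))) \<Longrightarrow> Q t2 (x + c * (t2 - t1)) \<le> Q t1 x + k * (t2 - t1)"
proof -
  define f where "f y = Kn n (y - x)" for y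
  have f: "continuous_on UNIV f" "integrable lborel f" "\<bar>f y\<bar> \<le> 1" for y
    unfolding f_def using lborel_integrable_real_affine[OF Kn_integrable[OF n], of 1 "- x"] Kn_abs
    by (auto intro!: continuous_on_compose2[OF Kn_continuous[of UNIV]] continuous_intros)
  have t2: "0 \<le> t2" using t by simp
  have Th: "(LINT z:{..y}|lborel. f z) = (LINT z:{..y - x}|lborel. Kn n z)" for y
    unfolding f_def using set_integral_atMost_shift[of "y - x" x "\<lambda>z. Kn n (z - x)"] by simp
  have Hf: "(\<integral>y. (u s y - c) * f (y - c * (s - t1)) \<partial>\<mu> s) = H c s (x + c * (s - t1))" for s
    unfolding H_def f_def by (simp add: algebra_simps)
  have Q1: "Q t1 x = kap n * measure (\<mu> 0) UNIV - (\<integral>y. (LINT z:{..y}|lborel. f z) \<partial>\<mu> t1)"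
    unfolding Th Q_def by (rule pHS_primitive[OF t(1) n])
  have Q2: "Q t2 (x + c * (t2 - t1)) = kap n * measure (\<mu> 0) UNIV - (\<integral>y. (LINT z:{..y - c * (t2 - t1)}|lborel. f z) \<partial>\<mu> t2)"
    unfolding Th Q_def by (subst pHS_primitive[OF t2 n]) (simp add: algebra_simps)
  show "Q t1 x + k * (t2 - t1) \<le> Q t2 (x + c * (t2 - t1))"
    if "\<And>s. t1 < s \<Longrightarrow> s \<le> t2 \<Longrightarrow> H c s (x + c * (s - t1)) \<le> - k"
    using transport_le[OF f t, of c "- k"] that unfolding Q1 Q2 Hf by simp
  show "Q t2 (x + c * (t2 - t1)) \<le> Q t1 x + k * (t2 - t1)"
    if "\<And>s. t1 < s \<Longrightarrow> s \<le> t2 \<Longrightarrow> - k \<le> H c s (x + c * (s - t1))"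
    using transport_ge[OF f t, of "- k" c] that unfolding Q1 Q2 Hf by simp
qed

lemma GHS_mono:
  assumes t: "t \<ge> 0" and n: "n \<ge> 1" and xy: "x \<le> y"
  shows "GHS n \<mu> t x \<le> GHS n \<mu> t y"
proof -
  interpret M: finite_measure "\<mu> t" by (rule finite_mu[OF t])
  have i: "integrable lborel (\<lambda>z. indicator {..b} z * pHS n \<mu> t z)" for b
    using integrable_real_mult_indicator[OF _ pHS_integrable[OF t n], of "{..b}"] by (simp add: mult.commute)
  have "(LINT y:{..x}|lborel. pHS n \<mu> t y) \<le> (LINT y:{..y}|lborel. pHS n \<mu> t y)"
    unfolding set_lebesgue_integral_def real_scaleR_def
    by (rule integral_mono[OF i i]) (use xy pHS_nonneg in \<open>auto simp: indicator_def\<close>)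
  moreover have "measure (\<mu> t) {..<x} \<le> measure (\<mu> t) {..<y}"
    by (rule M.finite_measure_mono) (use xy in \<open>auto simp: sets_mu[OF t]\<close>)
  ultimately show ?thesis unfolding GHS_def by linarith
qed

text \<open>In a frame of speed \<open>M\<close> or \<open>- M\<close> the relative velocity has one
  sign everywhere and \<open>K\<close> is positive, so both summands of \<open>G\<close> are
  monotone along the line. Any window width would do in the distribution estimates; \<open>1\<close>
  is taken.\<close>

lemma GHS_speed:
  assumes t: "0 \<le> t1" "t1 \<le> t2" and n: "n \<ge> 1" and M: "\<And>s y. t1 \<le> s \<Longrightarrow> s \<le> t2 \<Longrightarrow> \<bar>u s y\<bar> \<le> M"
  shows "GHS n \<mu> t1 x \<le> GHS n \<mu> t2 (x + M * (t2 - t1))"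
    and "GHS n \<mu> t2 (x - M * (t2 - t1)) \<le> GHS n \<mu> t1 x"
proof -
  have uM: "u s y \<le> M" "- M \<le> u s y" if "t1 < s" "s \<le> t2" for s y
    using M[of s y] that by (auto simp: abs_le_iff)
  have sign: "(\<integral>y. (u s y - M) * Kn n (y - z) \<partial>\<mu> s) \<le> - 0" "- 0 \<le> (\<integral>y. (u s y - (- M)) * Kn n (y - z) \<partial>\<mu> s)"
    if s: "t1 < s" "s \<le> t2" for s z
  proof -
    have "0 \<le> (\<integral>y. - ((u s y - M) * Kn n (y - z)) \<partial>\<mu> s)"
      using uM(1)[OF s] by (intro integral_nonneg_AE AE_I2) (auto intro!: mult_nonpos_nonneg Kn_nonneg)
    then show "(\<integral>y. (u s y - M) * Kn n (y - z) \<partial>\<mu> s) \<le> - 0" by simp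
    have "0 \<le> u s y + M" for y using uM(2)[OF s, of y] by simp
    then show "- 0 \<le> (\<integral>y. (u s y - (- M)) * Kn n (y - z) \<partial>\<mu> s)"
      by (simp, intro integral_nonneg_AE AE_I2) (auto intro!: mult_nonneg_nonneg Kn_nonneg)
  qed
  show "GHS n \<mu> t1 x \<le> GHS n \<mu> t2 (x + M * (t2 - t1))"
    using pHS_primitive_transport(1)[OF t n, where c=M and k=0 and x=x, OF sign(1)]
      distribution_transport_le[OF t zero_less_one, of x M] uM(1) unfolding GHS_def by fastforce
  show "GHS n \<mu> t2 (x - M * (t2 - t1)) \<le> GHS n \<mu> t1 x"
    using pHS_primitive_transport(2)[OF t n, where c="- M" and k=0 and x=x, OF sign(2)]
      distribution_transport_ge[OF t zero_less_one, of x "- M"] uM(2) unfolding GHS_def by fastforce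
qed

text \<open>The flux of \<open>p\<close> depends on all of \<open>\<mu>(s)\<close>, but it is
  jointly continuous in frame speed, time and position, so near \<open>(u0, t0, x0)\<close> it stays
  within \<epsilon> of \<open>- h0\<close>. The contribution of \<open>\<mu>\<close> is local: close
  to \<open>(t0, x0)\<close> the velocity lies between the two slopes. \<open>t0\<close> may lie on
  either side of \<open>t1\<close> and \<open>t2\<close>, which covers both time directions.\<close>

lemma GHS_local:
  fixes t0 x0 \<epsilon> :: real
  assumes t0: "t0 \<ge> 0" and n: "n \<ge> 1" and e: "\<epsilon> > 0"
  defines "u0 \<equiv> u t0 x0" and "h0 \<equiv> \<integral>y. (u t0 x0 - u t0 y) * Kn n (y - x0) \<partial>\<mu> t0"
  obtains \<rho> where "\<rho> > 0"
    "\<And>t1 t2 x. 0 \<le> t1 \<Longrightarrow> t1 \<le> t2 \<Longrightarrow> \<bar>t1 - t0\<bar> < \<rho> \<Longrightarrow> \<bar>t2 - t0\<bar> < \<rho> \<Longrightarrow> \<bar>x - x0\<bar> < \<rho> \<Longrightarrow>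
       GHS n \<mu> t1 x + (h0 - \<epsilon>) * (t2 - t1) \<le> GHS n \<mu> t2 (x + (u0 + \<epsilon>) * (t2 - t1)) \<and>
       GHS n \<mu> t2 (x + (u0 - \<epsilon>) * (t2 - t1)) \<le> GHS n \<mu> t1 x + (h0 + \<epsilon>) * (t2 - t1)"
proof -
  define H where "H c s x = (\<integral>y. (u s y - c) * Kn n (y - x) \<partial>\<mu> s)" for c s x
  have h0: "h0 = - H u0 t0 x0"
    unfolding h0_def H_def u0_def Bochner_Integration.integral_minus[symmetric]
    by (rule Bochner_Integration.integral_cong) (auto simp: algebra_simps)
  define S where "S = (UNIV :: real set) \<times> {0::real..} \<times> (UNIV :: real set)"
  let ?F = "at (u0, t0, x0) within S"
  have id: "((\<lambda>p. p) \<longlongrightarrow> (u0, t0, x0)) ?F" by (rule tendsto_ident_at)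
  have pos: "\<forall>\<^sub>F p in ?F. 0 \<le> fst (snd p)"
    unfolding eventually_at_topological S_def by auto
  have "((\<lambda>p. H (fst p) (fst (snd p)) (snd (snd p))) \<longlongrightarrow> H u0 t0 x0) ?F"
    unfolding H_def
    by (rule flux_tendsto[OF Kn_uniform Kn_abs _ pos t0])
       (use tendsto_fst[OF id] tendsto_fst[OF tendsto_snd[OF id]] tendsto_snd[OF tendsto_snd[OF id]] in auto)
  then have "\<forall>\<^sub>F p in ?F. dist (H (fst p) (fst (snd p)) (snd (snd p))) (H u0 t0 x0) < \<epsilon>"
    using e by (rule tendstoD)
  then obtain d1 where d1: "d1 > 0" "\<And>p. p \<in> S \<Longrightarrow> p \<noteq> (u0, t0, x0) \<Longrightarrow> dist p (u0, t0, x0) < d1 \<Longrightarrow>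
      dist (H (fst p) (fst (snd p)) (snd (snd p))) (H u0 t0 x0) < \<epsilon>"
    unfolding eventually_at by blast
  have Hnear: "\<bar>H c s x - H u0 t0 x0\<bar> \<le> \<epsilon>" if "s \<ge> 0" "\<bar>c - u0\<bar> < d1 / 3" "\<bar>s - t0\<bar> < d1 / 3" "\<bar>x - x0\<bar> < d1 / 3" for c s x
  proof (cases "(c, s, x) = (u0, t0, x0)")
    case False
    have "dist (c, s, x) (u0, t0, x0) \<le> dist c u0 + (dist s t0 + dist x x0)"
      unfolding dist_prod_def fst_conv snd_conv
      by (meson add_left_mono order_trans sqrt_sum_squares_le_sum zero_le_dist real_sqrt_ge_zero add_nonneg_nonneg zero_le_power2)
    also have "\<dots> < d1" using that by (simp add: dist_real_def)
    finally have "dist (H (fst (c, s, x)) (fst (snd (c, s, x))) (snd (snd (c, s, x)))) (H u0 t0 x0) < \<epsilon>"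
      using False that(1) by (intro d1(2)) (auto simp: S_def)
    then show ?thesis by (simp add: dist_real_def)
  qed (use e in auto)
  \<comment> \<open>Slopes far from \<open>u0\<close> would leave the region where the flux is
    controlled, hence the cap \<open>d1 / 4\<close>. Monotonicity of \<open>G\<close> in
    \<open>x\<close> afterwards replaces \<open>\<epsilon>'\<close> by the larger
    \<epsilon>.\<close>
  define \<epsilon>' where "\<epsilon>' = min \<epsilon> (d1 / 4)"
  have e': "\<epsilon>' > 0" "\<epsilon>' \<le> \<epsilon>" "\<epsilon>' < d1 / 3" unfolding \<epsilon>'_def using e d1(1) by auto
  obtain d2 where d2: "d2 > 0" "\<And>s y. s \<ge> 0 \<Longrightarrow> \<bar>s - t0\<bar> < d2 \<Longrightarrow> \<bar>y - x0\<bar> < d2 \<Longrightarrow> \<bar>u s y - u0\<bar> < \<epsilon>'"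
  proof -
    have uc: "uniformly_continuous_on ({0..t0 + 1} \<times> UNIV) (\<lambda>(t, x). u t x)" using u_unif[of "t0 + 1"] t0 by simp
    obtain d where d: "d > 0" "\<And>p q. p \<in> {0..t0 + 1} \<times> UNIV \<Longrightarrow> q \<in> {0..t0 + 1} \<times> UNIV \<Longrightarrow> dist q p < d \<Longrightarrow>
      dist ((\<lambda>(t, x). u t x) q) ((\<lambda>(t, x). u t x) p) < \<epsilon>'"
      using uc e'(1) unfolding uniformly_continuous_on_def by meson
    have "\<bar>u s y - u0\<bar> < \<epsilon>'" if "s \<ge> 0" "\<bar>s - t0\<bar> < min (d / 2) 1" "\<bar>y - x0\<bar> < min (d / 2) 1" for s y
    proof -
      have "dist (s, y) (t0, x0) \<le> dist s t0 + dist y x0"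
        unfolding dist_prod_def by (simp add: sqrt_sum_squares_le_sum)
      also have "\<dots> < d" using that by (simp add: dist_real_def)
      finally have "dist ((\<lambda>(t, x). u t x) (s, y)) ((\<lambda>(t, x). u t x) (t0, x0)) < \<epsilon>'"
        using that t0 by (intro d(2)) auto
      then show ?thesis unfolding u0_def by (simp add: dist_real_def)
    qed
    then show thesis using d(1) by (intro that[of "min (d / 2) 1"]) auto
  qed
  \<comment> \<open>Half of the admissible distance: a line within \<open>r\<close> of
    \<open>x0\<close>, together with the strip of width \<open>r\<close> to its left, stays
    inside.\<close>
  define r where "r = min (d1 / 3) d2 / 2"
  have r: "r > 0" "2 * r \<le> d1 / 3" "2 * r \<le> d2" unfolding r_def using d1(1) d2(1) by auto
  define V where "V = \<bar>u0\<bar> + \<epsilon>' + 1"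
  have V: "V \<ge> 1" unfolding V_def using e' by simp
  \<comment> \<open>\<open>V\<close> bounds the slopes, the time span is at most
    \<open>2 * \<rho>\<close> and the start is within \<open>\<rho> \<le> V * \<rho>\<close> of
    \<open>x0\<close>, so the whole line stays within \<open>3 * V * \<rho> = r\<close>.\<close>
  define \<rho> where "\<rho> = r / (3 * V)"
  have rho: "\<rho> > 0" "3 * V * \<rho> = r" unfolding \<rho>_def using r V by auto
  have "1 * \<rho> \<le> V * \<rho>" using V rho(1) by (intro mult_right_mono) auto
  then have rho_r: "3 * \<rho> \<le> r" using rho(2) by linarith
  show thesis
  proof (rule that[OF rho(1)])
    fix t1 t2 x assume t: "0 \<le> t1" "t1 \<le> t2" and near: "\<bar>t1 - t0\<bar> < \<rho>" "\<bar>t2 - t0\<bar> < \<rho>" "\<bar>x - x0\<bar> < \<rho>"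
    have path: "\<bar>x + c * (s - t1) - x0\<bar> < r" if c: "\<bar>c - u0\<bar> \<le> \<epsilon>'" and s: "t1 < s" "s \<le> t2" for c s
    proof -
      have "\<bar>c\<bar> \<le> V" using c unfolding V_def by linarith
      moreover have "\<bar>s - t1\<bar> \<le> 2 * \<rho>" using s near by linarith
      ultimately have "\<bar>c * (s - t1)\<bar> \<le> V * (2 * \<rho>)" unfolding abs_mult using V by (intro mult_mono) auto
      moreover have "\<rho> \<le> V * \<rho>" using mult_right_mono[OF V, of \<rho>] rho by simp
      ultimately have "\<bar>x + c * (s - t1) - x0\<bar> < V * \<rho> + V * (2 * \<rho>)" using near(3) by linarith
      also have "\<dots> = r" using rho(2) by (simp add: algebra_simps)
      finally show ?thesis .
    qed
    have Hp: "\<bar>H c s (x + c * (s - t1)) + h0\<bar> \<le> \<epsilon>" if c: "\<bar>c - u0\<bar> \<le> \<epsilon>'" and s: "t1 < s" "s \<le> t2" for c s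
    proof -
      have "\<bar>H c s (x + c * (s - t1)) - H u0 t0 x0\<bar> \<le> \<epsilon>"
      proof (rule Hnear)
        show "s \<ge> 0" using s t by simp
        show "\<bar>c - u0\<bar> < d1 / 3" using c e' by simp
        show "\<bar>s - t0\<bar> < d1 / 3" using s near rho_r r rho(1) by linarith
        show "\<bar>x + c * (s - t1) - x0\<bar> < d1 / 3" using path[OF c s] r by linarith
      qed
      then show ?thesis unfolding h0 by simp
    qed
    have up: "\<bar>u s y - u0\<bar> < \<epsilon>'"
      if c: "\<bar>c - u0\<bar> \<le> \<epsilon>'" and s: "t1 < s" "s \<le> t2" and y: "x + c * (s - t1) - r \<le> y" "y \<le> x + c * (s - t1)" for c s y
    proof (rule d2(2))
      show "s \<ge> 0" using s t by simp
      show "\<bar>s - t0\<bar> < d2" using s near rho_r r rho(1) by linarith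
      show "\<bar>y - x0\<bar> < d2" using path[OF c s] r y by linarith
    qed
    have c1: "\<bar>(u0 + \<epsilon>') - u0\<bar> \<le> \<epsilon>'" and c2: "\<bar>(u0 - \<epsilon>') - u0\<bar> \<le> \<epsilon>'" using e' by auto
    have "(LINT y:{..x}|lborel. pHS n \<mu> t1 y) + (h0 - \<epsilon>) * (t2 - t1) \<le> (LINT y:{..x + (u0 + \<epsilon>') * (t2 - t1)}|lborel. pHS n \<mu> t2 y)"
    proof (rule pHS_primitive_transport(1)[OF t n])
      fix s assume s: "t1 < s" "s \<le> t2"
      show "(\<integral>y. (u s y - (u0 + \<epsilon>')) * Kn n (y - (x + (u0 + \<epsilon>') * (s - t1))) \<partial>\<mu> s) \<le> - (h0 - \<epsilon>)"
        using Hp[OF c1 s] unfolding H_def by linarith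
    qed
    moreover have "measure (\<mu> t1) {..<x} \<le> measure (\<mu> t2) {..<x + (u0 + \<epsilon>') * (t2 - t1)}"
    proof (rule distribution_transport_le[OF t r(1)])
      fix s y assume "t1 < s" "s \<le> t2" "x + (u0 + \<epsilon>') * (s - t1) - r \<le> y" "y \<le> x + (u0 + \<epsilon>') * (s - t1)"
      from up[OF c1 this] show "u s y \<le> u0 + \<epsilon>'" by linarith
    qed
    ultimately have "GHS n \<mu> t1 x + (h0 - \<epsilon>) * (t2 - t1) \<le> GHS n \<mu> t2 (x + (u0 + \<epsilon>') * (t2 - t1))"
      unfolding GHS_def by linarith
    moreover have "GHS n \<mu> t2 (x + (u0 + \<epsilon>') * (t2 - t1)) \<le> GHS n \<mu> t2 (x + (u0 + \<epsilon>) * (t2 - t1))"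
      using t e' by (intro GHS_mono n) (auto intro!: mult_right_mono)
    moreover
    have "(LINT y:{..x + (u0 - \<epsilon>') * (t2 - t1)}|lborel. pHS n \<mu> t2 y) \<le> (LINT y:{..x}|lborel. pHS n \<mu> t1 y) + (h0 + \<epsilon>) * (t2 - t1)"
    proof (rule pHS_primitive_transport(2)[OF t n])
      fix s assume s: "t1 < s" "s \<le> t2"
      show "- (h0 + \<epsilon>) \<le> (\<integral>y. (u s y - (u0 - \<epsilon>')) * Kn n (y - (x + (u0 - \<epsilon>') * (s - t1))) \<partial>\<mu> s)"
        using Hp[OF c2 s] unfolding H_def by linarith
    qed
    moreover have "measure (\<mu> t2) {..<x + (u0 - \<epsilon>') * (t2 - t1)} \<le> measure (\<mu> t1) {..<x}"
    proof (rule distribution_transport_ge[OF t r(1)])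
      fix s y assume "t1 < s" "s \<le> t2" "x + (u0 - \<epsilon>') * (s - t1) - r \<le> y" "y \<le> x + (u0 - \<epsilon>') * (s - t1)"
      from up[OF c2 this] show "u0 - \<epsilon>' \<le> u s y" by linarith
    qed
    moreover have "GHS n \<mu> t2 (x + (u0 - \<epsilon>) * (t2 - t1)) \<le> GHS n \<mu> t2 (x + (u0 - \<epsilon>') * (t2 - t1))"
      using t e' by (intro GHS_mono n) (auto intro!: mult_right_mono)
    ultimately show "GHS n \<mu> t1 x + (h0 - \<epsilon>) * (t2 - t1) \<le> GHS n \<mu> t2 (x + (u0 + \<epsilon>) * (t2 - t1)) \<and>
       GHS n \<mu> t2 (x + (u0 - \<epsilon>) * (t2 - t1)) \<le> GHS n \<mu> t1 x + (h0 + \<epsilon>) * (t2 - t1)"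
      unfolding GHS_def by linarith
  qed
qed

end

section \<open>The measure \<open>p dx + d\<mu>\<close> and its quantile function\<close>

definition sum_measure :: "'a measure \<Rightarrow> 'a measure \<Rightarrow> 'a measure" where
  "sum_measure M N = measure_of (space M) (sets M) (\<lambda>A. emeasure M A + emeasure N A)"

lemma sets_sum_measure[simp]: "sets (sum_measure M N) = sets M"
  and space_sum_measure[simp]: "space (sum_measure M N) = space M"
  unfolding sum_measure_def by simp_all

lemma emeasure_sum_measure:
  assumes s: "sets N = sets M" and A: "A \<in> sets M"
  shows "emeasure (sum_measure M N) A = emeasure M A + emeasure N A"
proof (rule emeasure_measure_of[OF sum_measure_def])
  show "countably_additive (sets (sum_measure M N)) (\<lambda>A. emeasure M A + emeasure N A)"
  proof (rule countably_additiveI)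
    fix F :: "nat \<Rightarrow> 'a set" assume F: "range F \<subseteq> sets (sum_measure M N)" "disjoint_family F"
    have "(\<Sum>i. emeasure M (F i) + emeasure N (F i)) = (\<Sum>i. emeasure M (F i)) + (\<Sum>i. emeasure N (F i))"
      by (rule suminf_add[symmetric]) auto
    also have "\<dots> = emeasure M (\<Union>i. F i) + emeasure N (\<Union>i. F i)"
      using F s by (intro arg_cong2[where f="(+)"] suminf_emeasure) auto
    finally show "(\<Sum>i. emeasure M (F i) + emeasure N (F i)) = emeasure M (\<Union>i. F i) + emeasure N (\<Union>i. F i)" .
  qed
qed (use A in \<open>auto simp: positive_def sets.space_closed[THEN subsetD] dest: sets.sets_into_space\<close>)

lemma nn_integral_sum_measure:
  assumes s: "sets N = sets M" and f: "f \<in> borel_measurable M"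
  shows "(\<integral>\<^sup>+x. f x \<partial>sum_measure M N) = (\<integral>\<^sup>+x. f x \<partial>M) + (\<integral>\<^sup>+x. f x \<partial>N)"
proof -
  have m: "g \<in> borel_measurable (sum_measure M N) \<and> g \<in> borel_measurable N" if "g \<in> borel_measurable M" for g :: "'a \<Rightarrow> ennreal"
    using that s measurable_cong_sets[OF sets_sum_measure[of M N] refl] measurable_cong_sets[OF s refl] by blast
  show ?thesis using f
  proof (induction rule: borel_measurable_induct)
    case (cong f g)
    have sp: "space N = space M" using sets_eq_imp_space_eq[OF s] .
    have e: "(\<integral>\<^sup>+x. f x \<partial>K) = (\<integral>\<^sup>+x. g x \<partial>K)" if "space K = space M" for K
      by (rule nn_integral_cong) (use cong(3) that in simp)
    show ?case unfolding e[OF space_sum_measure] e[OF refl] e[OF sp] by (rule cong(4))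
  next
    case (set A)
    then show ?case using s by (simp add: emeasure_sum_measure)
  next
    case (mult f c)
    then show ?case using m[of f] by (simp add: nn_integral_cmult distrib_left)
  next
    case (add f g)
    then show ?case using m[of f] m[of g] by (simp add: nn_integral_add algebra_simps)
  next
    case (seq F)
    have inc: "incseq F" using seq by simp
    have "(\<integral>\<^sup>+x. (SUP i. F i) x \<partial>K) = (SUP i. \<integral>\<^sup>+x. F i x \<partial>K)" if "\<And>i. F i \<in> borel_measurable K" for K
      using nn_integral_monotone_convergence_SUP[OF inc that] by (simp add: image_comp)
    then have e: "(\<integral>\<^sup>+x. (SUP i. F i) x \<partial>sum_measure M N) = (SUP i. \<integral>\<^sup>+x. F i x \<partial>sum_measure M N)"
      "(\<integral>\<^sup>+x. (SUP i. F i) x \<partial>M) = (SUP i. \<integral>\<^sup>+x. F i x \<partial>M)"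
      "(\<integral>\<^sup>+x. (SUP i. F i) x \<partial>N) = (SUP i. \<integral>\<^sup>+x. F i x \<partial>N)"
      using m seq(1) by blast+
    have "(SUP i. (\<integral>\<^sup>+x. F i x \<partial>M) + (\<integral>\<^sup>+x. F i x \<partial>N)) = (SUP i. \<integral>\<^sup>+x. F i x \<partial>M) + (SUP i. \<integral>\<^sup>+x. F i x \<partial>N)"
      using inc by (intro ennreal_SUP_add) (auto simp: incseq_def le_fun_def intro!: nn_integral_mono)
    then show ?case unfolding e using seq by simp
  qed
qed

lemma powr_add_le:
  fixes y z \<gamma> :: real
  assumes "\<gamma> > 0" shows "\<bar>y + z\<bar> powr \<gamma> \<le> 2 powr \<gamma> * (\<bar>y\<bar> powr \<gamma> + \<bar>z\<bar> powr \<gamma>)"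
proof -
  have "\<bar>y + z\<bar> powr \<gamma> \<le> (2 * max \<bar>y\<bar> \<bar>z\<bar>) powr \<gamma>" using assms by (intro powr_mono2) auto
  also have "\<dots> = 2 powr \<gamma> * max \<bar>y\<bar> \<bar>z\<bar> powr \<gamma>" by (simp add: powr_mult)
  also have "\<dots> \<le> 2 powr \<gamma> * (\<bar>y\<bar> powr \<gamma> + \<bar>z\<bar> powr \<gamma>)" by (intro mult_left_mono) (auto simp: max_def)
  finally show ?thesis .
qed

text \<open>\<open>\<bar>z\<bar> powr \<gamma>\<close> is at most
  \<open>(1 + z\<^sup>2) powr (\<gamma> / 2)\<close>, and
  \<open>\<gamma> / 2 \<le> \<gamma> - 1 \<le> n - 1\<close> by \<open>\<gamma> > 2\<close> and
  \<open>n \<ge> \<gamma>\<close>. One factor \<open>1 + z\<^sup>2\<close> of the kernel is left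
  over for integrability.\<close>

lemma Kn_moment:
  assumes g: "\<gamma> > 2" and n: "real n \<ge> \<gamma>"
  shows "\<bar>z\<bar> powr \<gamma> * Kn n z \<le> 1 / (1 + z\<^sup>2)"
proof -
  define w where "w = 1 + z\<^sup>2"
  have w: "w \<ge> 1" "w > 0" unfolding w_def by (auto intro: add_pos_nonneg)
  have n1: "n \<ge> 1" using n g by (cases n) auto
  have "\<bar>z\<bar> powr \<gamma> \<le> (w powr (1 / 2)) powr \<gamma>"
  proof (rule powr_mono2)
    have "\<bar>z\<bar> = sqrt (z\<^sup>2)" by simp
    also have "\<dots> \<le> sqrt w" unfolding w_def by (intro real_sqrt_le_mono) auto
    also have "\<dots> = w powr (1 / 2)" using w by (simp add: powr_half_sqrt)
    finally show "\<bar>z\<bar> \<le> w powr (1 / 2)" .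
  qed (use g in auto)
  also have "\<dots> = w powr (\<gamma> / 2)" by (simp add: powr_powr)
  also have "\<dots> \<le> w powr real (n - 1)" using w n n1 g by (intro powr_mono) auto
  also have "\<dots> = w ^ (n - 1)" using w by (simp add: powr_realpow)
  finally have "\<bar>z\<bar> powr \<gamma> * Kn n z \<le> w ^ (n - 1) * Kn n z" by (intro mult_right_mono Kn_nonneg)
  also have "\<dots> = 1 / w"
  proof -
    have "w ^ n = w ^ (n - 1) * w" using n1 by (metis Suc_pred' less_eq_Suc_le One_nat_def power_Suc2)
    then show ?thesis unfolding Kn_def w_def[symmetric] using w by simp
  qed
  finally show ?thesis unfolding w_def .
qed

text \<open>Positive mass makes \<open>p\<close> positive everywhere and the interval
  \<open>(0, B + C)\<close> nonempty. Zero mass leaves a degenerate interval, which the final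
  theorem treats separately.\<close>

locale measure_transport_kernel = measure_transport \<psi> u \<mu>
  for \<psi> :: "real \<Rightarrow> real" and u :: "real \<Rightarrow> real \<Rightarrow> real" and \<mu> :: "real \<Rightarrow> real measure" +
  fixes n :: nat
  assumes n: "n \<ge> 1" and C: "measure (\<mu> 0) UNIV > 0"
begin

abbreviation "NN \<equiv> BHS n \<mu> + CHS \<mu>"

lemma NN_eq: "NN = kap n * measure (\<mu> 0) UNIV + measure (\<mu> 0) UNIV"
  unfolding BHS_def CHS_def using pHS_integral[OF order_refl n] by simp

lemma NN_pos: "NN > 0"
proof -
  have "kap n \<ge> 0" unfolding kap_def by (intro integral_nonneg_AE AE_I2 Kn_nonneg)
  then show ?thesis unfolding NN_eq using C by (simp add: add_nonneg_pos)
qed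

definition pmeas :: "real \<Rightarrow> real measure" where "pmeas t = density lborel (\<lambda>x. ennreal (pHS n \<mu> t x))"

definition Gam :: "real \<Rightarrow> real measure" where "Gam t = sum_measure (pmeas t) (\<mu> t)"

lemma sets_Gam: "sets (Gam t) = sets borel" and sets_pmeas: "sets (pmeas t) = sets borel"
  unfolding Gam_def pmeas_def by simp_all

lemma emeasure_Gam:
  assumes t: "t \<ge> 0" and A: "A \<in> sets borel"
  shows "emeasure (Gam t) A = emeasure (pmeas t) A + emeasure (\<mu> t) A"
  unfolding Gam_def by (rule emeasure_sum_measure) (use A sets_mu[OF t] sets_pmeas in auto)

lemma emeasure_pmeas:
  assumes t: "t \<ge> 0" and A: "A \<in> sets borel"
  shows "emeasure (pmeas t) A = ennreal (LINT x:A|lborel. pHS n \<mu> t x)"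
proof -
  note [measurable] = pHS_meas[OF t, of n]
  have i: "integrable lborel (\<lambda>x. indicator A x * pHS n \<mu> t x)"
    using integrable_real_mult_indicator[OF _ pHS_integrable[OF t n], of A] A by (simp add: mult.commute)
  have "emeasure (pmeas t) A = (\<integral>\<^sup>+x. ennreal (indicator A x * pHS n \<mu> t x) \<partial>lborel)"
    unfolding pmeas_def using A
    by (subst emeasure_density) (auto intro!: nn_integral_cong simp: indicator_def)
  also have "\<dots> = ennreal (\<integral>x. indicator A x * pHS n \<mu> t x \<partial>lborel)"
    by (rule nn_integral_eq_integral[OF i]) (auto simp: pHS_nonneg)
  finally show ?thesis unfolding set_lebesgue_integral_def by simp
qed

lemma set_pHS_nonneg: "0 \<le> (LINT x:A|lborel. pHS n \<mu> t x)"
  unfolding set_lebesgue_integral_def by (intro integral_nonneg_AE AE_I2) (simp add: pHS_nonneg)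

lemma emeasure_Gam_real:
  assumes t: "t \<ge> 0" and A: "A \<in> sets borel"
  shows "emeasure (Gam t) A = ennreal ((LINT x:A|lborel. pHS n \<mu> t x) + measure (\<mu> t) A)"
  unfolding emeasure_Gam[OF t A] emeasure_pmeas[OF t A]
    finite_measure.emeasure_eq_measure[OF finite_mu[OF t]]
  by (rule ennreal_plus[symmetric, OF set_pHS_nonneg measure_nonneg])

lemma finite_Gam: "t \<ge> 0 \<Longrightarrow> finite_measure (Gam t)"
  by (rule finite_measureI) (simp add: emeasure_Gam_real sets_eq_imp_space_eq[OF sets_Gam])

lemma measure_Gam:
  assumes t: "t \<ge> 0" and A: "A \<in> sets borel"
  shows "measure (Gam t) A = (LINT x:A|lborel. pHS n \<mu> t x) + measure (\<mu> t) A"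
  unfolding measure_def[of "Gam t"] emeasure_Gam_real[OF t A]
  by (rule enn2real_ennreal) (intro add_nonneg_nonneg set_pHS_nonneg measure_nonneg)

lemma measure_Gam_UNIV: "t \<ge> 0 \<Longrightarrow> measure (Gam t) UNIV = NN"
  using pHS_integral[of t n] n
  by (simp add: measure_Gam NN_eq mass_const[of t] set_lebesgue_integral_def)

lemma measure_Gam_lessThan:
  assumes t: "t \<ge> 0" shows "measure (Gam t) {..<x} = GHS n \<mu> t x"
proof -
  \<comment> \<open>\<open>GHS\<close> integrates \<open>p\<close> over \<open>{..x}\<close> but
    measures \<open>{..<x}\<close>; the point \<open>x\<close> is Lebesgue null, so one half-line
    serves both.\<close>
  have "(LINT y:{..<x}|lborel. pHS n \<mu> t y) = (LINT y:{..x}|lborel. pHS n \<mu> t y)"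
    by (rule set_integral_discrete_difference[where X="{x}"]) auto
  then show ?thesis unfolding GHS_def using measure_Gam[OF t, of "{..<x}"] by simp
qed

lemma atMost_le_GHS: "t \<ge> 0 \<Longrightarrow> x < y \<Longrightarrow> measure (Gam t) {..x} \<le> GHS n \<mu> t y"
  unfolding measure_Gam_lessThan[symmetric]
  by (rule finite_measure.finite_measure_mono[OF finite_Gam]) (auto simp: sets_Gam)

section \<open>The quantile function of \<open>p dx + d\<mu>\<close>\<close>

lemma GHS_small:
  assumes t: "t \<ge> 0" and e: "0 < \<eta>"
  obtains x where "GHS n \<mu> t x < \<eta>"
proof -
  interpret F: finite_measure "Gam t" by (rule finite_Gam[OF t])
  have "(\<lambda>i. measure (Gam t) {..<- real i}) \<longlonglongrightarrow> measure (Gam t) (\<Inter>i. {..<- real i})"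
    by (rule F.finite_Lim_measure_decseq) (auto simp: sets_Gam decseq_def)
  moreover have "(\<Inter>i. {..<- real i}) = {}"
  proof (rule equals0I)
    fix x assume x: "x \<in> (\<Inter>i. {..<- real i})"
    obtain i :: nat where "- x < real i" using reals_Archimedean2 by blast
    moreover have "x < - real i" using x by auto
    ultimately show False by linarith
  qed
  ultimately have "(\<lambda>i. GHS n \<mu> t (- real i)) \<longlonglongrightarrow> 0" unfolding measure_Gam_lessThan[OF t] by simp
  then have "\<forall>\<^sub>F i in sequentially. GHS n \<mu> t (- real i) < \<eta>" using e by (rule order_tendstoD)
  then show thesis using that by (auto simp: eventually_sequentially)
qed

lemma GHS_large:
  assumes t: "t \<ge> 0" and e: "\<eta> < NN"
  obtains x where "\<eta> < GHS n \<mu> t x"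
proof -
  interpret F: finite_measure "Gam t" by (rule finite_Gam[OF t])
  have "(\<lambda>i. measure (Gam t) {..<real i}) \<longlonglongrightarrow> measure (Gam t) (\<Union>i. {..<real i})"
    by (rule F.finite_Lim_measure_incseq) (auto simp: sets_Gam incseq_def)
  moreover have "(\<Union>i. {..<real i}) = UNIV" using reals_Archimedean2 by auto
  ultimately have "(\<lambda>i. GHS n \<mu> t (real i)) \<longlonglongrightarrow> NN"
    unfolding measure_Gam_lessThan[OF t] by (simp add: measure_Gam_UNIV[OF t])
  then have "\<forall>\<^sub>F i in sequentially. \<eta> < GHS n \<mu> t (real i)" using e by (rule order_tendstoD)
  then show thesis using that by (auto simp: eventually_sequentially)
qed

lemma chi_le:
  assumes t: "t \<ge> 0" and e: "0 < \<eta>" and X: "\<eta> \<le> GHS n \<mu> t X"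
  shows "chiHS n \<mu> t \<eta> \<le> X"
  unfolding chiHS_def
proof (rule cSup_least)
  show "{x. GHS n \<mu> t x < \<eta>} \<noteq> {}" using GHS_small[OF t e] by auto
  fix x assume "x \<in> {x. GHS n \<mu> t x < \<eta>}"
  then show "x \<le> X" using X GHS_mono[OF t n, of X x] by force
qed

lemma chi_ge:
  assumes t: "t \<ge> 0" and e: "\<eta> < NN" and X: "GHS n \<mu> t X < \<eta>"
  shows "X \<le> chiHS n \<mu> t \<eta>"
  unfolding chiHS_def
proof (rule cSup_upper)
  obtain Y where Y: "\<eta> < GHS n \<mu> t Y" by (rule GHS_large[OF t e])
  show "bdd_above {x. GHS n \<mu> t x < \<eta>}"
  proof (rule bdd_aboveI[of _ Y])
    fix x assume "x \<in> {x. GHS n \<mu> t x < \<eta>}"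
    then show "x \<le> Y" using Y GHS_mono[OF t n, of Y x] by force
  qed
qed (use X in simp)

text \<open>The Galois connection between a distribution function and its quantile. The half-line is
  closed because \<open>GHS\<close> is only left-continuous: at an atom \<open>x\<close>,
  \<open>GHS n \<mu> t x < \<eta>\<close> gives no more than
  \<open>x \<le> chiHS n \<mu> t \<eta>\<close>.\<close>

lemma chi_gt_iff:
  assumes t: "t \<ge> 0" and e: "0 < \<eta>" "\<eta> < NN"
  shows "x < chiHS n \<mu> t \<eta> \<longleftrightarrow> measure (Gam t) {..x} < \<eta>"
proof
  assume "x < chiHS n \<mu> t \<eta>"
  then obtain y where y: "x < y" "y < chiHS n \<mu> t \<eta>" using dense by blast
  then have "GHS n \<mu> t y < \<eta>" using chi_le[OF t e(1), of y] by force
  then show "measure (Gam t) {..x} < \<eta>" using atMost_le_GHS[OF t y(1)] by linarith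
next
  assume lt: "measure (Gam t) {..x} < \<eta>"
  interpret F: finite_measure "Gam t" by (rule finite_Gam[OF t])
  have "(\<lambda>i. measure (Gam t) {..<x + 1 / real (Suc i)}) \<longlonglongrightarrow> measure (Gam t) (\<Inter>i. {..<x + 1 / real (Suc i)})"
  proof (rule F.finite_Lim_measure_decseq)
    have "1 / real (Suc j) \<le> 1 / real (Suc i)" if "i \<le> j" for i j using that by (intro divide_left_mono) auto
    then show "decseq (\<lambda>i. {..<x + 1 / real (Suc i)})" unfolding decseq_def by simp
  qed (auto simp: sets_Gam)
  moreover have "(\<Inter>i. {..<x + 1 / real (Suc i)}) = {..x}"
  proof (intro set_eqI iffI)
    fix y assume y: "y \<in> (\<Inter>i. {..<x + 1 / real (Suc i)})"
    show "y \<in> {..x}"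
    proof (rule ccontr)
      assume "y \<notin> {..x}"
      then obtain i where "1 / real (Suc i) < y - x" using nat_approx_posE[of "y - x"] by auto
      moreover have "y < x + 1 / real (Suc i)" using y by blast
      ultimately show False by linarith
    qed
  next
    fix y assume "y \<in> {..x}"
    moreover have "0 < 1 / real (Suc i)" for i by simp
    ultimately show "y \<in> (\<Inter>i. {..<x + 1 / real (Suc i)})" by (auto simp del: of_nat_Suc intro: le_less_trans less_add_same_cancel1[THEN iffD2])
  qed
  ultimately have "(\<lambda>i. GHS n \<mu> t (x + 1 / real (Suc i))) \<longlonglongrightarrow> measure (Gam t) {..x}"
    unfolding measure_Gam_lessThan[OF t] by simp
  then have "\<forall>\<^sub>F i in sequentially. GHS n \<mu> t (x + 1 / real (Suc i)) < \<eta>" using lt by (rule order_tendstoD)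
  then obtain i where "GHS n \<mu> t (x + 1 / real (Suc i)) < \<eta>" by (auto simp: eventually_sequentially)
  then have "x + 1 / real (Suc i) \<le> chiHS n \<mu> t \<eta>" by (rule chi_ge[OF t e(2)])
  moreover have "0 < 1 / real (Suc i)" by simp
  ultimately show "x < chiHS n \<mu> t \<eta>" by linarith
qed

lemma chi_mono:
  assumes t: "t \<ge> 0" and e: "0 < \<eta>" "\<eta> \<le> \<eta>'" "\<eta>' < NN"
  shows "chiHS n \<mu> t \<eta> \<le> chiHS n \<mu> t \<eta>'"
proof (rule ccontr)
  assume "\<not> chiHS n \<mu> t \<eta> \<le> chiHS n \<mu> t \<eta>'"
  then have "chiHS n \<mu> t \<eta>' < chiHS n \<mu> t \<eta>" by simp
  then have "measure (Gam t) {..chiHS n \<mu> t \<eta>'} < \<eta>" using chi_gt_iff[OF t e(1)] e by simp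
  then have "measure (Gam t) {..chiHS n \<mu> t \<eta>'} < \<eta>'" using e(2) by simp
  moreover have "0 < \<eta>'" using e by simp
  ultimately have "chiHS n \<mu> t \<eta>' < chiHS n \<mu> t \<eta>'" using chi_gt_iff[OF t _ e(3)] by blast
  then show False by simp
qed

text \<open>The supremum defining \<^const>\<open>chiHS\<close> is over an empty or unbounded set, hence junk, at the
  endpoints \<open>0\<close> and \<open>B + C\<close>.\<close>
definition chi0 :: "real \<Rightarrow> real \<Rightarrow> real" where
  "chi0 t \<eta> = (if \<eta> \<in> {0<..<NN} then chiHS n \<mu> t \<eta> else 0)"

lemma chi0_greater:
  assumes t: "t \<ge> 0"
  shows "{\<eta>. x < chi0 t \<eta>} \<inter> {0<..<NN} = {measure (Gam t) {..x}<..<NN}"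
  using chi_gt_iff[OF t] measure_nonneg[of "Gam t" "{..x}"] unfolding chi0_def by (auto simp del: measure_nonneg)

lemma chi0_meas:
  assumes t: "t \<ge> 0" shows "chi0 t \<in> borel_measurable borel"
  unfolding borel_measurable_iff_greater
proof
  fix x
  \<comment> \<open>Outside \<open>(0, NN)\<close> the default value \<open>0\<close> exceeds
    \<open>x\<close> exactly when \<open>x < 0\<close>.\<close>
  have "{\<eta>. x < chi0 t \<eta>} = {measure (Gam t) {..x}<..<NN} \<union> (if x < 0 then - {0<..<NN} else {})"
    unfolding chi0_greater[OF t, symmetric] by (auto simp: chi0_def)
  then show "{w \<in> space borel. x < chi0 t w} \<in> sets borel" by simp
qed

text \<open>A density rather than a restricted space, so that the measurable sets are all Borel sets
  of the line.\<close>

definition Leta :: "real measure" where "Leta = density lborel (indicator {0<..<NN})"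

lemma emeasure_Leta: "A \<in> sets borel \<Longrightarrow> emeasure Leta A = emeasure lborel (A \<inter> {0<..<NN})"
  unfolding Leta_def by (subst emeasure_density) (auto simp: indicator_inter_arith[symmetric] Int_commute)

lemma sets_Leta: "sets Leta = sets borel"
  unfolding Leta_def by simp

text \<open>By \<open>chi0_greater\<close> the part of the preimage of \<open>{x<..}\<close> inside
  \<open>(0, NN)\<close> is an interval of length \<open>NN - measure (Gam t) {..x}\<close>, and
  half-lines determine a finite measure. Atoms are allowed, which matters at time \<open>0\<close>,
  where the moment hypothesis is transferred to \<chi>.\<close>

lemma distr_chi0:
  assumes t: "t \<ge> 0" shows "distr Leta borel (chi0 t) = Gam t"
proof (rule measure_eqI_lessThan)
  have cm: "chi0 t \<in> measurable Leta borel" unfolding measurable_cong_sets[OF sets_Leta refl] by (rule chi0_meas[OF t])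
  interpret F: finite_measure "Gam t" by (rule finite_Gam[OF t])
  have e: "emeasure (distr Leta borel (chi0 t)) {x<..} = ennreal (NN - measure (Gam t) {..x})" for x
  proof -
    have le: "measure (Gam t) {..x} \<le> NN"
      unfolding measure_Gam_UNIV[OF t, symmetric] by (rule F.finite_measure_mono) (auto simp: sets_Gam)
    have "emeasure (distr Leta borel (chi0 t)) {x<..} = emeasure Leta (chi0 t -` {x<..} \<inter> space Leta)"
      by (rule emeasure_distr[OF cm]) simp
    also have "chi0 t -` {x<..} \<inter> space Leta = {\<eta>. x < chi0 t \<eta>}"
      using sets_eq_imp_space_eq[OF sets_Leta] by auto
    also have "emeasure Leta {\<eta>. x < chi0 t \<eta>} = emeasure lborel {measure (Gam t) {..x}<..<NN}"
      unfolding chi0_greater[OF t, symmetric]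
      by (rule emeasure_Leta) (use chi0_meas[OF t] in \<open>simp add: borel_measurable_iff_greater\<close>)
    also have "\<dots> = ennreal (NN - measure (Gam t) {..x})" using le by simp
    finally show ?thesis .
  qed
  show "emeasure (distr Leta borel (chi0 t)) {x<..} < \<infinity>" for x unfolding e by simp
  show "emeasure (distr Leta borel (chi0 t)) {x<..} = emeasure (Gam t) {x<..}" for x
  proof -
    have "measure (Gam t) (space (Gam t) - {..x}) = measure (Gam t) (space (Gam t)) - measure (Gam t) {..x}"
      by (rule F.finite_measure_compl) (simp add: sets_Gam)
    moreover have "space (Gam t) - {..x} = {x<..}" "space (Gam t) = UNIV"
      using sets_eq_imp_space_eq[OF sets_Gam, of t] by auto
    ultimately show ?thesis unfolding e F.emeasure_eq_measure by (simp add: measure_Gam_UNIV[OF t])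
  qed
qed (auto simp: sets_Gam)

text \<open>By \<open>GHS_speed\<close> the set \<open>{x. GHS n \<mu> t1 x < \<eta>}\<close>,
  shifted to the left by \<open>M * (t2 - t1)\<close>, lies in the corresponding set at
  \<open>t2\<close>, and vice versa. The suprema inherit this.\<close>

lemma chi_lipschitz:
  assumes t: "0 \<le> t1" "t1 \<le> t2" and M: "\<And>s y. t1 \<le> s \<Longrightarrow> s \<le> t2 \<Longrightarrow> \<bar>u s y\<bar> \<le> M" and e: "0 < \<eta>" "\<eta> < NN"
  shows "\<bar>chiHS n \<mu> t2 \<eta> - chiHS n \<mu> t1 \<eta>\<bar> \<le> M * (t2 - t1)"
proof -
  have t2: "0 \<le> t2" using t by simp
  note sp = GHS_speed[OF t n M]
  have 1: "chiHS n \<mu> t1 \<eta> \<le> chiHS n \<mu> t2 \<eta> + M * (t2 - t1)"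
    unfolding chiHS_def[of n \<mu> t1]
  proof (rule cSup_least)
    show "{x. GHS n \<mu> t1 x < \<eta>} \<noteq> {}" using GHS_small[OF t(1) e(1)] by auto
    fix x assume "x \<in> {x. GHS n \<mu> t1 x < \<eta>}"
    then have "GHS n \<mu> t2 (x - M * (t2 - t1)) < \<eta>" using sp(2)[of x] by simp
    from chi_ge[OF t2 e(2) this] show "x \<le> chiHS n \<mu> t2 \<eta> + M * (t2 - t1)" by simp
  qed
  have 2: "chiHS n \<mu> t2 \<eta> \<le> chiHS n \<mu> t1 \<eta> + M * (t2 - t1)"
    unfolding chiHS_def[of n \<mu> t2]
  proof (rule cSup_least)
    show "{x. GHS n \<mu> t2 x < \<eta>} \<noteq> {}" using GHS_small[OF t2 e(1)] by auto
    fix x assume "x \<in> {x. GHS n \<mu> t2 x < \<eta>}"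
    then have "GHS n \<mu> t1 (x - M * (t2 - t1)) < \<eta>" using sp(1)[of "x - M * (t2 - t1)"] by simp
    from chi_ge[OF t(1) e(2) this] show "x \<le> chiHS n \<mu> t1 \<eta> + M * (t2 - t1)" by simp
  qed
  show ?thesis using 1 2 by linarith
qed

lemma nn_integral_chi0_Gam:
  assumes t: "t \<ge> 0" and f[measurable]: "f \<in> borel_measurable borel"
  shows "(\<integral>\<^sup>+\<eta>\<in>{0<..<NN}. f (chi0 t \<eta>) \<partial>lborel) = (\<integral>\<^sup>+x. f x \<partial>Gam t)"
proof -
  note [measurable] = chi0_meas[OF t]
  have cm: "chi0 t \<in> measurable Leta borel" unfolding measurable_cong_sets[OF sets_Leta refl] by (rule chi0_meas[OF t])
  have "(\<integral>\<^sup>+x. f x \<partial>Gam t) = (\<integral>\<^sup>+\<eta>. f (chi0 t \<eta>) \<partial>Leta)"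
    unfolding distr_chi0[OF t, symmetric] by (rule nn_integral_distr[OF cm]) measurable
  also have "\<dots> = (\<integral>\<^sup>+\<eta>\<in>{0<..<NN}. f (chi0 t \<eta>) \<partial>lborel)"
    unfolding Leta_def by (subst nn_integral_density) (auto simp: mult.commute)
  finally show ?thesis by simp
qed

lemma nn_integral_chi0:
  assumes t: "t \<ge> 0" and f: "f \<in> borel_measurable borel"
  shows "(\<integral>\<^sup>+\<eta>\<in>{0<..<NN}. f (chi0 t \<eta>) \<partial>lborel) = (\<integral>\<^sup>+x. f x \<partial>pmeas t) + (\<integral>\<^sup>+x. f x \<partial>\<mu> t)"
  unfolding nn_integral_chi0_Gam[OF t f] Gam_def
  by (rule nn_integral_sum_measure) (use sets_mu[OF t] sets_pmeas f in \<open>auto simp: pmeas_def\<close>)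

text \<open>By Tonelli the moment of \<open>p dx\<close> is the \<open>\<mu>(0)\<close>-integral
  over \<open>y\<close> of the moment of \<open>K\<close> centred at \<open>y\<close>, and
  \<open>powr_add_le\<close> bounds the latter by a multiple of
  \<open>1 + \<bar>y\<bar> powr \<gamma>\<close>. Here \<open>k\<close> and \<open>m'\<close> are
  the moments of \<open>K\<close> of order \<open>0\<close> and \<gamma>.\<close>

lemma pmeas_moment:
  assumes g: "\<gamma> > 2" "real n \<ge> \<gamma>" and m: "(\<integral>\<^sup>+x. ennreal (1 + \<bar>x\<bar> powr \<gamma>) \<partial>\<mu> 0) < \<infinity>"
  shows "(\<integral>\<^sup>+x. ennreal (\<bar>x\<bar> powr \<gamma>) \<partial>pmeas 0) < \<infinity>"
proof -
  interpret M: finite_measure "\<mu> 0" by (rule finite_mu[OF order_refl])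
  interpret P: pair_sigma_finite "\<mu> 0" lborel ..
  have s: "sets (\<mu> 0 \<Otimes>\<^sub>M lborel) = sets (borel \<Otimes>\<^sub>M borel)"
    by (intro sets_pair_measure_cong sets_mu[OF order_refl]) simp
  note [measurable] = pHS_meas[OF order_refl, of n]
  define k where "k = (\<integral>\<^sup>+z. ennreal (Kn n z) \<partial>lborel)"
  define m' where "m' = (\<integral>\<^sup>+z. ennreal (\<bar>z\<bar> powr \<gamma> * Kn n z) \<partial>lborel)"
  have kfin: "k < \<infinity>" unfolding k_def using nn_integral_eq_integral[OF Kn_integrable[OF n]] by (simp add: Kn_nonneg)
  have mfin: "m' < \<infinity>"
  proof -
    have "m' \<le> (\<integral>\<^sup>+z. ennreal (1 / (1 + z\<^sup>2)) \<partial>lborel)"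
      unfolding m'_def by (intro nn_integral_mono ennreal_leI Kn_moment[OF g])
    also have "\<dots> < \<infinity>"
      using nn_integral_eq_integral[OF integrable_inverse_1_plus_square] by (simp add: add_nonneg_nonneg)
    finally show ?thesis .
  qed
  have inner: "(\<integral>\<^sup>+x. ennreal (\<bar>x\<bar> powr \<gamma>) * ennreal (Kn n (x - y)) \<partial>lborel) \<le> ennreal (2 powr \<gamma>) * (k + m') * ennreal (1 + \<bar>y\<bar> powr \<gamma>)" for y
  proof -
    have "(\<integral>\<^sup>+x. ennreal (\<bar>x\<bar> powr \<gamma>) * ennreal (Kn n (x - y)) \<partial>lborel) = (\<integral>\<^sup>+z. ennreal (\<bar>y + z\<bar> powr \<gamma>) * ennreal (Kn n z) \<partial>lborel)"
      by (subst nn_integral_real_affine[where c=1 and t=y]) simp_all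
    also have "\<dots> \<le> (\<integral>\<^sup>+z. ennreal (2 powr \<gamma>) * (ennreal (\<bar>y\<bar> powr \<gamma>) * ennreal (Kn n z) + ennreal (\<bar>z\<bar> powr \<gamma> * Kn n z)) \<partial>lborel)"
    proof (rule nn_integral_mono)
      fix z
      have "\<bar>y + z\<bar> powr \<gamma> * Kn n z \<le> 2 powr \<gamma> * (\<bar>y\<bar> powr \<gamma> + \<bar>z\<bar> powr \<gamma>) * Kn n z"
        using g by (intro mult_right_mono powr_add_le Kn_nonneg) auto
      then have "ennreal (\<bar>y + z\<bar> powr \<gamma> * Kn n z) \<le> ennreal (2 powr \<gamma> * (\<bar>y\<bar> powr \<gamma> * Kn n z + \<bar>z\<bar> powr \<gamma> * Kn n z))"
        by (intro ennreal_leI) (simp add: algebra_simps)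
      then show "ennreal (\<bar>y + z\<bar> powr \<gamma>) * ennreal (Kn n z) \<le> ennreal (2 powr \<gamma>) * (ennreal (\<bar>y\<bar> powr \<gamma>) * ennreal (Kn n z) + ennreal (\<bar>z\<bar> powr \<gamma> * Kn n z))"
        by (simp add: ennreal_mult[symmetric] ennreal_plus[symmetric] Kn_nonneg del: ennreal_plus)
    qed
    also have "\<dots> = ennreal (2 powr \<gamma>) * (ennreal (\<bar>y\<bar> powr \<gamma>) * k + m')"
      unfolding k_def m'_def by (simp add: nn_integral_cmult nn_integral_add)
    also have "\<dots> \<le> ennreal (2 powr \<gamma>) * ((k + m') * ennreal (1 + \<bar>y\<bar> powr \<gamma>))"
    proof (intro mult_left_mono)
      have "ennreal (1 + \<bar>y\<bar> powr \<gamma>) = 1 + ennreal (\<bar>y\<bar> powr \<gamma>)" by simp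
      then show "ennreal (\<bar>y\<bar> powr \<gamma>) * k + m' \<le> (k + m') * ennreal (1 + \<bar>y\<bar> powr \<gamma>)"
        by (simp add: distrib_left distrib_right mult.commute add_increasing add_increasing2 add_mono)
    qed simp
    finally show ?thesis by (simp add: mult.assoc)
  qed
  have pe: "ennreal (pHS n \<mu> 0 x) = (\<integral>\<^sup>+y. ennreal (Kn n (x - y)) \<partial>\<mu> 0)" for x
    unfolding pHS_eq Kn_commute[of n x]
    by (rule nn_integral_eq_integral[symmetric, OF Kn_shift_integrable[OF order_refl]]) (simp add: Kn_nonneg)
  have mK: "(\<lambda>(y, x). ennreal (\<bar>x\<bar> powr \<gamma>) * ennreal (Kn n (x - y))) \<in> borel_measurable (\<mu> 0 \<Otimes>\<^sub>M lborel)"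
    unfolding measurable_cong_sets[OF s refl] by measurable
  have "(\<integral>\<^sup>+x. ennreal (\<bar>x\<bar> powr \<gamma>) \<partial>pmeas 0) = (\<integral>\<^sup>+x. ennreal (\<bar>x\<bar> powr \<gamma>) * ennreal (pHS n \<mu> 0 x) \<partial>lborel)"
    unfolding pmeas_def by (subst nn_integral_density) (auto simp: mult.commute)
  also have "\<dots> = (\<integral>\<^sup>+x. (\<integral>\<^sup>+y. ennreal (\<bar>x\<bar> powr \<gamma>) * ennreal (Kn n (x - y)) \<partial>\<mu> 0) \<partial>lborel)"
    unfolding pe
    by (intro nn_integral_cong nn_integral_cmult[symmetric] measurable_mu[OF order_refl, THEN measurable_compose[OF _ measurable_ennreal]]) measurable
  also have "\<dots> = (\<integral>\<^sup>+y. (\<integral>\<^sup>+x. ennreal (\<bar>x\<bar> powr \<gamma>) * ennreal (Kn n (x - y)) \<partial>lborel) \<partial>\<mu> 0)"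
    using P.Fubini[OF mK] by simp
  also have "\<dots> \<le> (\<integral>\<^sup>+y. ennreal (2 powr \<gamma>) * (k + m') * ennreal (1 + \<bar>y\<bar> powr \<gamma>) \<partial>\<mu> 0)"
    by (rule nn_integral_mono) (rule inner)
  also have "\<dots> = ennreal (2 powr \<gamma>) * (k + m') * (\<integral>\<^sup>+y. ennreal (1 + \<bar>y\<bar> powr \<gamma>) \<partial>\<mu> 0)"
    by (rule nn_integral_cmult, rule measurable_compose[OF measurable_mu[OF order_refl] measurable_ennreal]) measurable
  also have "\<dots> < \<infinity>" using kfin mfin m by (simp add: ennreal_mult_less_top)
  finally show ?thesis .
qed

text \<open>\<open>\<chi>(0,\<cdot>)\<close> pushes Lebesgue measure to
  \<open>p dx + d\<mu>(0)\<close>, so its norm is a moment of that measure. Later times are reached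
  through the Lipschitz bound in time.\<close>

lemma chi0_moment:
  assumes g: "\<gamma> > 2" "real n \<ge> \<gamma>" and m: "(\<integral>\<^sup>+x. ennreal (1 + \<bar>x\<bar> powr \<gamma>) \<partial>\<mu> 0) < \<infinity>"
  shows "(\<integral>\<^sup>+\<eta>\<in>{0<..<NN}. ennreal (\<bar>chi0 0 \<eta>\<bar> powr \<gamma>) \<partial>lborel) < \<infinity>"
proof -
  have "(\<integral>\<^sup>+x. ennreal (\<bar>x\<bar> powr \<gamma>) \<partial>\<mu> 0) \<le> (\<integral>\<^sup>+x. ennreal (1 + \<bar>x\<bar> powr \<gamma>) \<partial>\<mu> 0)"
    by (intro nn_integral_mono ennreal_leI) simp
  then have "(\<integral>\<^sup>+x. ennreal (\<bar>x\<bar> powr \<gamma>) \<partial>\<mu> 0) < \<infinity>" using m by (rule le_less_trans)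
  then show ?thesis using pmeas_moment[OF g m]
    by (subst nn_integral_chi0[OF order_refl, where f="\<lambda>x. ennreal (\<bar>x\<bar> powr \<gamma>)"]) (auto simp: less_top[symmetric])
qed

end

section \<open>The time derivative at an atomless time\<close>

locale measure_transport_atomless = measure_transport_kernel \<psi> u \<mu> n
  for \<psi> :: "real \<Rightarrow> real" and u :: "real \<Rightarrow> real \<Rightarrow> real" and \<mu> :: "real \<Rightarrow> real measure" and n :: nat +
  fixes t :: real
  assumes t: "t \<ge> 0" and atomless: "\<And>x. measure (\<mu> t) {x} = 0"
begin

abbreviation "GG \<equiv> GHS n \<mu> t"
abbreviation "chi \<equiv> chiHS n \<mu> t"
abbreviation "p \<equiv> pHS n \<mu> t"

lemma p_pos: "0 < p x"
  by (rule pHS_pos[OF t C])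

lemma p_meas[measurable]: "p \<in> borel_measurable borel"
  by (rule pHS_meas[OF t])

lemma p_lower_bound:
  obtains m where "m > 0" "\<And>x. x \<in> {a..b} \<Longrightarrow> m \<le> p x"
proof (cases "a \<le> b")
  case True
  then have "{a..b} \<noteq> {}" by simp
  from continuous_attains_inf[OF compact_Icc this continuous_on_subset[OF pHS_continuous[OF t, of n]]]
  obtain z where "z \<in> {a..b}" "\<And>y. y \<in> {a..b} \<Longrightarrow> p z \<le> p y" by auto
  then show thesis using p_pos by (intro that[of "p z"]) auto
qed (auto intro: that[of 1])

lemma Gam_atMost: "measure (Gam t) {..x} = GG x"
proof -
  interpret M: finite_measure "\<mu> t" by (rule finite_mu[OF t])
  have "{..x} = {..<x} \<union> {x}" by auto
  then have "measure (\<mu> t) {..x} = measure (\<mu> t) {..<x} + measure (\<mu> t) {x}"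
    by (subst M.finite_measure_Union[symmetric]) (auto simp: sets_mu[OF t])
  then show ?thesis using measure_Gam[OF t, of "{..x}"] atomless[of x] unfolding GHS_def by simp
qed

text \<open>\<open>p\<close> has a positive lower bound on \<open>[x, y]\<close>, so the interval
  carries mass of \<open>Gam t\<close> even where \<open>\<mu>(t)\<close> has none.\<close>

lemma GG_strict_mono:
  assumes xy: "x < y" shows "GG x < GG y"
proof -
  interpret F: finite_measure "Gam t" by (rule finite_Gam[OF t])
  obtain m where m: "m > 0" "\<And>z. z \<in> {x..y} \<Longrightarrow> m \<le> p z" by (rule p_lower_bound[of x y]) blast
  have "(LINT z:{x..<y}|lborel. m) \<le> (LINT z:{x..<y}|lborel. p z)"
  proof (rule set_integral_mono)
    show "set_integrable lborel {x..<y} (\<lambda>z. m)"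
      by (rule set_integrable_bounded_real[where L="\<bar>m\<bar>"]) (use xy in auto)
    show "set_integrable lborel {x..<y} p"
      unfolding set_integrable_def
      using integrable_real_mult_indicator[OF _ pHS_integrable[OF t n], of "{x..<y}"] by (simp add: mult.commute)
  qed (use m in auto)
  moreover have "(LINT z:{x..<y}|lborel. m) = m * (y - x)" using xy by (subst set_integral_const) auto
  ultimately have "0 < (LINT z:{x..<y}|lborel. p z)" using m xy by (smt (verit) mult_pos_pos)
  moreover have "measure (Gam t) {x..<y} = (LINT z:{x..<y}|lborel. p z) + measure (\<mu> t) {x..<y}"
    by (rule measure_Gam[OF t]) simp
  ultimately have pos: "0 < measure (Gam t) {x..<y}"
    using measure_nonneg[of "\<mu> t" "{x..<y}"] by linarith
  have "measure (Gam t) ({..<x} \<union> {x..<y}) = measure (Gam t) {..<x} + measure (Gam t) {x..<y}"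
    by (rule F.finite_measure_Union) (auto simp: sets_Gam)
  moreover have "{..<x} \<union> {x..<y} = {..<y}" using xy by force
  ultimately have "measure (Gam t) {..<y} = measure (Gam t) {..<x} + measure (Gam t) {x..<y}" by (simp only:)
  then show ?thesis using pos unfolding measure_Gam_lessThan[OF t] by simp
qed

text \<open>Without atoms open and closed half-lines have the same mass, so \<open>G\<close> is
  continuous and its generalised inverse is a right inverse.\<close>

lemma GG_chi:
  assumes e: "0 < \<eta>" "\<eta> < NN" shows "GG (chi \<eta>) = \<eta>"
proof (rule antisym)
  show "\<eta> \<le> GG (chi \<eta>)" using chi_gt_iff[OF t e, of "chi \<eta>"] unfolding Gam_atMost by simp
  show "GG (chi \<eta>) \<le> \<eta>"
    unfolding measure_Gam_lessThan[OF t, symmetric]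
  proof (rule measure_lessThan_limit[OF finite_Gam[OF t] sets_Gam _ zero_less_one])
    fix d :: real assume "0 < d" "d \<le> 1"
    then show "measure (Gam t) {..chi \<eta> - d} \<le> \<eta>" using chi_gt_iff[OF t e, of "chi \<eta> - d"] by simp
  qed
qed

lemma GG_range: "0 < GG x" "GG x < NN"
proof -
  have "0 \<le> GG (x - 1)" unfolding measure_Gam_lessThan[OF t, symmetric] by simp
  then show "0 < GG x" using GG_strict_mono[of "x - 1" x] by simp
  have "GG (x + 1) \<le> measure (Gam t) UNIV" unfolding measure_Gam_lessThan[OF t, symmetric]
    by (rule finite_measure.finite_measure_mono[OF finite_Gam[OF t]]) (auto simp: sets_Gam)
  then show "GG x < NN" using GG_strict_mono[of x "x + 1"] unfolding measure_Gam_UNIV[OF t] by simp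
qed

lemma chi_strict_mono:
  assumes "0 < \<eta>" "\<eta> < \<eta>'" "\<eta>' < NN" shows "chi \<eta> < chi \<eta>'"
proof (rule ccontr)
  assume "\<not> chi \<eta> < chi \<eta>'"
  then have "GG (chi \<eta>') \<le> GG (chi \<eta>)" by (intro GHS_mono t n) simp
  then show False using assms by (simp add: GG_chi)
qed

lemma chi_less_of:
  assumes "0 < \<eta>" "\<eta> < NN"
  shows "\<eta> < GG x \<Longrightarrow> chi \<eta> < x" and "GG x < \<eta> \<Longrightarrow> x < chi \<eta>"
proof -
  show "chi \<eta> < x" if "\<eta> < GG x"
  proof (rule ccontr)
    assume "\<not> chi \<eta> < x"
    then have "GG x \<le> GG (chi \<eta>)" by (intro GHS_mono t n) simp
    then show False using assms that by (simp add: GG_chi)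
  qed
  show "x < chi \<eta>" if "GG x < \<eta>"
  proof (rule ccontr)
    assume "\<not> x < chi \<eta>"
    then have "GG (chi \<eta>) \<le> GG x" by (intro GHS_mono t n) simp
    then show False using assms that by (simp add: GG_chi)
  qed
qed

lemma chi_near:
  assumes e: "0 < \<eta>" "\<eta> < NN" and r: "r > 0"
  obtains d where "d > 0" "\<And>\<eta>'. \<bar>\<eta>' - \<eta>\<bar> < d \<Longrightarrow> 0 < \<eta>' \<and> \<eta>' < NN \<and> \<bar>chi \<eta>' - chi \<eta>\<bar> < r"
proof -
  define x where "x = chi \<eta>"
  have G: "GG (x - r) < \<eta>" "\<eta> < GG (x + r)"
    using GG_strict_mono[of "x - r" x] GG_strict_mono[of x "x + r"] GG_chi[OF e] r unfolding x_def by auto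
  define d where "d = min (\<eta> - GG (x - r)) (GG (x + r) - \<eta>)"
  show thesis
  proof (rule that[of d])
    show "d > 0" unfolding d_def using G by simp
    fix \<eta>' assume a: "\<bar>\<eta>' - \<eta>\<bar> < d"
    then have b: "GG (x - r) < \<eta>'" "\<eta>' < GG (x + r)" unfolding d_def by linarith+
    then have c: "0 < \<eta>'" "\<eta>' < NN" using GG_range[of "x - r"] GG_range[of "x + r"] by linarith+
    show "0 < \<eta>' \<and> \<eta>' < NN \<and> \<bar>chi \<eta>' - chi \<eta>\<bar> < r"
      using chi_less_of(1)[OF c b(2)] chi_less_of(2)[OF c b(1)] c unfolding x_def by linarith
  qed
qed

lemma chi0_eq: "0 < \<eta> \<Longrightarrow> \<eta> < NN \<Longrightarrow> chi0 t \<eta> = chi \<eta>"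
  unfolding chi0_def by simp

lemma chi0_continuous: "continuous_on {0<..<NN} (chi0 t)"
  unfolding continuous_on_iff
proof (intro ballI allI impI)
  fix \<eta> r :: real assume e: "\<eta> \<in> {0<..<NN}" and r: "0 < r"
  then have e': "0 < \<eta>" "\<eta> < NN" by auto
  obtain d where "d > 0" "\<And>\<eta>'. \<bar>\<eta>' - \<eta>\<bar> < d \<Longrightarrow> 0 < \<eta>' \<and> \<eta>' < NN \<and> \<bar>chi \<eta>' - chi \<eta>\<bar> < r"
    by (rule chi_near[OF e' r]) blast
  then show "\<exists>d>0. \<forall>x'\<in>{0<..<NN}. dist x' \<eta> < d \<longrightarrow> dist (chi0 t x') (chi0 t \<eta>) < r"
    using e' by (intro exI[of _ d]) (auto simp: chi0_eq dist_real_def)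
qed

lemma deriv_chi0:
  assumes e: "\<eta> \<in> {0<..<NN}" shows "deriv (chi0 t) \<eta> = deriv chi \<eta>"
proof (rule deriv_cong_ev[OF _ refl])
  have "\<forall>\<^sub>F x in nhds \<eta>. x \<in> {0<..<NN}" by (rule eventually_nhds_in_open[OF _ e]) simp
  then show "\<forall>\<^sub>F x in nhds \<eta>. chi0 t x = chi x" by eventually_elim (simp add: chi0_def)
qed

lemma deriv_chi_meas: "(\<lambda>\<eta>. indicator {0<..<NN} \<eta> * deriv chi \<eta>) \<in> borel_measurable borel"
proof -
  have "(\<lambda>\<eta>. indicator {0<..<NN} \<eta> * deriv (chi0 t) \<eta>) \<in> borel_measurable borel"
    by (rule borel_measurable_deriv[OF _ chi0_continuous chi0_meas[OF t]]) simp
  moreover have "indicator {0<..<NN} \<eta> * deriv (chi0 t) \<eta> = indicator {0<..<NN} \<eta> * deriv chi \<eta>" for \<eta> :: real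
    by (cases "\<eta> \<in> {0<..<NN}") (auto simp: deriv_chi0)
  ultimately show ?thesis by (simp only:)
qed

text \<open>A line of slope about \<open>u0\<close> through \<open>chi (\<eta> + k)\<close> at time
  \<open>t\<close> starts with the value \<open>\<eta> + k\<close> of \<open>G\<close>, which
  changes by about \<open>h0 * s\<close> until time \<open>t + s\<close>. For \<open>k\<close> near
  \<open>- h0 * s\<close> it arrives near \<eta>, so the line ends near
  \<open>chiHS n \<mu> (t + s) \<eta>\<close>. Two choices of \<open>k\<close> enclose this value,
  and \<open>d\<close> turns \<open>chi (\<eta> + k)\<close> into \<open>x0 + d * k\<close>.\<close>

lemma chi_time_derivative:
  assumes e: "0 < \<eta>" "\<eta> < NN" and d: "(chi has_real_derivative d) (at \<eta>)"
  defines "x0 \<equiv> chi \<eta>"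
  defines "u0 \<equiv> u t x0" and "h0 \<equiv> \<integral>y. (u t x0 - u t y) * Kn n (y - x0) \<partial>\<mu> t"
  shows "((\<lambda>s. (chiHS n \<mu> (t + s) \<eta> - chi \<eta>) / s) \<longlongrightarrow> u0 - h0 * d) (at 0 within {s. 0 \<le> t + s})"
proof (rule tendstoI)
  fix e0 :: real assume "e0 > 0"
  \<comment> \<open>Collects the errors in units of \<open>\<epsilon> * \<bar>s\<bar>\<close>:
    \<open>\<bar>h0\<bar> + 2 * \<epsilon>\<close> from linearising \<open>chi\<close>,
    \<open>2 * \<bar>d\<bar>\<close> from the offset in \<open>k\<close>, \<open>1\<close> from the
    slope; \<open>\<epsilon> \<le> 1\<close> keeps the sum below \<open>A\<close>.\<close>
  define A where "A = 2 * \<bar>d\<bar> + \<bar>h0\<bar> + 4"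
  have "A > 0" unfolding A_def by simp
  define \<epsilon> where "\<epsilon> = min 1 (e0 / A) / 2"
  have eps: "\<epsilon> > 0" "\<epsilon> \<le> 1" "\<epsilon> * A < e0"
  proof -
    show "\<epsilon> > 0" "\<epsilon> \<le> 1" unfolding \<epsilon>_def using \<open>e0 > 0\<close> \<open>A > 0\<close> by auto
    have q: "0 < e0 / A" using \<open>e0 > 0\<close> \<open>A > 0\<close> by simp
    have "\<epsilon> \<le> (e0 / A) / 2" unfolding \<epsilon>_def by (rule divide_right_mono) simp_all
    also have "\<dots> < e0 / A" using half_gt_zero[OF q] field_sum_of_halves[of "e0 / A"] by linarith
    finally have "\<epsilon> < e0 / A" .
    then show "\<epsilon> * A < e0" using \<open>A > 0\<close> by (simp add: pos_less_divide_eq)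
  qed
  obtain \<rho> where rho: "\<rho> > 0" "\<And>t1 t2 x. 0 \<le> t1 \<Longrightarrow> t1 \<le> t2 \<Longrightarrow> \<bar>t1 - t\<bar> < \<rho> \<Longrightarrow> \<bar>t2 - t\<bar> < \<rho> \<Longrightarrow> \<bar>x - x0\<bar> < \<rho> \<Longrightarrow>
       GHS n \<mu> t1 x + (h0 - \<epsilon>) * (t2 - t1) \<le> GHS n \<mu> t2 (x + (u0 + \<epsilon>) * (t2 - t1)) \<and>
       GHS n \<mu> t2 (x + (u0 - \<epsilon>) * (t2 - t1)) \<le> GHS n \<mu> t1 x + (h0 + \<epsilon>) * (t2 - t1)"
    unfolding u0_def h0_def by (rule GHS_local[OF t n eps(1), of x0]) blast
  have "\<rho> / 2 > 0" using rho(1) by simp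
  obtain d1 where d1: "d1 > 0" "\<And>\<eta>'. \<bar>\<eta>' - \<eta>\<bar> < d1 \<Longrightarrow> 0 < \<eta>' \<and> \<eta>' < NN \<and> \<bar>chi \<eta>' - x0\<bar> < \<rho> / 2"
    unfolding x0_def by (rule chi_near[OF e \<open>\<rho> / 2 > 0\<close>]) blast
  have "((\<lambda>k. (chi (\<eta> + k) - chi \<eta>) / k) \<longlongrightarrow> d) (at 0)" using d unfolding DERIV_def .
  then have "\<forall>\<^sub>F k in at 0. dist ((chi (\<eta> + k) - chi \<eta>) / k) d < \<epsilon>" using eps(1) by (rule tendstoD)
  then obtain d2 where d2: "d2 > 0" "\<And>k. k \<noteq> 0 \<Longrightarrow> \<bar>k\<bar> < d2 \<Longrightarrow> \<bar>(chi (\<eta> + k) - x0) / k - d\<bar> < \<epsilon>"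
    unfolding eventually_at x0_def by (auto simp: dist_real_def)
  have lin: "\<bar>chi (\<eta> + k) - x0 - d * k\<bar> \<le> \<epsilon> * \<bar>k\<bar>" if "\<bar>k\<bar> < d2" for k
  proof (cases "k = 0")
    case False
    have "chi (\<eta> + k) - x0 - d * k = ((chi (\<eta> + k) - x0) / k - d) * k" using False by (simp add: field_simps)
    then have "\<bar>chi (\<eta> + k) - x0 - d * k\<bar> = \<bar>(chi (\<eta> + k) - x0) / k - d\<bar> * \<bar>k\<bar>" by (simp add: abs_mult)
    also have "\<dots> \<le> \<epsilon> * \<bar>k\<bar>" using d2(2)[OF False that] by (intro mult_right_mono) auto
    finally show ?thesis .
  qed (simp add: x0_def)
  define V where "V = \<bar>h0\<bar> + 2 * \<epsilon> + \<bar>u0\<bar> + 1"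
  have V: "V \<ge> 1" "\<bar>h0\<bar> + 2 * \<epsilon> \<le> V" "\<bar>u0\<bar> + \<epsilon> \<le> V" unfolding V_def using eps by auto
  \<comment> \<open>For \<open>\<bar>s\<bar> < \<sigma>\<close> both offsets \<open>k\<close> are
    smaller than \<open>d1\<close> and \<open>d2\<close>, and moving along a line uses at most half
    of \<rho>; the other half is for the distance of \<open>chi (\<eta> + k)\<close> from
    \<open>x0\<close>.\<close>
  define \<sigma> where "\<sigma> = min (min d1 d2) (\<rho> / 2) / (V + 1)"
  have sig: "\<sigma> > 0" unfolding \<sigma>_def using d1(1) d2(1) rho(1) V by simp
  have sV: "V * \<bar>s\<bar> < min (min d1 d2) (\<rho> / 2)" "\<bar>s\<bar> < \<rho> / 2" if "\<bar>s\<bar> < \<sigma>" for s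
  proof -
    have "V * \<bar>s\<bar> + \<bar>s\<bar> = (V + 1) * \<bar>s\<bar>" by (simp add: algebra_simps)
    also have "\<dots> < (V + 1) * \<sigma>" using that V by simp
    also have "\<dots> = min (min d1 d2) (\<rho> / 2)" unfolding \<sigma>_def using V by simp
    finally have *: "V * \<bar>s\<bar> + \<bar>s\<bar> < min (min d1 d2) (\<rho> / 2)" .
    have "0 \<le> V * \<bar>s\<bar>" using V by simp
    then show "V * \<bar>s\<bar> < min (min d1 d2) (\<rho> / 2)" "\<bar>s\<bar> < \<rho> / 2" using * by linarith+
  qed
  have est: "\<bar>chiHS n \<mu> (t + s) \<eta> - x0 - (u0 - h0 * d) * s\<bar> \<le> \<epsilon> * A * \<bar>s\<bar>"
    if s: "\<bar>s\<bar> < \<sigma>" "s \<noteq> 0" "0 \<le> t + s" for s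
  proof -
    \<comment> \<open>One half of \<open>2 * \<epsilon> * \<bar>s\<bar>\<close> pays for the
      uncertainty of the growth rate; the other carries \<open>G\<close> past \<eta>, strictly so
      where \<open>chi_ge\<close> asks for it.\<close>
    define kp where "kp = - h0 * s + 2 * \<epsilon> * \<bar>s\<bar>"
    define km where "km = - h0 * s - 2 * \<epsilon> * \<bar>s\<bar>"
    have hs: "\<bar>h0 * s\<bar> = \<bar>h0\<bar> * \<bar>s\<bar>" by (rule abs_mult)
    have es: "0 < \<epsilon> * \<bar>s\<bar>" using eps s by simp
    have kb: "\<bar>kp\<bar> \<le> (\<bar>h0\<bar> + 2 * \<epsilon>) * \<bar>s\<bar>" "\<bar>km\<bar> \<le> (\<bar>h0\<bar> + 2 * \<epsilon>) * \<bar>s\<bar>"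
      unfolding kp_def km_def using hs es by (simp_all add: distrib_right abs_le_iff) linarith+
    have "(\<bar>h0\<bar> + 2 * \<epsilon>) * \<bar>s\<bar> \<le> V * \<bar>s\<bar>" using V by (intro mult_right_mono) auto
    then have ks: "\<bar>kp\<bar> < d1" "\<bar>kp\<bar> < d2" "\<bar>km\<bar> < d1" "\<bar>km\<bar> < d2" using kb sV(1)[OF s(1)] by linarith+
    have np: "0 < \<eta> + kp" "\<eta> + kp < NN" "\<bar>chi (\<eta> + kp) - x0\<bar> < \<rho> / 2" using d1(2)[of "\<eta> + kp"] ks by auto
    have nm: "0 < \<eta> + km" "\<eta> + km < NN" "\<bar>chi (\<eta> + km) - x0\<bar> < \<rho> / 2" using d1(2)[of "\<eta> + km"] ks by auto
    have cs: "\<bar>c * s\<bar> < \<rho> / 2" if "\<bar>c\<bar> \<le> V" for c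
    proof -
      have "\<bar>c * s\<bar> \<le> V * \<bar>s\<bar>" unfolding abs_mult using that by (intro mult_right_mono) auto
      then show ?thesis using sV(1)[OF s(1)] by linarith
    qed
    have cV: "\<bar>u0 + \<epsilon>\<bar> \<le> V" "\<bar>u0 - \<epsilon>\<bar> \<le> V" using V eps by linarith+
    have bounds: "chiHS n \<mu> (t + s) \<eta> \<le> chi (\<eta> + kp) + u0 * s + \<epsilon> * \<bar>s\<bar> \<and>
        chi (\<eta> + km) + u0 * s - \<epsilon> * \<bar>s\<bar> \<le> chiHS n \<mu> (t + s) \<eta>"
    proof (cases "s > 0")
      case True
      have r1: "\<bar>t + s - t\<bar> < \<rho>" "\<bar>t - t\<bar> < \<rho>" "t \<le> t + s" using sV(2)[OF s(1)] rho(1) True by auto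
      have "\<bar>chi (\<eta> + kp) - x0\<bar> < \<rho>" "\<bar>chi (\<eta> + km) - x0\<bar> < \<rho>" using np nm rho(1) by linarith+
      note R = rho(2)[OF t r1(3,2,1) this(1)] rho(2)[OF t r1(3,2,1) this(2)]
      have "\<eta> + kp + (h0 - \<epsilon>) * s \<le> GHS n \<mu> (t + s) (chi (\<eta> + kp) + (u0 + \<epsilon>) * s)"
        using R(1) GG_chi[OF np(1,2)] by simp
      moreover have "\<eta> + kp + (h0 - \<epsilon>) * s = \<eta> + \<epsilon> * s" unfolding kp_def using True by (simp add: algebra_simps)
      ultimately have "\<eta> \<le> GHS n \<mu> (t + s) (chi (\<eta> + kp) + (u0 + \<epsilon>) * s)" using es True by simp
      from chi_le[OF s(3) e(1) this]
      have up: "chiHS n \<mu> (t + s) \<eta> \<le> chi (\<eta> + kp) + (u0 + \<epsilon>) * s" .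
      have "GHS n \<mu> (t + s) (chi (\<eta> + km) + (u0 - \<epsilon>) * s) \<le> \<eta> + km + (h0 + \<epsilon>) * s"
        using R(2) GG_chi[OF nm(1,2)] by simp
      moreover have "\<eta> + km + (h0 + \<epsilon>) * s = \<eta> - \<epsilon> * s" unfolding km_def using True by (simp add: algebra_simps)
      ultimately have "GHS n \<mu> (t + s) (chi (\<eta> + km) + (u0 - \<epsilon>) * s) < \<eta>" using es True by simp
      from chi_ge[OF s(3) e(2) this]
      have "chi (\<eta> + km) + (u0 - \<epsilon>) * s \<le> chiHS n \<mu> (t + s) \<eta>" .
      then show ?thesis using up True by (simp add: algebra_simps)
    next
      case False
      then have sn: "s < 0" using s(2) by simp
      have r1: "\<bar>t + s - t\<bar> < \<rho>" "\<bar>t - t\<bar> < \<rho>" "t + s \<le> t" using sV(2)[OF s(1)] rho(1) sn by auto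
      have ts: "t - (t + s) = - s" by simp
      \<comment> \<open>For \<open>s < 0\<close> the lines run from \<open>t + s\<close> to
        \<open>t\<close>. Their starting points are chosen so that they end at
        \<open>chi (\<eta> + kp)\<close> and \<open>chi (\<eta> + km)\<close>, where
        \<open>G\<close> is known; the two slopes exchange roles.\<close>
      define xp where "xp = chi (\<eta> + kp) + (u0 - \<epsilon>) * s"
      define xm where "xm = chi (\<eta> + km) + (u0 + \<epsilon>) * s"
      have "\<bar>xp - x0\<bar> < \<rho>" "\<bar>xm - x0\<bar> < \<rho>"
        unfolding xp_def xm_def using np(3) nm(3) cs[OF cV(1)] cs[OF cV(2)] by linarith+
      note R = rho(2)[OF s(3) r1(3,1,2) this(1)] rho(2)[OF s(3) r1(3,1,2) this(2)]
      have "GG (xp + (u0 - \<epsilon>) * (- s)) \<le> GHS n \<mu> (t + s) xp + (h0 + \<epsilon>) * (- s)" using R(1) unfolding ts by blast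
      moreover have "xp + (u0 - \<epsilon>) * (- s) = chi (\<eta> + kp)" unfolding xp_def by simp
      ultimately have "\<eta> + kp + (h0 + \<epsilon>) * s \<le> GHS n \<mu> (t + s) xp" using GG_chi[OF np(1,2)] by simp
      moreover have "\<eta> + kp + (h0 + \<epsilon>) * s = \<eta> - \<epsilon> * s" unfolding kp_def using sn by (simp add: algebra_simps)
      ultimately have "\<eta> \<le> GHS n \<mu> (t + s) xp" using es sn by simp
      from chi_le[OF s(3) e(1) this] have up: "chiHS n \<mu> (t + s) \<eta> \<le> xp" .
      have "GHS n \<mu> (t + s) xm + (h0 - \<epsilon>) * (- s) \<le> GG (xm + (u0 + \<epsilon>) * (- s))" using R(2) unfolding ts by blast
      moreover have "xm + (u0 + \<epsilon>) * (- s) = chi (\<eta> + km)" unfolding xm_def by simp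
      ultimately have "GHS n \<mu> (t + s) xm \<le> \<eta> + km + (h0 - \<epsilon>) * s" using GG_chi[OF nm(1,2)] by simp
      moreover have "\<eta> + km + (h0 - \<epsilon>) * s = \<eta> + \<epsilon> * s" unfolding km_def using sn by (simp add: algebra_simps)
      ultimately have "GHS n \<mu> (t + s) xm < \<eta>" using es sn by simp
      from chi_ge[OF s(3) e(2) this] have "xm \<le> chiHS n \<mu> (t + s) \<eta>" .
      then show ?thesis using up sn unfolding xp_def xm_def by (simp add: algebra_simps)
    qed
    have lp: "\<bar>chi (\<eta> + kp) - x0 - d * kp\<bar> \<le> \<epsilon> * ((\<bar>h0\<bar> + 2 * \<epsilon>) * \<bar>s\<bar>)"
      using lin[OF ks(2)] mult_left_mono[OF kb(1), of \<epsilon>] eps(1) by linarith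
    have lm: "\<bar>chi (\<eta> + km) - x0 - d * km\<bar> \<le> \<epsilon> * ((\<bar>h0\<bar> + 2 * \<epsilon>) * \<bar>s\<bar>)"
      using lin[OF ks(4)] mult_left_mono[OF kb(2), of \<epsilon>] eps(1) by linarith
    have dk: "d * kp = - h0 * d * s + d * (2 * \<epsilon> * \<bar>s\<bar>)" "d * km = - h0 * d * s - d * (2 * \<epsilon> * \<bar>s\<bar>)"
      unfolding kp_def km_def by (simp_all add: algebra_simps)
    have "\<bar>d * (2 * \<epsilon> * \<bar>s\<bar>)\<bar> = \<bar>d\<bar> * (2 * \<epsilon> * \<bar>s\<bar>)" using eps(1) by (simp add: abs_mult)
    then have dd: "d * (2 * \<epsilon> * \<bar>s\<bar>) \<le> \<bar>d\<bar> * (2 * \<epsilon> * \<bar>s\<bar>)" "- (\<bar>d\<bar> * (2 * \<epsilon> * \<bar>s\<bar>)) \<le> d * (2 * \<epsilon> * \<bar>s\<bar>)" by linarith+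
    have usd: "(u0 - h0 * d) * s = u0 * s - h0 * d * s" by (simp add: algebra_simps)
    have "\<bar>chiHS n \<mu> (t + s) \<eta> - x0 - (u0 - h0 * d) * s\<bar> \<le> \<epsilon> * ((\<bar>h0\<bar> + 2 * \<epsilon>) * \<bar>s\<bar>) + \<bar>d\<bar> * (2 * \<epsilon> * \<bar>s\<bar>) + \<epsilon> * \<bar>s\<bar>"
      using bounds lp lm dk dd usd by (simp only: abs_le_iff) linarith
    also have "\<dots> = \<epsilon> * \<bar>s\<bar> * (\<bar>h0\<bar> + 2 * \<epsilon> + 2 * \<bar>d\<bar> + 1)" by (simp add: algebra_simps)
    also have "\<dots> \<le> \<epsilon> * \<bar>s\<bar> * A" unfolding A_def using eps es by (intro mult_left_mono) auto
    finally show ?thesis by (simp add: mult_ac)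
  qed
  show "\<forall>\<^sub>F s in at 0 within {s. 0 \<le> t + s}. dist ((chiHS n \<mu> (t + s) \<eta> - chi \<eta>) / s) (u0 - h0 * d) < e0"
    unfolding eventually_at
  proof (intro exI[of _ \<sigma>] conjI ballI impI)
    fix s assume "s \<in> {s. 0 \<le> t + s}" and a: "s \<noteq> 0 \<and> dist s 0 < \<sigma>"
    then have s: "\<bar>s\<bar> < \<sigma>" "s \<noteq> 0" "0 \<le> t + s" by auto
    have "(chiHS n \<mu> (t + s) \<eta> - chi \<eta>) / s - (u0 - h0 * d) = (chiHS n \<mu> (t + s) \<eta> - x0 - (u0 - h0 * d) * s) / s"
      using s(2) unfolding x0_def by (simp add: field_simps)
    then have "\<bar>(chiHS n \<mu> (t + s) \<eta> - chi \<eta>) / s - (u0 - h0 * d)\<bar> =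
        \<bar>chiHS n \<mu> (t + s) \<eta> - x0 - (u0 - h0 * d) * s\<bar> / \<bar>s\<bar>"
      by (simp only: abs_divide)
    also have "\<dots> \<le> \<epsilon> * A * \<bar>s\<bar> / \<bar>s\<bar>" by (rule divide_right_mono[OF est[OF s] abs_ge_zero])
    also have "\<dots> < e0" using eps(3) s(2) by simp
    finally show "dist ((chiHS n \<mu> (t + s) \<eta> - chi \<eta>) / s) (u0 - h0 * d) < e0" by (simp add: dist_real_def)
  qed (rule sig)
qed

text \<open>Since \<open>pmeas t \<le> Gam t\<close>, the Radon-Nikodym density is at most
  \<open>1\<close> almost everywhere; truncating it makes the bounds hold at every point.
  Subtraction then shows that \<open>\<mu> t\<close> has density \<open>1 - r\<close>.\<close>

lemma pmeas_density:
  obtains r where "r \<in> borel_measurable borel" "\<And>x. 0 \<le> r x" "\<And>x. r x \<le> 1"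
    "pmeas t = density (Gam t) (\<lambda>x. ennreal (r x))" "\<mu> t = density (Gam t) (\<lambda>x. ennreal (1 - r x))"
proof -
  interpret F: finite_measure "Gam t" by (rule finite_Gam[OF t])
  have le: "emeasure (pmeas t) A \<le> emeasure (Gam t) A" if "A \<in> sets borel" for A
    unfolding emeasure_Gam[OF t that] by simp
  have "absolutely_continuous (Gam t) (pmeas t)"
    unfolding absolutely_continuous_def null_sets_def
    using le by (auto simp: sets_Gam sets_pmeas intro: le_zero_eq[THEN iffD1] simp del: le_zero_eq) (metis le_zero_eq)
  then obtain f where f: "f \<in> borel_measurable (Gam t)" "density (Gam t) f = pmeas t"
    using F.Radon_Nikodym[of "pmeas t"] by (auto simp: sets_Gam sets_pmeas)
  have fm[measurable]: "f \<in> borel_measurable borel" using f(1) measurable_cong_sets[OF sets_Gam refl] by blast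
  \<comment> \<open>On \<open>B\<close> the density exceeds \<open>1\<close> by a fixed margin, so
    positive mass of \<open>B\<close> would give \<open>pmeas t\<close> more mass there than
    \<open>Gam t\<close>.\<close>
  have "AE x in Gam t. f x \<le> 1 + ennreal (1 / real (Suc k))" for k
  proof -
    define B where "B = {x. \<not> f x \<le> 1 + ennreal (1 / real (Suc k))}"
    have Bm: "B \<in> sets borel" unfolding B_def by measurable
    have "(1 + ennreal (1 / real (Suc k))) * emeasure (Gam t) B = (\<integral>\<^sup>+x\<in>B. (1 + ennreal (1 / real (Suc k))) \<partial>Gam t)"
      using Bm by (simp add: nn_integral_cmult_indicator sets_Gam)
    also have "\<dots> \<le> (\<integral>\<^sup>+x\<in>B. f x \<partial>Gam t)"
      by (intro nn_integral_mono) (auto simp: B_def indicator_def)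
    also have "\<dots> = emeasure (pmeas t) B"
      unfolding f(2)[symmetric] using Bm f(1) by (simp add: emeasure_density sets_Gam)
    also have "\<dots> \<le> emeasure (Gam t) B" by (rule le[OF Bm])
    finally have "measure (Gam t) B + 1 / real (Suc k) * measure (Gam t) B \<le> measure (Gam t) B"
      unfolding F.emeasure_eq_measure
      by (simp add: distrib_right ennreal_mult[symmetric] ennreal_plus[symmetric] del: ennreal_plus of_nat_Suc)
    then have "measure (Gam t) B = 0" using measure_nonneg[of "Gam t" B] by (simp add: field_simps mult_le_0_iff)
    then have "B \<in> null_sets (Gam t)" using Bm by (simp add: null_sets_def F.emeasure_eq_measure sets_Gam)
    then show ?thesis using AE_not_in by (fastforce simp: B_def)
  qed
  then have "AE x in Gam t. \<forall>k. f x \<le> 1 + ennreal (1 / real (Suc k))" unfolding AE_all_countable by blast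
  then have f1: "AE x in Gam t. f x \<le> 1"
  proof eventually_elim
    case (elim x)
    have "(\<lambda>k. 1 + ennreal (1 / real (Suc k))) \<longlonglongrightarrow> 1 + ennreal 0"
      by (intro tendsto_add tendsto_const tendsto_ennrealI lim_const_over_n[THEN LIMSEQ_Suc])
    then show ?case using elim by (intro LIMSEQ_le_const[of _ _ "f x"]) auto
  qed
  define r where "r x = enn2real (min 1 (f x))" for x
  have r: "r \<in> borel_measurable borel" unfolding r_def by measurable
  have er: "ennreal (r x) = min 1 (f x)" for x unfolding r_def by (simp add: ennreal_enn2real min.strict_coboundedI1)
  have r01: "0 \<le> r x" "r x \<le> 1" for x
  proof -
    show "0 \<le> r x" unfolding r_def by simp
    have "ennreal (r x) \<le> ennreal 1" unfolding er by simp
    then show "r x \<le> 1" by (simp only: ennreal_le_iff zero_le_one)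
  qed
  have pd: "pmeas t = density (Gam t) (\<lambda>x. ennreal (r x))"
    unfolding f(2)[symmetric] er
  proof (rule density_cong)
    show "AE x in Gam t. f x = min 1 (f x)" using f1 by eventually_elim (simp add: min_def)
  qed (use f(1) in measurable)
  have rG: "r \<in> borel_measurable (Gam t)" using r measurable_cong_sets[OF sets_Gam refl] by blast
  have "\<mu> t = density (Gam t) (\<lambda>x. ennreal (1 - r x))"
  proof (rule measure_eqI)
    show "sets (\<mu> t) = sets (density (Gam t) (\<lambda>x. ennreal (1 - r x)))" by (simp add: sets_mu[OF t] sets_Gam)
    fix A assume "A \<in> sets (\<mu> t)"
    then have A: "A \<in> sets borel" by (simp add: sets_mu[OF t])
    have [measurable]: "A \<in> sets (Gam t)" "r \<in> borel_measurable (Gam t)" using A rG by (simp_all add: sets_Gam)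
    have "emeasure (pmeas t) A + emeasure (\<mu> t) A = (\<integral>\<^sup>+x. indicator A x \<partial>Gam t)"
      using emeasure_Gam[OF t A] A by (simp add: sets_Gam)
    also have "\<dots> = (\<integral>\<^sup>+x. ennreal (r x) * indicator A x + ennreal (1 - r x) * indicator A x \<partial>Gam t)"
      using r01 by (intro nn_integral_cong) (auto simp: indicator_def ennreal_plus[symmetric] simp del: ennreal_plus)
    also have "\<dots> = emeasure (pmeas t) A + (\<integral>\<^sup>+x. ennreal (1 - r x) * indicator A x \<partial>Gam t)"
      unfolding pd by (subst nn_integral_add) (auto simp: emeasure_density)
    finally have "emeasure (\<mu> t) A = (\<integral>\<^sup>+x. ennreal (1 - r x) * indicator A x \<partial>Gam t)"
      using emeasure_pmeas[OF t A] by (simp add: ennreal_add_left_cancel)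
    then show "emeasure (\<mu> t) A = emeasure (density (Gam t) (\<lambda>x. ennreal (1 - r x))) A"
      by (simp add: emeasure_density)
  qed
  with r r01 pd show thesis by (intro that[of r])
qed

end

section \<open>The derivative of \<chi> in \<eta> and the two expressions for
  \<open>h\<close>\<close>

context measure_transport_atomless
begin

text \<open>Changing variables by \<chi> gives the integral of \<open>r / p\<close> over
  \<open>J = [chi x, chi y]\<close> with respect to \<open>Gam t\<close>. The factor
  \<open>r\<close> turns this measure into \<open>p dx\<close> and \<open>1 / p\<close> turns that
  into Lebesgue measure, which leaves the length of \<open>J\<close>.\<close>

lemma chi_increment:
  assumes r: "r \<in> borel_measurable borel" "\<And>x. 0 \<le> r x" "pmeas t = density (Gam t) (\<lambda>x. ennreal (r x))"
    and xy: "0 < x" "x \<le> y" "y < NN"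
  shows "chi y - chi x = (LINT \<eta>:{x..y}|lborel. r (chi0 t \<eta>) / p (chi0 t \<eta>))"
proof -
  note [measurable] = r(1) chi0_meas[OF t]
  have rG[measurable]: "r \<in> borel_measurable (Gam t)" using r(1) measurable_cong_sets[OF sets_Gam refl] by blast
  have le: "chi x \<le> chi y" by (rule chi_mono[OF t xy])
  define J where "J = {chi x..chi y}"
  have Jm[measurable]: "J \<in> sets borel" unfolding J_def by simp
  \<comment> \<open>Strict monotonicity of \<open>chi\<close> makes \<open>[x, y]\<close> exactly
    the preimage of \<open>J\<close> in \<open>(0, NN)\<close>.\<close>
  have mem: "\<eta> \<in> {x..y} \<longleftrightarrow> \<eta> \<in> {0<..<NN} \<and> chi0 t \<eta> \<in> J" for \<eta>
  proof
    assume "\<eta> \<in> {x..y}"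
    then have "0 < \<eta>" "\<eta> < NN" "x \<le> \<eta>" "\<eta> \<le> y" using xy by auto
    then show "\<eta> \<in> {0<..<NN} \<and> chi0 t \<eta> \<in> J"
      using chi_mono[OF t xy(1), of \<eta>] chi_mono[OF t _ _ xy(3), of \<eta>] by (simp add: chi0_eq J_def)
  next
    assume a: "\<eta> \<in> {0<..<NN} \<and> chi0 t \<eta> \<in> J"
    then have b: "0 < \<eta>" "\<eta> < NN" "chi x \<le> chi \<eta>" "chi \<eta> \<le> chi y" by (auto simp: chi0_eq J_def)
    have "x \<le> \<eta>" using chi_strict_mono[of \<eta> x] b xy by force
    moreover have "\<eta> \<le> y" using chi_strict_mono[of y \<eta>] b xy by force
    ultimately show "\<eta> \<in> {x..y}" by simp
  qed
  have "(\<integral>\<^sup>+\<eta>. ennreal (indicator {x..y} \<eta> * (r (chi0 t \<eta>) / p (chi0 t \<eta>))) \<partial>lborel)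
     = (\<integral>\<^sup>+\<eta>\<in>{0<..<NN}. (indicator J (chi0 t \<eta>) * ennreal (r (chi0 t \<eta>) / p (chi0 t \<eta>))) \<partial>lborel)"
    using mem by (intro nn_integral_cong) (auto simp: indicator_def)
  also have "\<dots> = (\<integral>\<^sup>+\<xi>. indicator J \<xi> * ennreal (r \<xi> / p \<xi>) \<partial>Gam t)"
    by (rule nn_integral_chi0_Gam[OF t]) measurable
  also have "\<dots> = (\<integral>\<^sup>+\<xi>. ennreal (r \<xi>) * (indicator J \<xi> * ennreal (1 / p \<xi>)) \<partial>Gam t)"
  proof (rule nn_integral_cong)
    fix \<xi>
    have "ennreal (r \<xi> / p \<xi>) = ennreal (r \<xi>) * ennreal (1 / p \<xi>)"
      using r(2)[of \<xi>] p_pos[of \<xi>] by (subst ennreal_mult[symmetric]) auto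
    then show "indicator J \<xi> * ennreal (r \<xi> / p \<xi>) = ennreal (r \<xi>) * (indicator J \<xi> * ennreal (1 / p \<xi>))"
      by (simp add: mult_ac)
  qed
  also have "\<dots> = (\<integral>\<^sup>+\<xi>. indicator J \<xi> * ennreal (1 / p \<xi>) \<partial>pmeas t)"
    unfolding r(3)
  proof (rule nn_integral_density[symmetric])
    have "(\<lambda>\<xi>. indicator J \<xi> * ennreal (1 / p \<xi>)) \<in> borel_measurable borel" by measurable
    then show "(\<lambda>\<xi>. indicator J \<xi> * ennreal (1 / p \<xi>)) \<in> borel_measurable (Gam t)"
      using measurable_cong_sets[OF sets_Gam refl] by blast
  qed measurable
  also have "\<dots> = (\<integral>\<^sup>+\<xi>. ennreal (p \<xi>) * (indicator J \<xi> * ennreal (1 / p \<xi>)) \<partial>lborel)"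
    unfolding pmeas_def by (rule nn_integral_density) measurable
  also have "\<dots> = (\<integral>\<^sup>+\<xi>. indicator J \<xi> \<partial>lborel)"
  proof (rule nn_integral_cong)
    fix \<xi>
    have "ennreal (p \<xi>) * ennreal (1 / p \<xi>) = 1"
      using p_pos[of \<xi>] by (subst ennreal_mult[symmetric]) auto
    then show "ennreal (p \<xi>) * (indicator J \<xi> * ennreal (1 / p \<xi>)) = indicator J \<xi>"
      by (simp add: indicator_def)
  qed
  also have "\<dots> = ennreal (chi y - chi x)" using le unfolding J_def by simp
  finally have nn: "(\<integral>\<^sup>+\<eta>. ennreal (indicator {x..y} \<eta> * (r (chi0 t \<eta>) / p (chi0 t \<eta>))) \<partial>lborel) = ennreal (chi y - chi x)" .
  have "(LINT \<eta>:{x..y}|lborel. r (chi0 t \<eta>) / p (chi0 t \<eta>)) = enn2real (ennreal (chi y - chi x))"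
    unfolding set_lebesgue_integral_def real_scaleR_def nn[symmetric]
  proof (rule integral_eq_nn_integral)
    show "AE \<eta> in lborel. 0 \<le> indicator {x..y} \<eta> * (r (chi0 t \<eta>) / p (chi0 t \<eta>))"
      using r(2) p_pos by (intro AE_I2 mult_nonneg_nonneg divide_nonneg_nonneg) (auto intro: less_imp_le)
  qed measurable
  then show ?thesis using le by simp
qed

text \<open>On \<open>[a, b]\<close> the values of \<open>chi\<close> stay in a compact interval, on
  which \<open>p\<close> has a positive lower bound; this makes the density bounded, as
  \<open>AE_has_derivative_of_bounded\<close> requires. Towards the ends of \<open>(0, NN)\<close>
  such a bound may fail.\<close>

lemma AE_chi_derivative_Icc:
  assumes r: "r \<in> borel_measurable borel" "\<And>x. 0 \<le> r x" "\<And>x. r x \<le> 1" "pmeas t = density (Gam t) (\<lambda>x. ennreal (r x))"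
    and ab: "0 < a" "a \<le> b" "b < NN"
  shows "AE \<eta> in lborel. \<eta> \<in> {a<..<b} \<longrightarrow> (chi has_real_derivative r (chi \<eta>) / p (chi \<eta>)) (at \<eta>)"
proof -
  note [measurable] = r(1) chi0_meas[OF t]
  obtain m where m: "m > 0" "\<And>x. x \<in> {chi a..chi b} \<Longrightarrow> m \<le> p x" by (rule p_lower_bound[of "chi a" "chi b"]) blast
  define g where "g \<eta> = indicator {a..b} \<eta> * (r (chi0 t \<eta>) / p (chi0 t \<eta>))" for \<eta>
  have gm[measurable]: "g \<in> borel_measurable borel" unfolding g_def by measurable
  have gb: "\<bar>g \<eta>\<bar> \<le> 1 / m" for \<eta>
  proof (cases "\<eta> \<in> {a..b}")
    case True
    then have e: "0 < \<eta>" "\<eta> < NN" using ab by auto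
    then have "chi \<eta> \<in> {chi a..chi b}"
      using chi_mono[OF t ab(1), of \<eta>] chi_mono[OF t _ _ ab(3), of \<eta>] True by auto
    then have mp: "m \<le> p (chi \<eta>)" by (rule m(2))
    have "r (chi \<eta>) / p (chi \<eta>) \<le> 1 / m" using r(2,3)[of "chi \<eta>"] mp m(1) by (intro frac_le) auto
    moreover have "0 \<le> r (chi \<eta>) / p (chi \<eta>)" using r(2)[of "chi \<eta>"] p_pos[of "chi \<eta>"] by simp
    ultimately show ?thesis using True e unfolding g_def by (simp add: chi0_eq)
  qed (use m in \<open>simp add: g_def\<close>)
  have gi: "integrable lborel g"
  proof -
    have "set_integrable lborel {a..b} g"
      by (rule set_integrable_bounded_real[where L="1 / m"]) (use gb in \<open>auto simp: emeasure_lborel_Icc_eq\<close>)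
    moreover have "(\<lambda>\<eta>. indicator {a..b} \<eta> *\<^sub>R g \<eta>) = g" by (auto simp: g_def indicator_def)
    ultimately show ?thesis unfolding set_integrable_def by simp
  qed
  define f where "f y = (LINT \<eta>:{..y}|lborel. g \<eta>)" for y
  have fg: "f y - f x = (LINT \<eta>:{x..y}|lborel. g \<eta>)" if "x \<le> y" for x y
  proof -
    have si: "set_integrable lborel S g" if "S \<in> sets borel" for S
      unfolding set_integrable_def using integrable_real_mult_indicator[OF _ gi, of S] that by (simp add: mult.commute)
    have "(LINT \<eta>:{..x} \<union> {x<..y}|lborel. g \<eta>) = (LINT \<eta>:{..x}|lborel. g \<eta>) + (LINT \<eta>:{x<..y}|lborel. g \<eta>)"
      by (rule set_integral_Un) (auto intro!: si)
    moreover have "{..x} \<union> {x<..y} = {..y}" using that by auto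
    moreover have "(LINT \<eta>:{x<..y}|lborel. g \<eta>) = (LINT \<eta>:{x..y}|lborel. g \<eta>)"
      by (rule set_integral_discrete_difference[where X="{x}"]) auto
    ultimately show ?thesis unfolding f_def by simp
  qed
  have "AE \<eta> in lborel. (f has_real_derivative g \<eta>) (at \<eta>)"
    by (rule AE_has_derivative_of_bounded[OF gm gb fg])
  then show ?thesis
  proof eventually_elim
    case (elim \<eta>)
    show ?case
    proof
      assume e: "\<eta> \<in> {a<..<b}"
      have "((\<lambda>y. chi a + (f y - f a)) has_real_derivative g \<eta>) (at \<eta>)"
        using elim by (auto intro!: derivative_eq_intros)
      then have "(chi has_real_derivative g \<eta>) (at \<eta>)"
      proof (rule has_field_derivative_transform_within_open[OF _ open_greaterThanLessThan e])
        fix y assume y: "y \<in> {a<..<b}"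
        then have "a \<le> y" "y < NN" using ab by auto
        have "f y - f a = (LINT \<eta>:{a..y}|lborel. r (chi0 t \<eta>) / p (chi0 t \<eta>))"
          unfolding fg[OF \<open>a \<le> y\<close>]
          by (rule set_lebesgue_integral_cong) (use y in \<open>auto simp: g_def\<close>)
        also have "\<dots> = chi y - chi a"
          by (rule chi_increment[symmetric, OF r(1,2,4) ab(1) \<open>a \<le> y\<close> \<open>y < NN\<close>])
        finally show "chi a + (f y - f a) = chi y" by simp
      qed
      moreover have "g \<eta> = r (chi \<eta>) / p (chi \<eta>)" using e ab by (simp add: g_def chi0_eq)
      ultimately show "(chi has_real_derivative r (chi \<eta>) / p (chi \<eta>)) (at \<eta>)" by simp
    qed
  qed
qed

lemma AE_chi_derivative:
  assumes r: "r \<in> borel_measurable borel" "\<And>x. 0 \<le> r x" "\<And>x. r x \<le> 1" "pmeas t = density (Gam t) (\<lambda>x. ennreal (r x))"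
  shows "AE \<eta> in lborel. \<eta> \<in> {0<..<NN} \<longrightarrow> (chi has_real_derivative r (chi \<eta>) / p (chi \<eta>)) (at \<eta>)"
proof -
  \<comment> \<open>The offset \<open>3\<close> gives \<open>d k \<le> NN / 2\<close>, so that the
    ends of the subinterval are in order from \<open>k = 0\<close> on.\<close>
  define d where "d k = NN / real (k + 3)" for k :: nat
  have d: "0 < d k" "d k \<le> NN - d k" "NN - d k < NN" for k
  proof -
    show 1: "0 < d k" unfolding d_def using NN_pos by simp
    have "d k \<le> NN / 2" unfolding d_def using NN_pos by (intro divide_left_mono) auto
    then show "d k \<le> NN - d k" "NN - d k < NN" using 1 by auto
  qed
  have "AE \<eta> in lborel. \<forall>k. \<eta> \<in> {d k<..<NN - d k} \<longrightarrow> (chi has_real_derivative r (chi \<eta>) / p (chi \<eta>)) (at \<eta>)"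
    unfolding AE_all_countable using AE_chi_derivative_Icc[OF r d] by blast
  then show ?thesis
  proof eventually_elim
    case (elim \<eta>)
    show ?case
    proof
      assume e: "\<eta> \<in> {0<..<NN}"
      define q where "q = min \<eta> (NN - \<eta>) / NN"
      have "q > 0" unfolding q_def using e NN_pos by simp
      then obtain k :: nat where k: "1 / real (Suc k) < q" by (rule nat_approx_posE)
      have "d k \<le> NN * (1 / real (Suc k))" unfolding d_def using NN_pos by (simp add: frac_le)
      also have "\<dots> < NN * q" by (rule mult_strict_left_mono[OF k NN_pos])
      also have "\<dots> = min \<eta> (NN - \<eta>)" unfolding q_def using NN_pos by simp
      finally have "\<eta> \<in> {d k<..<NN - d k}" by auto
      then show "(chi has_real_derivative r (chi \<eta>) / p (chi \<eta>)) (at \<eta>)" using elim by blast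
    qed
  qed
qed

lemma AE_chi_differentiable:
  "AE \<eta> in lborel. \<eta> \<in> {0<..<NN} \<longrightarrow> (chi has_real_derivative deriv chi \<eta>) (at \<eta>)"
proof -
  obtain r where r: "r \<in> borel_measurable borel" "\<And>x. 0 \<le> r x" "\<And>x. r x \<le> 1"
    "pmeas t = density (Gam t) (\<lambda>x. ennreal (r x))" by (rule pmeas_density) blast
  from AE_chi_derivative[OF r] show ?thesis
    by eventually_elim (metis DERIV_imp_deriv)
qed

text \<open>Almost everywhere \<open>p (chi \<eta>) * deriv chi \<eta> = r (chi \<eta>)\<close>, so
  the weight is \<open>1 - r\<close> composed with \<open>chi\<close>; after the change of variables
  it turns \<open>Gam t\<close> into \<open>\<mu> t\<close>.\<close>

lemma integral_chi:
  assumes f[measurable]: "f \<in> borel_measurable borel"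
  shows "(LINT \<eta>:{0..NN}|lborel. f (chi \<eta>) * (1 - p (chi \<eta>) * deriv chi \<eta>)) = (\<integral>x. f x \<partial>\<mu> t)"
proof -
  obtain r where r: "r \<in> borel_measurable borel" "\<And>x. 0 \<le> r x" "\<And>x. r x \<le> 1"
    "pmeas t = density (Gam t) (\<lambda>x. ennreal (r x))" "\<mu> t = density (Gam t) (\<lambda>x. ennreal (1 - r x))" by (rule pmeas_density) blast
  note [measurable] = r(1) chi0_meas[OF t] deriv_chi_meas
  have toG: "h \<in> borel_measurable (Gam t)" if "h \<in> borel_measurable borel" for h :: "real \<Rightarrow> real"
    using that measurable_cong_sets[OF sets_Gam refl] by blast
  have cm: "chi0 t \<in> measurable Leta borel" unfolding measurable_cong_sets[OF sets_Leta refl] by (rule chi0_meas[OF t])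
  let ?I = "{0<..<NN}"
  have "(LINT \<eta>:{0..NN}|lborel. f (chi \<eta>) * (1 - p (chi \<eta>) * deriv chi \<eta>)) =
    (LINT \<eta>:?I|lborel. f (chi \<eta>) * (1 - p (chi \<eta>) * deriv chi \<eta>))"
    by (rule set_integral_discrete_difference[where X="{0, NN}"]) (use NN_pos in auto)
  \<comment> \<open>\<open>chi0\<close> and the indicator in front of \<open>deriv chi\<close> are
    the forms known to be Borel.\<close>
  also have "\<dots> = (\<integral>\<eta>. indicator ?I \<eta> * (f (chi0 t \<eta>) * (1 - p (chi0 t \<eta>) * (indicator ?I \<eta> * deriv chi \<eta>))) \<partial>lborel)"
    unfolding set_lebesgue_integral_def
    by (rule Bochner_Integration.integral_cong) (auto simp: indicator_def chi0_eq)
  also have "\<dots> = (\<integral>\<eta>. indicator ?I \<eta> * ((1 - r (chi0 t \<eta>)) * f (chi0 t \<eta>)) \<partial>lborel)"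
  proof (rule integral_cong_AE)
    show "AE \<eta> in lborel. indicator ?I \<eta> * (f (chi0 t \<eta>) * (1 - p (chi0 t \<eta>) * (indicator ?I \<eta> * deriv chi \<eta>))) =
       indicator ?I \<eta> * ((1 - r (chi0 t \<eta>)) * f (chi0 t \<eta>))"
      using AE_chi_derivative[OF r(1-4)]
    proof eventually_elim
      case (elim \<eta>)
      show ?case
      proof (cases "\<eta> \<in> ?I")
        case True
        then have "deriv chi \<eta> = r (chi \<eta>) / p (chi \<eta>)" using elim by (auto intro: DERIV_imp_deriv)
        then have "p (chi \<eta>) * deriv chi \<eta> = r (chi \<eta>)" using p_pos[of "chi \<eta>"] by simp
        then show ?thesis using True by (simp add: chi0_eq mult.commute)
      qed simp
    qed
  qed measurable
  also have "\<dots> = (\<integral>\<eta>. (1 - r (chi0 t \<eta>)) * f (chi0 t \<eta>) \<partial>Leta)"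
  proof -
    have "Leta = density lborel (\<lambda>\<eta>. ennreal (indicator ?I \<eta>))"
      unfolding Leta_def by (simp add: ennreal_indicator)
    then show ?thesis by (simp add: integral_density)
  qed
  also have "\<dots> = (\<integral>x. (1 - r x) * f x \<partial>Gam t)"
    unfolding distr_chi0[OF t, symmetric] by (rule integral_distr[symmetric, OF cm]) measurable
  also have "\<dots> = (\<integral>x. f x \<partial>\<mu> t)"
    unfolding r(5) by (subst integral_density) (use r(3) in \<open>auto intro!: toG\<close>)
  finally show ?thesis .
qed

text \<open>The product of \<open>UHS\<close> and \<open>PHS\<close> is \<open>u t x\<close> times
  the integral of the kernel, by definition of \<open>p\<close>; \<open>integral_chi\<close>
  rewrites the integral over \<eta>' as the integral of \<open>u t y * Kn n (y - x)\<close>.\<close>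

lemma hHS_eq:
  assumes e: "0 < \<eta>" "\<eta> < NN"
  shows "hHS n u \<mu> t \<eta> = (\<integral>y. (u t (chi \<eta>) - u t y) * Kn n (y - chi \<eta>) \<partial>\<mu> t)"
proof -
  define x where "x = chi \<eta>"
  obtain M where M: "M \<ge> 0" "\<And>s y. s \<in> {0..t} \<Longrightarrow> \<bar>u s y\<bar> \<le> M" using u_bound[of t] by blast
  note [measurable] = u_meas[OF t]
  have i: "integrable (\<mu> t) (\<lambda>y. u t y * Kn n (y - x))"
  proof (rule integrable_mu[OF t])
    show "\<bar>u t y * Kn n (y - x)\<bar> \<le> M * 1" for y
      unfolding abs_mult using M t Kn_abs by (intro mult_mono) auto
  qed measurable
  have "(LINT \<eta>':{0..NN}|lborel. UHS n u \<mu> t \<eta>' * Kn n (chi \<eta> - chi \<eta>') * (1 - PHS n \<mu> t \<eta>' * chi_eta n \<mu> t \<eta>'))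
     = (LINT \<eta>':{0..NN}|lborel. (\<lambda>y. u t y * Kn n (y - x)) (chi \<eta>') * (1 - p (chi \<eta>') * deriv chi \<eta>'))"
    unfolding UHS_def PHS_def chi_eta_def x_def by (simp add: Kn_commute[of n "chi \<eta>"])
  also have "\<dots> = (\<integral>y. u t y * Kn n (y - x) \<partial>\<mu> t)"
    by (rule integral_chi) measurable
  finally have "hHS n u \<mu> t \<eta> = u t x * (\<integral>y. Kn n (y - x) \<partial>\<mu> t) - (\<integral>y. u t y * Kn n (y - x) \<partial>\<mu> t)"
    unfolding hHS_def by (simp only: UHS_def PHS_def x_def[symmetric] pHS_eq)
  also have "\<dots> = (\<integral>y. u t x * Kn n (y - x) - u t y * Kn n (y - x) \<partial>\<mu> t)"
    by (subst Bochner_Integration.integral_diff[OF integrable_mult_right[OF Kn_shift_integrable[OF t]] i]) simp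
  finally show ?thesis unfolding x_def by (simp add: left_diff_distrib)
qed

lemma chi_time_derivative_hHS:
  assumes e: "0 < \<eta>" "\<eta> < NN" and d: "(chi has_real_derivative deriv chi \<eta>) (at \<eta>)"
  shows "((\<lambda>s. (chiHS n \<mu> (t + s) \<eta> - chi \<eta>) / s) \<longlongrightarrow> UHS n u \<mu> t \<eta> - hHS n u \<mu> t \<eta> * chi_eta n \<mu> t \<eta>)
    (at 0 within {s. 0 \<le> t + s})"
  using chi_time_derivative[OF e d] unfolding UHS_def hHS_eq[OF e] chi_eta_def .

text \<open>The integral defining \<open>h\<close> depends on \<eta> only through
  \<open>chi\<close>; \<open>hHS_eq\<close> exhibits it as a Borel function \<open>q\<close>
  composed with \<open>chi\<close>.\<close>

lemma chi_time_rhs_meas: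
  "(\<lambda>\<eta>. indicator {0<..<NN} \<eta> * (UHS n u \<mu> t \<eta> - hHS n u \<mu> t \<eta> * chi_eta n \<mu> t \<eta>)) \<in> borel_measurable borel"
proof -
  note [measurable] = u_meas[OF t] chi0_meas[OF t] deriv_chi_meas
  obtain M where M: "M \<ge> 0" "\<And>s y. s \<in> {0..t} \<Longrightarrow> \<bar>u s y\<bar> \<le> M" using u_bound[of t] by blast
  define q where "q x = u t x * p x - (\<integral>y. u t y * Kn n (y - x) \<partial>\<mu> t)" for x
  interpret M: finite_measure "\<mu> t" by (rule finite_mu[OF t])
  have s': "sets (borel \<Otimes>\<^sub>M \<mu> t) = sets (borel \<Otimes>\<^sub>M borel)"
    by (intro sets_pair_measure_cong sets_mu[OF t] refl)
  have "(\<lambda>(x, y). u t y * Kn n (y - x)) \<in> borel_measurable (borel \<Otimes>\<^sub>M borel)" by measurable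
  then have "(\<lambda>(x, y). u t y * Kn n (y - x)) \<in> borel_measurable (borel \<Otimes>\<^sub>M \<mu> t)"
    using measurable_cong_sets[OF s' refl] by blast
  then have "(\<lambda>x. \<integral>y. u t y * Kn n (y - x) \<partial>\<mu> t) \<in> borel_measurable borel"
    by (rule M.borel_measurable_lebesgue_integral)
  then have qm[measurable]: "q \<in> borel_measurable borel" unfolding q_def by measurable
  have hq: "hHS n u \<mu> t \<eta> = q (chi \<eta>)" if "0 < \<eta>" "\<eta> < NN" for \<eta>
  proof -
    have i: "integrable (\<mu> t) (\<lambda>y. u t y * Kn n (y - x))" for x
    proof (rule integrable_mu[OF t])
      show "\<bar>u t y * Kn n (y - x)\<bar> \<le> M * 1" for y
        unfolding abs_mult using M t Kn_abs by (intro mult_mono) auto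
    qed measurable
    show ?thesis
      unfolding hHS_eq[OF that] q_def pHS_eq left_diff_distrib
      by (subst Bochner_Integration.integral_diff[OF integrable_mult_right[OF Kn_shift_integrable[OF t]] i]) simp
  qed
  have "(\<lambda>\<eta>. indicator {0<..<NN} \<eta> * (u t (chi0 t \<eta>) - q (chi0 t \<eta>) * (indicator {0<..<NN} \<eta> * deriv chi \<eta>))) \<in> borel_measurable borel"
    by measurable
  moreover have "indicator {0<..<NN} \<eta> * (u t (chi0 t \<eta>) - q (chi0 t \<eta>) * (indicator {0<..<NN} \<eta> * deriv chi \<eta>)) =
     indicator {0<..<NN} \<eta> * (UHS n u \<mu> t \<eta> - hHS n u \<mu> t \<eta> * chi_eta n \<mu> t \<eta>)" for \<eta> :: real
    by (cases "\<eta> \<in> {0<..<NN}") (auto simp: chi0_eq hq UHS_def chi_eta_def)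
  ultimately show ?thesis by (simp only:)
qed

end

section \<open>Convergence in \<open>L\<^sup>\<gamma>\<close>\<close>

text \<open>Drops the endpoints, at which \<open>chiHS\<close> has no meaningful value, from every
  norm.\<close>

lemma nn_integral_Icc_eq_Ioo:
  fixes f :: "real \<Rightarrow> ennreal"
  shows "(\<integral>\<^sup>+x\<in>{a..b}. f x \<partial>lborel) = (\<integral>\<^sup>+x\<in>{a<..<b}. f x \<partial>lborel)"
proof (rule nn_integral_cong_AE)
  show "AE x in lborel. f x * indicator {a..b} x = f x * indicator {a<..<b} x"
    using AE_lborel_singleton[of a] AE_lborel_singleton[of b]
    by eventually_elim (auto simp: indicator_def)
qed

lemma set_borel_measurable_Icc_of_Ioo:
  fixes f :: "real \<Rightarrow> real"
  assumes [measurable]: "(\<lambda>x. indicator {a<..<b} x * f x) \<in> borel_measurable borel"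
  shows "set_borel_measurable lborel {a..b} f"
proof -
  have "(\<lambda>x. if x = a then indicator {a..b} a * f a else if x = b then indicator {a..b} b * f b else indicator {a<..<b} x * f x) \<in> borel_measurable borel"
    by measurable
  moreover have "(if x = a then indicator {a..b} a * f a else if x = b then indicator {a..b} b * f b else indicator {a<..<b} x * f x)
      = indicator {a..b} x * f x" for x
    by (auto simp: indicator_def)
  ultimately show ?thesis unfolding set_borel_measurable_def by simp
qed

text \<open>From \<open>\<bar>g\<bar> \<le> 1 + g\<^sup>2\<close> the oscillation of
  \<open>f\<close> over a unit interval is at most \<open>D\<close>. If
  \<open>\<bar>f x\<bar>\<close> exceeded \<open>D + (1 + E)\<close>, then
  \<open>f\<^sup>2 \<ge> 1 + E\<close> on \<open>[x, x + 1]\<close>, which is more than its total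
  integral \<open>E\<close> allows.\<close>

lemma H1_bounded:
  assumes "H1 f" obtains B where "\<And>x. \<bar>f x\<bar> \<le> B"
proof -
  obtain g where f: "L2 f" and g: "L2 g"
    and fg: "\<And>x y. x \<le> y \<Longrightarrow> set_integrable lborel {x..y} g \<and> f y - f x = (LINT s:{x..y}|lborel. g s)"
    using assms unfolding H1_def by blast
  have f2: "integrable lborel (\<lambda>x. (f x)\<^sup>2)" and g2: "integrable lborel (\<lambda>x. (g x)\<^sup>2)"
    using f g unfolding L2_def by auto
  define D where "D = 1 + (\<integral>x. (g x)\<^sup>2 \<partial>lborel)"
  define E where "E = (\<integral>x. (f x)\<^sup>2 \<partial>lborel)"
  have sub: "set_integrable lborel S h" if "integrable lborel h" "S \<in> sets borel" for S and h :: "real \<Rightarrow> real"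
    unfolding set_integrable_def using integrable_real_mult_indicator[OF _ that(1), of S] that(2) by (simp add: mult.commute)
  have osc: "\<bar>f y - f x\<bar> \<le> D" if "x \<le> y" "y \<le> x + 1" for x y
  proof -
    have si1: "set_integrable lborel {x..y} (\<lambda>s. 1 :: real)"
      by (rule set_integrable_bounded_real[where L=1]) (auto simp: emeasure_lborel_Icc_eq)
    have si2: "set_integrable lborel {x..y} (\<lambda>s. (g s)\<^sup>2)" by (rule sub[OF g2]) simp
    have "\<bar>g s\<bar> \<le> 1 + (g s)\<^sup>2" for s
    proof -
      have "0 \<le> (\<bar>g s\<bar> - 1)\<^sup>2" by simp
      then have "2 * \<bar>g s\<bar> \<le> 1 + (g s)\<^sup>2" by (simp add: power2_diff)
      then show ?thesis by simp
    qed
    then have "\<bar>LINT s:{x..y}|lborel. g s\<bar> \<le> (LINT s:{x..y}|lborel. 1 + (g s)\<^sup>2)"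
      using fg[OF that(1)] set_integral_add(1)[OF si1 si2]
      unfolding set_lebesgue_integral_def set_integrable_def real_norm_def[symmetric]
      by (intro Bochner_Integration.integral_norm_bound_integral) (auto simp: indicator_def)
    also have "\<dots> = (LINT s:{x..y}|lborel. 1) + (LINT s:{x..y}|lborel. (g s)\<^sup>2)"
      by (rule set_integral_add(2)[OF si1 si2])
    also have "\<dots> \<le> 1 + (\<integral>x. (g x)\<^sup>2 \<partial>lborel)"
    proof (rule add_mono)
      show "(LINT s:{x..y}|lborel. 1 :: real) \<le> 1" using that by (subst set_integral_const) (auto simp: emeasure_lborel_Icc_eq)
      show "(LINT s:{x..y}|lborel. (g s)\<^sup>2) \<le> (\<integral>x. (g x)\<^sup>2 \<partial>lborel)"
        using si2 unfolding set_lebesgue_integral_def set_integrable_def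
        by (intro integral_mono g2) (auto simp: indicator_def)
    qed
    finally show ?thesis using fg[OF that(1)] unfolding D_def by simp
  qed
  have E0: "E \<ge> 0" unfolding E_def by simp
  have "\<bar>f x\<bar> \<le> D + (1 + E)" for x
  proof (rule ccontr)
    assume "\<not> \<bar>f x\<bar> \<le> D + (1 + E)"
    then have big: "1 + E \<le> \<bar>f y\<bar>" if "x \<le> y" "y \<le> x + 1" for y using osc[OF that] by linarith
    have sq: "1 + E \<le> (f y)\<^sup>2" if "x \<le> y" "y \<le> x + 1" for y
    proof -
      have "(1 + E) * 1 \<le> (1 + E) * (1 + E)" using E0 by (intro mult_left_mono) auto
      also have "\<dots> \<le> \<bar>f y\<bar> * \<bar>f y\<bar>" using big[OF that] E0 by (intro mult_mono) auto
      finally show ?thesis by (simp add: power2_eq_square)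
    qed
    have si1: "set_integrable lborel {x..x+1} (\<lambda>s. 1 + E)"
      by (rule set_integrable_bounded_real[where L="\<bar>1 + E\<bar>"]) (auto simp: emeasure_lborel_Icc_eq)
    have si2: "set_integrable lborel {x..x+1} (\<lambda>s. (f s)\<^sup>2)" by (rule sub[OF f2]) simp
    have "(LINT s:{x..x+1}|lborel. 1 + E) \<le> (LINT s:{x..x+1}|lborel. (f s)\<^sup>2)"
      by (rule set_integral_mono[OF si1 si2]) (use sq in auto)
    moreover have "(LINT s:{x..x+1}|lborel. 1 + E) = 1 + E"
      by (subst set_integral_const) (auto simp: emeasure_lborel_Icc_eq)
    moreover have "(LINT s:{x..x+1}|lborel. (f s)\<^sup>2) \<le> E"
      using si2 unfolding set_lebesgue_integral_def set_integrable_def E_def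
      by (intro integral_mono f2) (auto simp: indicator_def)
    ultimately show False by linarith
  qed
  then show thesis by (rule that)
qed

text \<open>The bound for \<open>u\<close> combines two conditions: \<open>u(0)\<close> is bounded
  as an element of \<open>E\<^sub>2\<close>, and Hoelder continuity in time carries the bound to
  \<open>[0, T]\<close>.\<close>

lemma measure_transport_of_solution:
  assumes psi: "cutoff_pair \<psi>p \<psi>m" and sol: "HS_weak_conservative \<psi>p \<psi>m u \<mu>"
  shows "measure_transport \<psi>p u \<mu>"
proof (rule measure_transport.intro)
  note S = sol[unfolded HS_weak_conservative_def]
  note step = cutoff_pair_step[OF psi]
  show "smooth1 \<psi>p" "\<And>x. x \<le> - 1 \<Longrightarrow> \<psi>p x = 0" "\<And>x. 1 \<le> x \<Longrightarrow> \<psi>p x = 1" "\<And>x. 0 \<le> \<psi>p x" "\<And>x. \<psi>p x \<le> 1"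
    by (fact step)+
  have s: "\<And>t. 0 \<le> t \<Longrightarrow> sets (\<mu> t) = sets borel" and fi: "\<And>t. 0 \<le> t \<Longrightarrow> emeasure (\<mu> t) UNIV < \<infinity>"
    using S by blast+
  show "\<And>t. 0 \<le> t \<Longrightarrow> sets (\<mu> t) = sets borel" by (fact s)
  show "finite_measure (\<mu> t)" if "0 \<le> t" for t
    by (rule finite_measureI) (use fi[OF that] sets_eq_imp_space_eq[OF s[OF that]] in auto)
  have H: "\<exists>\<alpha> M. 0 < \<alpha> \<and> \<alpha> \<le> 1 \<and> (\<forall>t\<in>{0..T}. \<forall>s\<in>{0..T}. \<forall>x y. \<bar>u t x - u s y\<bar> \<le> M * (sqrt ((t - s)\<^sup>2 + (x - y)\<^sup>2)) powr \<alpha>)"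
    if "T > 0" for T using S that by blast
  show "uniformly_continuous_on ({0..T} \<times> UNIV) (\<lambda>(t, x). u t x)" if T: "T > 0" for T
    unfolding uniformly_continuous_on_def
  proof (intro allI impI)
    fix e :: real assume e: "e > 0"
    obtain \<alpha> M where a: "0 < \<alpha>" and M: "\<And>t s x y. t \<in> {0..T} \<Longrightarrow> s \<in> {0..T} \<Longrightarrow> \<bar>u t x - u s y\<bar> \<le> M * (sqrt ((t - s)\<^sup>2 + (x - y)\<^sup>2)) powr \<alpha>"
      using H[OF T] by blast
    \<comment> \<open>\<open>M\<close> is an arbitrary real; \<open>\<bar>M\<bar> + 1\<close> is a
      positive constant to divide by.\<close>
    obtain k :: real where ep: "0 < k" and qe: "(\<bar>M\<bar> + 1) * k = e"
      by (rule that[of "e / (\<bar>M\<bar> + 1)"]) (use e in auto)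
    define d where "d = k powr (1 / \<alpha>)"
    have "d > 0" unfolding d_def using ep by simp
    have "dist ((\<lambda>(t, x). u t x) q) ((\<lambda>(t, x). u t x) r) < e"
      if q: "q \<in> {0..T} \<times> UNIV" and r: "r \<in> {0..T} \<times> UNIV" and dd: "dist q r < d" for q r
    proof -
      obtain t x where qq: "q = (t, x)" "t \<in> {0..T}" using q by auto
      obtain s' y where rr: "r = (s', y)" "s' \<in> {0..T}" using r by auto
      define w where "w = sqrt ((t - s')\<^sup>2 + (x - y)\<^sup>2)"
      have "w = dist q r" unfolding w_def qq rr dist_Pair_Pair by (simp add: dist_real_def)
      then have w: "0 \<le> w" "w < d" using dd by auto
      have "w powr \<alpha> < d powr \<alpha>" using w a by (intro powr_less_mono2) auto
      also have "d powr \<alpha> = k" unfolding d_def using a ep by (simp add: powr_powr)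
      finally have wa: "w powr \<alpha> < k" .
      have "\<bar>u t x - u s' y\<bar> \<le> M * w powr \<alpha>" unfolding w_def by (rule M[OF qq(2) rr(2)])
      also have "\<dots> \<le> (\<bar>M\<bar> + 1) * w powr \<alpha>" by (intro mult_right_mono) auto
      also have "\<dots> < (\<bar>M\<bar> + 1) * k" using wa by (intro mult_strict_left_mono) auto
      also have "\<dots> = e" by (rule qe)
      finally show ?thesis unfolding qq rr by (simp add: dist_real_def)
    qed
    then show "\<exists>d>0. \<forall>x\<in>{0..T} \<times> UNIV. \<forall>x'\<in>{0..T} \<times> UNIV. dist x' x < d \<longrightarrow>
        dist (case x' of (t, x) \<Rightarrow> u t x) (case x of (t, x) \<Rightarrow> u t x) < e"
      using \<open>d > 0\<close> by blast
  qed
  have "inE2 \<psi>p \<psi>m (u 0)" using S by simp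
  then obtain fb a b where fb: "H1 fb" "\<And>x. u 0 x = fb x + a * \<psi>p x + b * \<psi>m x" unfolding inE2_def by blast
  obtain B where B: "\<And>x. \<bar>fb x\<bar> \<le> B" using H1_bounded[OF fb(1)] by blast
  have u0: "\<bar>u 0 x\<bar> \<le> B + \<bar>a\<bar> + \<bar>b\<bar>" for x
  proof -
    have "\<bar>\<psi>p x\<bar> \<le> 1" "\<bar>\<psi>m x\<bar> \<le> 1" using psi unfolding cutoff_pair_def by auto
    then have "\<bar>a * \<psi>p x\<bar> \<le> \<bar>a\<bar> * 1" "\<bar>b * \<psi>m x\<bar> \<le> \<bar>b\<bar> * 1"
      unfolding abs_mult by (simp_all only: mult_left_mono abs_ge_zero)
    then show ?thesis unfolding fb(2) using B[of x] by linarith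
  qed
  show "\<exists>M. \<forall>t\<in>{0..T}. \<forall>x. \<bar>u t x\<bar> \<le> M" if T: "T > 0" for T
  proof -
    obtain \<alpha> M where a: "0 < \<alpha>" and M: "\<And>t s x y. t \<in> {0..T} \<Longrightarrow> s \<in> {0..T} \<Longrightarrow> \<bar>u t x - u s y\<bar> \<le> M * (sqrt ((t - s)\<^sup>2 + (x - y)\<^sup>2)) powr \<alpha>"
      using H[OF T] by blast
    have "\<bar>u t x\<bar> \<le> B + \<bar>a\<bar> + \<bar>b\<bar> + \<bar>M\<bar> * T powr \<alpha>" if t: "t \<in> {0..T}" for t x
    proof -
      have "\<bar>u t x - u 0 x\<bar> \<le> M * t powr \<alpha>" using M[OF t, of 0 x x] t T by simp
      also have "\<dots> \<le> \<bar>M\<bar> * T powr \<alpha>" using t a by (intro mult_mono powr_mono2) auto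
      finally show ?thesis using u0[of x] by linarith
    qed
    then show ?thesis by blast
  qed
  show "continuous_on {0..} (\<lambda>t. \<integral>x. f x \<partial>\<mu> t)" if "continuous_on UNIV f" "bounded (range f)" for f :: "real \<Rightarrow> real"
    using S that by blast
  show "(LINT t:{0..}|lborel. (\<integral>x. deriv (\<lambda>s. \<phi> s x) t + u t x * deriv (\<lambda>y. \<phi> t y) x \<partial>\<mu> t)) = - (\<integral>x. \<phi> 0 x \<partial>\<mu> 0)"
    if "test_fun \<phi>" for \<phi>
    using S that by blast
qed

text \<open>\<open>f\<close> is arbitrary. Either its set function is a measure and assigns to a
  point an integral over a null set, or \<open>density\<close> falls back to the zero measure. Thus
  atomless times come from condition (v) without a proof that \<open>deriv (u t)\<close> is
  measurable.\<close>

lemma density_lborel_singleton: "measure (density lborel f) {x :: real} = 0"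
proof -
  have "emeasure (density lborel f) {x} = 0"
  proof (cases "measure_space UNIV (sigma_sets UNIV (sets borel)) (\<lambda>A. \<integral>\<^sup>+y. f y * indicator A y \<partial>lborel)")
    case True
    have "(\<integral>\<^sup>+y. f y * indicator {x} y \<partial>lborel) = (\<integral>\<^sup>+y. 0 \<partial>(lborel :: real measure))"
      by (rule nn_integral_cong_AE) (use AE_lborel_singleton[of x] in eventually_elim, simp)
    then show ?thesis unfolding density_def by (simp add: emeasure_measure_of_conv)
  next
    case False
    then show ?thesis unfolding density_def by (simp add: emeasure_measure_of_conv)
  qed
  then show ?thesis by (simp add: measure_def)
qed

section \<open>Integrability and continuity of \<chi> in \<open>L\<^sup>\<gamma>\<close>\<close>

context measure_transport_kernel
begin

lemma chi_dist:
  assumes M: "\<And>s y. s \<in> {0..T} \<Longrightarrow> \<bar>u s y\<bar> \<le> M" and st: "s \<in> {0..T}" "t \<in> {0..T}" and e: "0 < \<eta>" "\<eta> < NN"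
  shows "\<bar>chiHS n \<mu> s \<eta> - chiHS n \<mu> t \<eta>\<bar> \<le> M * \<bar>s - t\<bar>"
proof (cases "s \<le> t")
  case True
  have "\<bar>chiHS n \<mu> t \<eta> - chiHS n \<mu> s \<eta>\<bar> \<le> M * (t - s)"
    by (rule chi_lipschitz[OF _ True _ e]) (use st M in auto)
  then show ?thesis using True by (simp add: abs_minus_commute)
next
  case False
  have "\<bar>chiHS n \<mu> s \<eta> - chiHS n \<mu> t \<eta>\<bar> \<le> M * (s - t)"
    by (rule chi_lipschitz[OF _ _ _ e]) (use st M False in auto)
  then show ?thesis using False by simp
qed

lemma chi_indicator_meas:
  "t \<ge> 0 \<Longrightarrow> (\<lambda>\<eta>. indicator {0<..<NN} \<eta> * chiHS n \<mu> t \<eta>) \<in> borel_measurable borel"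
proof -
  assume "t \<ge> 0"
  then have "chi0 t \<in> borel_measurable borel" by (rule chi0_meas)
  moreover have "chi0 t = (\<lambda>\<eta>. indicator {0<..<NN} \<eta> * chiHS n \<mu> t \<eta>)" by (auto simp: chi0_def indicator_def)
  ultimately show ?thesis by simp
qed

lemma Lp_on_bounded:
  assumes m: "(\<lambda>\<eta>. indicator {0<..<NN} \<eta> * f \<eta>) \<in> borel_measurable borel" and g: "\<gamma> \<ge> 0"
    and b: "AE \<eta> in lborel. \<eta> \<in> {0<..<NN} \<longrightarrow> \<bar>f \<eta>\<bar> \<le> B"
  shows "Lp_on \<gamma> {0..NN} f"
  unfolding Lp_on_def
proof
  show "set_borel_measurable lborel {0..NN} f" by (rule set_borel_measurable_Icc_of_Ioo[OF m])
  have "(\<integral>\<^sup>+\<eta>\<in>{0..NN}. ennreal (\<bar>f \<eta>\<bar> powr \<gamma>) \<partial>lborel) \<le> (\<integral>\<^sup>+\<eta>\<in>{0<..<NN}. ennreal (B powr \<gamma>) \<partial>lborel)"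
    unfolding nn_integral_Icc_eq_Ioo
  proof (rule nn_integral_mono_AE)
    show "AE \<eta> in lborel. ennreal (\<bar>f \<eta>\<bar> powr \<gamma>) * indicator {0<..<NN} \<eta> \<le> ennreal (B powr \<gamma>) * indicator {0<..<NN} \<eta>"
      using b by eventually_elim (auto simp: indicator_def intro!: ennreal_leI powr_mono2 g)
  qed
  also have "\<dots> = ennreal (B powr \<gamma>) * ennreal NN" using NN_pos by (simp add: nn_integral_cmult_indicator)
  also have "\<dots> < \<infinity>" by (simp add: ennreal_mult_less_top)
  finally show "(\<integral>\<^sup>+\<eta>\<in>{0..NN}. ennreal (\<bar>f \<eta>\<bar> powr \<gamma>) \<partial>lborel) < \<infinity>" .
qed

text \<open>Integrability at time \<open>0\<close>, where the moment hypothesis lives, propagates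
  because \<chi> moves by at most \<open>M * t\<close>.\<close>

lemma Lp_on_chi:
  assumes g: "\<gamma> > 2" "real n \<ge> \<gamma>" and m: "(\<integral>\<^sup>+x. ennreal (1 + \<bar>x\<bar> powr \<gamma>) \<partial>\<mu> 0) < \<infinity>"
    and M: "\<And>s y. s \<in> {0..T} \<Longrightarrow> \<bar>u s y\<bar> \<le> M" and t: "t \<in> {0..T}"
  shows "Lp_on \<gamma> {0..NN} (chiHS n \<mu> t)"
  unfolding Lp_on_def
proof
  have t0: "t \<ge> 0" using t by simp
  show "set_borel_measurable lborel {0..NN} (chiHS n \<mu> t)"
    by (rule set_borel_measurable_Icc_of_Ioo[OF chi_indicator_meas[OF t0]])
  have [measurable]: "chi0 0 \<in> borel_measurable borel" by (rule chi0_meas) simp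
  have "(\<integral>\<^sup>+\<eta>\<in>{0..NN}. ennreal (\<bar>chiHS n \<mu> t \<eta>\<bar> powr \<gamma>) \<partial>lborel) \<le>
     (\<integral>\<^sup>+\<eta>. ennreal (2 powr \<gamma>) * (ennreal (\<bar>chi0 0 \<eta>\<bar> powr \<gamma>) * indicator {0<..<NN} \<eta> + ennreal (\<bar>M * t\<bar> powr \<gamma>) * indicator {0<..<NN} \<eta>) \<partial>lborel)"
    unfolding nn_integral_Icc_eq_Ioo
  proof (rule nn_integral_mono)
    fix \<eta>
    show "ennreal (\<bar>chiHS n \<mu> t \<eta>\<bar> powr \<gamma>) * indicator {0<..<NN} \<eta> \<le>
      ennreal (2 powr \<gamma>) * (ennreal (\<bar>chi0 0 \<eta>\<bar> powr \<gamma>) * indicator {0<..<NN} \<eta> + ennreal (\<bar>M * t\<bar> powr \<gamma>) * indicator {0<..<NN} \<eta>)"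
    proof (cases "\<eta> \<in> {0<..<NN}")
      case True
      have "\<bar>chiHS n \<mu> t \<eta> - chiHS n \<mu> 0 \<eta>\<bar> \<le> M * \<bar>t - 0\<bar>"
        by (rule chi_dist[OF M]) (use t True in auto)
      then have "\<bar>chiHS n \<mu> t \<eta>\<bar> \<le> \<bar>\<bar>chi0 0 \<eta>\<bar> + \<bar>M * t\<bar>\<bar>" using True t by (simp add: chi0_def)
      then have "\<bar>chiHS n \<mu> t \<eta>\<bar> powr \<gamma> \<le> \<bar>\<bar>chi0 0 \<eta>\<bar> + \<bar>M * t\<bar>\<bar> powr \<gamma>" using g by (intro powr_mono2) auto
      also have "\<dots> \<le> 2 powr \<gamma> * (\<bar>\<bar>chi0 0 \<eta>\<bar>\<bar> powr \<gamma> + \<bar>\<bar>M * t\<bar>\<bar> powr \<gamma>)" using g by (intro powr_add_le) auto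
      finally have "ennreal (\<bar>chiHS n \<mu> t \<eta>\<bar> powr \<gamma>) \<le> ennreal (2 powr \<gamma> * (\<bar>chi0 0 \<eta>\<bar> powr \<gamma> + \<bar>M * t\<bar> powr \<gamma>))"
        unfolding abs_idempotent by (rule ennreal_leI)
      then show ?thesis using True by (simp add: ennreal_mult)
    qed simp
  qed
  also have "\<dots> = ennreal (2 powr \<gamma>) * ((\<integral>\<^sup>+\<eta>\<in>{0<..<NN}. ennreal (\<bar>chi0 0 \<eta>\<bar> powr \<gamma>) \<partial>lborel) + ennreal (\<bar>M * t\<bar> powr \<gamma>) * ennreal NN)"
    using NN_pos by (simp add: nn_integral_cmult nn_integral_add nn_integral_cmult_indicator)
  also have "\<dots> < \<infinity>" using chi0_moment[OF g m] by (simp add: ennreal_mult_less_top)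
  finally show "(\<integral>\<^sup>+\<eta>\<in>{0..NN}. ennreal (\<bar>chiHS n \<mu> t \<eta>\<bar> powr \<gamma>) \<partial>lborel) < \<infinity>" .
qed

text \<open>The bound \<open>M * \<bar>s - t\<bar>\<close> is uniform in \<eta> and the interval has
  finite length; times at which \<open>\<mu>(t)\<close> has atoms are included.\<close>

lemma Lp_dist_chi_tendsto:
  assumes g: "\<gamma> > 0" and M: "\<And>s y. s \<in> {0..T} \<Longrightarrow> \<bar>u s y\<bar> \<le> M" and t: "t \<in> {0..T}"
  shows "((\<lambda>s. Lp_dist_pow \<gamma> {0..NN} (chiHS n \<mu> s) (chiHS n \<mu> t)) \<longlongrightarrow> 0) (at t within {0..T})"
proof (rule tendsto_sandwich)
  show "\<forall>\<^sub>F s in at t within {0..T}. 0 \<le> Lp_dist_pow \<gamma> {0..NN} (chiHS n \<mu> s) (chiHS n \<mu> t)" by simp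
  have "Lp_dist_pow \<gamma> {0..NN} (chiHS n \<mu> s) (chiHS n \<mu> t) \<le> ennreal ((M * \<bar>s - t\<bar>) powr \<gamma> * NN)" if s: "s \<in> {0..T}" for s
  proof -
    have "Lp_dist_pow \<gamma> {0..NN} (chiHS n \<mu> s) (chiHS n \<mu> t) \<le> (\<integral>\<^sup>+\<eta>\<in>{0<..<NN}. ennreal ((M * \<bar>s - t\<bar>) powr \<gamma>) \<partial>lborel)"
      unfolding Lp_dist_pow_def nn_integral_Icc_eq_Ioo
      by (rule nn_integral_mono)
         (use chi_dist[OF M s t] g in \<open>auto simp: indicator_def intro!: ennreal_leI powr_mono2\<close>)
    also have "\<dots> = ennreal ((M * \<bar>s - t\<bar>) powr \<gamma> * NN)" using NN_pos by (simp add: nn_integral_cmult_indicator ennreal_mult)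
    finally show ?thesis .
  qed
  then show "\<forall>\<^sub>F s in at t within {0..T}. Lp_dist_pow \<gamma> {0..NN} (chiHS n \<mu> s) (chiHS n \<mu> t) \<le> ennreal ((M * \<bar>s - t\<bar>) powr \<gamma> * NN)"
    by (simp add: eventually_at_filter)
  have M0: "M \<ge> 0" using M[OF t, of 0] by linarith
  have l: "((\<lambda>s. M * \<bar>s - t\<bar>) \<longlongrightarrow> M * \<bar>t - t\<bar>) (at t within {0..T})" by (intro tendsto_intros)
  then have l: "((\<lambda>s. M * \<bar>s - t\<bar>) \<longlongrightarrow> 0) (at t within {0..T})" by simp
  have "((\<lambda>s. (M * \<bar>s - t\<bar>) powr \<gamma>) \<longlongrightarrow> 0 powr \<gamma>) (at t within {0..T})"
    by (rule tendsto_powr'[OF l tendsto_const]) (use g M0 in auto)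
  then have "((\<lambda>s. (M * \<bar>s - t\<bar>) powr \<gamma> * NN) \<longlongrightarrow> 0 * NN) (at t within {0..T})"
    by (intro tendsto_mult tendsto_const) simp
  then show "((\<lambda>s. ennreal ((M * \<bar>s - t\<bar>) powr \<gamma> * NN)) \<longlongrightarrow> 0) (at t within {0..T})"
    using tendsto_ennrealI by fastforce
qed simp

end

context measure_transport_atomless
begin

text \<open>\<open>F\<close> inherits the bound \<open>M\<close> from the quotients of which it is
  the limit. This replaces separate estimates of \<open>h\<close> and of \<open>chi_eta\<close>,
  which may be unbounded near the ends of the interval.\<close>

lemma chi_time_derivative_Lp:
  fixes T \<gamma> M :: real
  defines "F \<equiv> \<lambda>\<eta>. UHS n u \<mu> t \<eta> - hHS n u \<mu> t \<eta> * chi_eta n \<mu> t \<eta>"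
  assumes g: "\<gamma> > 0" and M: "\<And>s y. s \<in> {0..T} \<Longrightarrow> \<bar>u s y\<bar> \<le> M" and T: "T > 0" "t \<in> {0..T}"
  shows "Lp_on \<gamma> {0..NN} F"
    and "((\<lambda>s. Lp_dist_pow \<gamma> {0..NN} (\<lambda>\<eta>. (chiHS n \<mu> (t + s) \<eta> - chi \<eta>) / s) F) \<longlongrightarrow> 0) (at 0 within {s. t + s \<in> {0..T}})"
proof -
  let ?S = "{s. t + s \<in> {0..T}}"
  have S: "?S = {- t..T - t}" by auto
  \<comment> \<open>The bound passes to the limit only if \<open>0\<close> is an accumulation point
    of the admissible increments; at \<open>t = 0\<close> and \<open>t = T\<close> these lie on one
    side.\<close>
  have nt: "at 0 within ?S \<noteq> bot"
  proof -
    have "0 islimpt {- t..T - t}"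
    proof (rule connected_imp_perfect)
      have "- t \<in> {- t..T - t}" "T - t \<in> {- t..T - t}" "- t \<noteq> T - t" using T by auto
      then show "{- t..T - t} \<noteq> {a}" for a by (metis singletonD)
    qed (use T in auto)
    then show ?thesis unfolding S by (simp add: trivial_limit_within)
  qed
  have Fm: "(\<lambda>\<eta>. indicator {0<..<NN} \<eta> * F \<eta>) \<in> borel_measurable borel"
    unfolding F_def by (rule chi_time_rhs_meas)
  have quot: "\<bar>(chiHS n \<mu> (t + s) \<eta> - chi \<eta>) / s\<bar> \<le> M" if "s \<in> ?S" "s \<noteq> 0" "0 < \<eta>" "\<eta> < NN" for s \<eta>
    using chi_dist[OF M _ T(2) that(3,4), of "t + s"] that by (simp add: abs_divide divide_le_eq)
  have lim: "AE \<eta> in lborel. \<eta> \<in> {0<..<NN} \<longrightarrow> ((\<lambda>s. (chiHS n \<mu> (t + s) \<eta> - chi \<eta>) / s) \<longlongrightarrow> F \<eta>) (at 0 within ?S)"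
    using AE_chi_differentiable
  proof eventually_elim
    case (elim \<eta>)
    show ?case
    proof
      assume e: "\<eta> \<in> {0<..<NN}"
      then have "((\<lambda>s. (chiHS n \<mu> (t + s) \<eta> - chi \<eta>) / s) \<longlongrightarrow> F \<eta>) (at 0 within {s. 0 \<le> t + s})"
        unfolding F_def using elim by (intro chi_time_derivative_hHS) auto
      then show "((\<lambda>s. (chiHS n \<mu> (t + s) \<eta> - chi \<eta>) / s) \<longlongrightarrow> F \<eta>) (at 0 within ?S)"
        by (rule tendsto_within_subset) auto
    qed
  qed
  have Fb: "AE \<eta> in lborel. \<eta> \<in> {0<..<NN} \<longrightarrow> \<bar>F \<eta>\<bar> \<le> M"
    using lim
  proof eventually_elim
    case (elim \<eta>)
    show ?case
    proof
      assume e: "\<eta> \<in> {0<..<NN}"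
      then have "((\<lambda>s. \<bar>(chiHS n \<mu> (t + s) \<eta> - chi \<eta>) / s\<bar>) \<longlongrightarrow> \<bar>F \<eta>\<bar>) (at 0 within ?S)"
        using elim by (intro tendsto_rabs) simp
      then show "\<bar>F \<eta>\<bar> \<le> M"
        by (rule tendsto_upperbound[OF _ _ nt]) (use quot e in \<open>auto simp: eventually_at_filter\<close>)
    qed
  qed
  show "Lp_on \<gamma> {0..NN} F" by (rule Lp_on_bounded[OF Fm _ Fb]) (use g in simp)
  show "((\<lambda>s. Lp_dist_pow \<gamma> {0..NN} (\<lambda>\<eta>. (chiHS n \<mu> (t + s) \<eta> - chi \<eta>) / s) F) \<longlongrightarrow> 0) (at 0 within ?S)"
    \<comment> \<open>Dominated convergence is a statement about sequences, so the limit is tested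
      along sequences of increments.\<close>
    unfolding tendsto_at_iff_sequentially o_def
  proof (intro allI impI)
    fix X assume X: "\<forall>i. X i \<in> ?S - {0}" and X0: "X \<longlonglongrightarrow> 0"
    define w where "w i \<eta> = ennreal (\<bar>(chiHS n \<mu> (t + X i) \<eta> - chi \<eta>) / X i - F \<eta>\<bar> powr \<gamma>) * indicator {0<..<NN} \<eta>" for i \<eta>
    have "(\<lambda>i. \<integral>\<^sup>+\<eta>. w i \<eta> \<partial>lborel) \<longlonglongrightarrow> (\<integral>\<^sup>+\<eta>. 0 \<partial>(lborel :: real measure))"
    proof (rule nn_integral_dominated_convergence[where w="\<lambda>\<eta>. ennreal ((2 * M) powr \<gamma>) * indicator {0<..<NN} \<eta>"])
      show "w i \<in> borel_measurable lborel" for i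
      proof -
        have "0 \<le> t + X i" using X by auto
        note [measurable] = chi_indicator_meas[OF this] chi_indicator_meas[OF t] Fm
        have "w i = (\<lambda>\<eta>. ennreal (\<bar>(indicator {0<..<NN} \<eta> * chiHS n \<mu> (t + X i) \<eta> - indicator {0<..<NN} \<eta> * chi \<eta>) / X i
            - indicator {0<..<NN} \<eta> * F \<eta>\<bar> powr \<gamma>) * indicator {0<..<NN} \<eta>)"
          unfolding w_def by (auto simp: fun_eq_iff indicator_def)
        also have "\<dots> \<in> borel_measurable borel" by measurable
        finally show ?thesis by simp
      qed
      show "AE \<eta> in lborel. w i \<eta> \<le> ennreal ((2 * M) powr \<gamma>) * indicator {0<..<NN} \<eta>" for i
        using Fb
      proof eventually_elim
        case (elim \<eta>)
        show ?case
        proof (cases "\<eta> \<in> {0<..<NN}")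
          case True
          have "\<bar>(chiHS n \<mu> (t + X i) \<eta> - chi \<eta>) / X i\<bar> \<le> M" by (rule quot) (use X True in auto)
          moreover have "\<bar>F \<eta>\<bar> \<le> M" using elim True by simp
          ultimately have "\<bar>(chiHS n \<mu> (t + X i) \<eta> - chi \<eta>) / X i - F \<eta>\<bar> \<le> 2 * M" by linarith
          then show ?thesis unfolding w_def using True g by (auto intro!: ennreal_leI powr_mono2)
        qed (simp add: w_def)
      qed
      show "AE \<eta> in lborel. (\<lambda>i. w i \<eta>) \<longlonglongrightarrow> 0"
        using lim
      proof eventually_elim
        case (elim \<eta>)
        show ?case
        proof (cases "\<eta> \<in> {0<..<NN}")
          case True
          then have "(\<lambda>i. (chiHS n \<mu> (t + X i) \<eta> - chi \<eta>) / X i) \<longlonglongrightarrow> F \<eta>"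
            using elim X X0 unfolding tendsto_at_iff_sequentially o_def by blast
          then have "(\<lambda>i. \<bar>(chiHS n \<mu> (t + X i) \<eta> - chi \<eta>) / X i - F \<eta>\<bar>) \<longlonglongrightarrow> \<bar>F \<eta> - F \<eta>\<bar>"
            by (intro tendsto_rabs tendsto_diff tendsto_const)
          then have l: "(\<lambda>i. \<bar>(chiHS n \<mu> (t + X i) \<eta> - chi \<eta>) / X i - F \<eta>\<bar>) \<longlonglongrightarrow> 0" by simp
          have "(\<lambda>i. \<bar>(chiHS n \<mu> (t + X i) \<eta> - chi \<eta>) / X i - F \<eta>\<bar> powr \<gamma>) \<longlonglongrightarrow> 0 powr \<gamma>"
            by (rule tendsto_powr'[OF l tendsto_const]) (use g in auto)
          then have "(\<lambda>i. ennreal (\<bar>(chiHS n \<mu> (t + X i) \<eta> - chi \<eta>) / X i - F \<eta>\<bar> powr \<gamma>)) \<longlonglongrightarrow> ennreal 0"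
            by (intro tendsto_ennrealI) simp
          then show ?thesis unfolding w_def using True by simp
        qed (simp add: w_def)
      qed
      show "(\<integral>\<^sup>+\<eta>. ennreal ((2 * M) powr \<gamma>) * indicator {0<..<NN} \<eta> \<partial>lborel) < \<infinity>"
        using NN_pos by (simp add: nn_integral_cmult_indicator ennreal_mult_less_top)
    qed auto
    then show "(\<lambda>i. Lp_dist_pow \<gamma> {0..NN} (\<lambda>\<eta>. (chiHS n \<mu> (t + X i) \<eta> - chi \<eta>) / X i) F) \<longlonglongrightarrow> 0"
      unfolding Lp_dist_pow_def nn_integral_Icc_eq_Ioo w_def by simp
  qed
qed

end

text \<open>The time derivative is the limit of difference quotients in
  \<open>L\<^sup>\<gamma>\<close>, one-sided at the ends of \<open>[0, T]\<close>.
  \<open>Lp_dist_pow\<close> is the \<gamma>-th power of the distance, which tends to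
  \<open>0\<close> together with it, and the first conjunct places \<open>\<chi>(t,\<cdot>)\<close>
  in the space.\<close>

theorem theorem5p3:
  fixes \<psi>p \<psi>m :: "real \<Rightarrow> real" and u :: "real \<Rightarrow> real \<Rightarrow> real"
    and \<mu> :: "real \<Rightarrow> real measure" and \<gamma> T :: real and n :: nat
  assumes psi: "cutoff_pair \<psi>p \<psi>m"
    and sol: "HS_weak_conservative \<psi>p \<psi>m u \<mu>"
    and gamma: "\<gamma> > 2" and n: "real n \<ge> \<gamma>"
    and moment: "(\<integral>\<^sup>+ x. ennreal (1 + \<bar>x\<bar> powr \<gamma>) \<partial>\<mu> 0) < \<infinity>"
    and T: "T > 0"
  shows "(\<forall>t\<in>{0..T}. Lp_on \<gamma> {0..BHS n \<mu> + CHS \<mu>} (chiHS n \<mu> t))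
    \<and> (AE t in lborel. t \<in> {0..T} \<longrightarrow>
          Lp_on \<gamma> {0..BHS n \<mu> + CHS \<mu>}
             (\<lambda>\<eta>. UHS n u \<mu> t \<eta> - hHS n u \<mu> t \<eta> * chi_eta n \<mu> t \<eta>)
        \<and> ((\<lambda>s. Lp_dist_pow \<gamma> {0..BHS n \<mu> + CHS \<mu>}
                 (\<lambda>\<eta>. (chiHS n \<mu> (t + s) \<eta> - chiHS n \<mu> t \<eta>) / s)
                 (\<lambda>\<eta>. UHS n u \<mu> t \<eta> - hHS n u \<mu> t \<eta> * chi_eta n \<mu> t \<eta>))
            \<longlongrightarrow> 0) (at 0 within {s. t + s \<in> {0..T}}))
    \<and> (\<forall>t\<in>{0..T}. ((\<lambda>s. Lp_dist_pow \<gamma> {0..BHS n \<mu> + CHS \<mu>} (chiHS n \<mu> s) (chiHS n \<mu> t))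
            \<longlongrightarrow> 0) (at t within {0..T}))"
proof -
  interpret measure_transport \<psi>p u \<mu> by (rule measure_transport_of_solution[OF psi sol])
  have n1: "n \<ge> 1" using n gamma by (cases n) auto
  show ?thesis
  proof (cases "measure (\<mu> 0) UNIV > 0")
    case True
    interpret measure_transport_kernel \<psi>p u \<mu> n by unfold_locales (use n1 True in auto)
    obtain M where M: "M \<ge> 0" "\<And>s y. s \<in> {0..T} \<Longrightarrow> \<bar>u s y\<bar> \<le> M" using u_bound[of T] by blast
    \<comment> \<open>Condition (v) provides the atomless times.\<close>
    have "AE t in lborel. t \<ge> 0 \<longrightarrow> \<mu> t = density lborel (\<lambda>x. ennreal ((deriv (u t) x)\<^sup>2))"
      using sol unfolding HS_weak_conservative_def by blast
    then have "AE t in lborel. t \<in> {0..T} \<longrightarrow>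
          Lp_on \<gamma> {0..BHS n \<mu> + CHS \<mu>} (\<lambda>\<eta>. UHS n u \<mu> t \<eta> - hHS n u \<mu> t \<eta> * chi_eta n \<mu> t \<eta>)
        \<and> ((\<lambda>s. Lp_dist_pow \<gamma> {0..BHS n \<mu> + CHS \<mu>} (\<lambda>\<eta>. (chiHS n \<mu> (t + s) \<eta> - chiHS n \<mu> t \<eta>) / s)
                 (\<lambda>\<eta>. UHS n u \<mu> t \<eta> - hHS n u \<mu> t \<eta> * chi_eta n \<mu> t \<eta>)) \<longlongrightarrow> 0) (at 0 within {s. t + s \<in> {0..T}})"
    proof eventually_elim
      case (elim t)
      show ?case
      proof
        assume t: "t \<in> {0..T}"
        then have mu: "\<mu> t = density lborel (\<lambda>x. ennreal ((deriv (u t) x)\<^sup>2))" using elim by simp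
        interpret A: measure_transport_atomless \<psi>p u \<mu> n t
        proof
          show "0 \<le> t" using t by simp
          show "measure (\<mu> t) {x} = 0" for x unfolding mu by (rule density_lborel_singleton)
        qed
        have "\<gamma> > 0" using gamma by simp
        from A.chi_time_derivative_Lp[OF this M(2) T t]
        show "Lp_on \<gamma> {0..BHS n \<mu> + CHS \<mu>} (\<lambda>\<eta>. UHS n u \<mu> t \<eta> - hHS n u \<mu> t \<eta> * chi_eta n \<mu> t \<eta>)
        \<and> ((\<lambda>s. Lp_dist_pow \<gamma> {0..BHS n \<mu> + CHS \<mu>} (\<lambda>\<eta>. (chiHS n \<mu> (t + s) \<eta> - chiHS n \<mu> t \<eta>) / s)
                 (\<lambda>\<eta>. UHS n u \<mu> t \<eta> - hHS n u \<mu> t \<eta> * chi_eta n \<mu> t \<eta>)) \<longlongrightarrow> 0) (at 0 within {s. t + s \<in> {0..T}})"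
          by blast
      qed
    qed
    moreover have "\<forall>t\<in>{0..T}. Lp_on \<gamma> {0..BHS n \<mu> + CHS \<mu>} (chiHS n \<mu> t)"
      using Lp_on_chi[OF gamma assms(4) moment M(2)] by blast
    moreover have "\<forall>t\<in>{0..T}. ((\<lambda>s. Lp_dist_pow \<gamma> {0..BHS n \<mu> + CHS \<mu>} (chiHS n \<mu> s) (chiHS n \<mu> t)) \<longlongrightarrow> 0) (at t within {0..T})"
      using Lp_dist_chi_tendsto[OF _ M(2)] gamma by auto
    ultimately show ?thesis by blast
  next
    \<comment> \<open>Without mass \<open>B + C = 0\<close>: the interval is a single point, so
      every function belongs to the space and all distances vanish.\<close>
    case False
    then have C0: "measure (\<mu> 0) UNIV = 0" using measure_nonneg[of "\<mu> 0" UNIV] by linarith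
    then have N: "BHS n \<mu> + CHS \<mu> = 0"
      unfolding BHS_def CHS_def using pHS_integral[OF order_refl n1] by simp
    have z: "(\<integral>\<^sup>+x\<in>{0..0::real}. f x \<partial>lborel) = 0" for f :: "real \<Rightarrow> ennreal"
      unfolding nn_integral_Icc_eq_Ioo by simp
    have "Lp_on \<gamma> {0..0} f" for f
      unfolding Lp_on_def z by (intro conjI set_borel_measurable_Icc_of_Ioo) simp_all
    moreover have "Lp_dist_pow \<gamma> {0..0} f g = 0" for f g
      unfolding Lp_dist_pow_def z ..
    ultimately show ?thesis unfolding N by simp
  qed
qed

end
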